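(* Let $p\in[1,+\infty]$, let $Y$ be a Banach space containing uniformly the $\ell_p^n$'s, and let $M$ be a proper subset of $L_p$. For every $r<\frac{1}{16}$ and every surjective continuous non-decreasing function $\mu\colon(0,+\infty)\to(-\infty,0)$, there exists a map $f\colon M\to Y$ such that for every $x,y\in M$, $$2^{\mu(\|x-y\|_p)}\,r\,\|x-y\|_p\le\|f(x)-f(y)\|_Y\le 9\,\|x-y\|_p,$$ where the left-hand side is read as $0$ when $x=y$.
   Context: $L_p$ denotes the Lebesgue space $L_p([0,1])$ with its norm $\|\cdot\|_p$. A metric space is proper if all its closed balls are compact; a proper subset $M$ of $L_p$ means a subset which is a proper metric space for the metric induced by the norm. A Banach space $Y$ contains the $\ell_p^n$'s uniformly if there are $\lambda\in[1,\infty)$ and a sequence $(E_n)_{n=1}^\infty$ of subspaces of $Y$ such that, for each $n$, $E_n$ is linearly isomorphic to $\ell_p^n$ with Banach-Mazur distance $d_{BM}(E_n,\ell_p^n)\le\lambda$. *)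

theory Defs
  imports
    "HOL-Analysis.Analysis"
    "HOL-Probability.Essential_Supremum"
    "HOL-Library.Function_Algebras"
begin

section \<open>The spaces \<open>L\<^sub>p([0,1])\<close>\<close>

definition Lp_fun :: "ereal \<Rightarrow> (real \<Rightarrow> real) \<Rightarrow> bool" where
  "Lp_fun p f \<longleftrightarrow>
     (if p = \<infinity> then esssup (lebesgue_on {0..1}) (\<lambda>t. ereal \<bar>f t\<bar>) < \<infinity>
      else integrable (lebesgue_on {0..1}) (\<lambda>t. \<bar>f t\<bar> powr real_of_ereal p))"

definition Lp_seminorm :: "ereal \<Rightarrow> (real \<Rightarrow> real) \<Rightarrow> real" where
  "Lp_seminorm p f =
     (if p = \<infinity> then real_of_ereal (esssup (lebesgue_on {0..1}) (\<lambda>t. ereal \<bar>f t\<bar>))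
      else (LINT t|lebesgue_on {0..1}. \<bar>f t\<bar> powr real_of_ereal p) powr (1 / real_of_ereal p))"

text \<open>Classes of Lebesgue measurable real functions on \<open>[0,1]\<close> modulo equality almost everywhere;
  the values of a representative outside \<open>[0,1]\<close> play no role.\<close>

quotient_type L0 = "real \<Rightarrow> real" / partial:
  "\<lambda>f g. f \<in> borel_measurable (lebesgue_on {0..1}) \<and> g \<in> borel_measurable (lebesgue_on {0..1}) \<and>
     (AE t in lebesgue_on {0..1}. f t = g t)"
proof (rule part_equivpI)
  show "\<exists>f. f \<in> borel_measurable (lebesgue_on {0..1::real}) \<and> f \<in> borel_measurable (lebesgue_on {0..1}) \<and>
     (AE t in lebesgue_on {0..1}. (f t::real) = f t)"
    by (intro exI[of _ "\<lambda>_. 0"]) auto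
qed (auto intro!: sympI transpI elim: AE_mp)

instantiation L0 :: real_vector
begin

lift_definition zero_L0 :: L0 is "\<lambda>t. 0" by auto

lift_definition plus_L0 :: "L0 \<Rightarrow> L0 \<Rightarrow> L0" is "\<lambda>f g t. f t + g t"
  by (auto elim!: AE_mp)

lift_definition minus_L0 :: "L0 \<Rightarrow> L0 \<Rightarrow> L0" is "\<lambda>f g t. f t - g t"
  by (auto elim!: AE_mp)

lift_definition uminus_L0 :: "L0 \<Rightarrow> L0" is "\<lambda>f t. - f t"
  by auto

lift_definition scaleR_L0 :: "real \<Rightarrow> L0 \<Rightarrow> L0" is "\<lambda>c f t. c * f t"
  by (auto elim!: AE_mp)

instance
  by standard (transfer; auto simp: algebra_simps elim!: AE_mp)+

end

lift_definition in_Lp :: "ereal \<Rightarrow> L0 \<Rightarrow> bool" is Lp_fun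
proof -
  fix p and f g :: "real \<Rightarrow> real"
  assume A: "f \<in> borel_measurable (lebesgue_on {0..1}) \<and> g \<in> borel_measurable (lebesgue_on {0..1}) \<and>
     (AE t in lebesgue_on {0..1}. f t = g t)"
  have "esssup (lebesgue_on {0..1}) (\<lambda>t. ereal \<bar>f t\<bar>) = esssup (lebesgue_on {0..1}) (\<lambda>t. ereal \<bar>g t\<bar>)"
    using A by (intro esssup_AE_cong) auto
  moreover have "integrable (lebesgue_on {0..1}) (\<lambda>t. \<bar>f t\<bar> powr real_of_ereal p) =
      integrable (lebesgue_on {0..1}) (\<lambda>t. \<bar>g t\<bar> powr real_of_ereal p)"
    using A by (intro integrable_cong_AE) (auto elim!: AE_mp)
  ultimately show "Lp_fun p f = Lp_fun p g" by (simp add: Lp_fun_def)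
qed

lift_definition Lp_norm :: "ereal \<Rightarrow> L0 \<Rightarrow> real" is Lp_seminorm
proof -
  fix p and f g :: "real \<Rightarrow> real"
  assume A: "f \<in> borel_measurable (lebesgue_on {0..1}) \<and> g \<in> borel_measurable (lebesgue_on {0..1}) \<and>
     (AE t in lebesgue_on {0..1}. f t = g t)"
  have "esssup (lebesgue_on {0..1}) (\<lambda>t. ereal \<bar>f t\<bar>) = esssup (lebesgue_on {0..1}) (\<lambda>t. ereal \<bar>g t\<bar>)"
    using A by (intro esssup_AE_cong) auto
  moreover have "(LINT t|lebesgue_on {0..1}. \<bar>f t\<bar> powr real_of_ereal p) =
      (LINT t|lebesgue_on {0..1}. \<bar>g t\<bar> powr real_of_ereal p)"
    using A by (intro integral_cong_AE) (auto elim!: AE_mp)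
  ultimately show "Lp_seminorm p f = Lp_seminorm p g" by (simp add: Lp_seminorm_def)
qed

definition Lp :: "ereal \<Rightarrow> L0 set" where
  "Lp p = {x. in_Lp p x}"

definition Lp_dist :: "ereal \<Rightarrow> L0 \<Rightarrow> L0 \<Rightarrow> real" where
  "Lp_dist p x y = Lp_norm p (x - y)"


subsection \<open>The norm of \<open>L\<^sub>p\<close> induces a metric\<close>

lemma powr_convex_nonneg:
  fixes u v s q :: real
  assumes "u \<ge> 0" "v \<ge> 0" "0 < s" "s < 1" "q \<ge> 1"
  shows "(s * u + (1 - s) * v) powr q \<le> s * u powr q + (1 - s) * v powr q"
proof -
  have *: "(c * w) powr q \<le> c * w powr q" if "0 < c" "c < 1" "w \<ge> 0" for c w :: real
  proof -
    have "c powr q \<le> c powr 1"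
      using that assms by (intro powr_mono') auto
    then show ?thesis
      using that by (simp add: powr_mult mult_right_mono)
  qed
  show ?thesis
  proof (cases "u = 0 \<or> v = 0")
    case True
    then show ?thesis using * [of s u] * [of "1 - s" v] assms by auto
  next
    case False
    then show ?thesis
      using convex_onD[OF powr_convex[OF \<open>q \<ge> 1\<close>], of s v u] assms
      by (simp add: add.commute)
  qed
qed

lemma Lp_fun_add_finite:
  assumes f: "f \<in> borel_measurable (lebesgue_on {0..1})" "Lp_fun p f"
    and g: "g \<in> borel_measurable (lebesgue_on {0..1})" "Lp_fun p g"
    and p: "1 \<le> p" "p \<noteq> \<infinity>"
  shows "Lp_fun p (\<lambda>t. f t + g t)"
    and "Lp_seminorm p (\<lambda>t. f t + g t) \<le> Lp_seminorm p f + Lp_seminorm p g"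
proof -
  let ?M = "lebesgue_on {0..1::real}"
  define q where "q = real_of_ereal p"
  have q: "q \<ge> 1" using p by (cases p) (auto simp: q_def one_ereal_def)
  have int: "integrable ?M (\<lambda>t. \<bar>f t\<bar> powr q)" "integrable ?M (\<lambda>t. \<bar>g t\<bar> powr q)"
    using f g p by (auto simp: Lp_fun_def q_def)
  have pt: "\<bar>f t + g t\<bar> powr q \<le>
      (a + b) powr q * (a / (a + b) * (\<bar>f t\<bar> powr q / a powr q) + b / (a + b) * (\<bar>g t\<bar> powr q / b powr q))"
    if ab: "a > 0" "b > 0" for a b t
  proof -
    have e: "1 - a / (a + b) = b / (a + b)"
      using ab by (simp add: field_simps)
    have "\<bar>f t + g t\<bar> powr q \<le> (\<bar>f t\<bar> + \<bar>g t\<bar>) powr q"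
      using q by (intro powr_mono2) auto
    also have "\<bar>f t\<bar> + \<bar>g t\<bar> = (a + b) * (a / (a + b) * (\<bar>f t\<bar> / a) + b / (a + b) * (\<bar>g t\<bar> / b))"
      using ab by (simp add: distrib_left)
    also have "\<dots> powr q = (a + b) powr q * (a / (a + b) * (\<bar>f t\<bar> / a) + b / (a + b) * (\<bar>g t\<bar> / b)) powr q"
      by (rule powr_mult)
    also have "(a / (a + b) * (\<bar>f t\<bar> / a) + b / (a + b) * (\<bar>g t\<bar> / b)) powr q \<le>
        a / (a + b) * (\<bar>f t\<bar> / a) powr q + b / (a + b) * (\<bar>g t\<bar> / b) powr q"
      using powr_convex_nonneg[of "\<bar>f t\<bar> / a" "\<bar>g t\<bar> / b" "a / (a + b)" q] ab q unfolding e
      by simp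
    finally show ?thesis using ab by (simp add: powr_divide mult_left_mono)
  qed
  have intR: "integrable ?M (\<lambda>t. (a + b) powr q * (a / (a + b) * (\<bar>f t\<bar> powr q / a powr q) + b / (a + b) * (\<bar>g t\<bar> powr q / b powr q)))"
    for a b
    using int by (intro integrable_mult_right integrable_divide Bochner_Integration.integrable_add)
  have ints: "integrable ?M (\<lambda>t. \<bar>f t + g t\<bar> powr q)"
  proof (rule Bochner_Integration.integrable_bound[OF intR[of 1 1]])
    show "(\<lambda>t. \<bar>f t + g t\<bar> powr q) \<in> borel_measurable ?M"
      using f g by measurable
    show "AE t in ?M. norm (\<bar>f t + g t\<bar> powr q) \<le> norm ((1 + 1) powr q * (1 / (1 + 1) * (\<bar>f t\<bar> powr q / 1 powr q) + 1 / (1 + 1) * (\<bar>g t\<bar> powr q / 1 powr q)))"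
    proof (intro AE_I2)
      fix t show "norm (\<bar>f t + g t\<bar> powr q) \<le> norm ((1 + 1) powr q * (1 / (1 + 1) * (\<bar>f t\<bar> powr q / 1 powr q) + 1 / (1 + 1) * (\<bar>g t\<bar> powr q / 1 powr q)))"
        using pt[of 1 1 t] unfolding real_norm_def by (smt (verit) powr_ge_zero)
    qed
  qed
  then show "Lp_fun p (\<lambda>t. f t + g t)"
    using p by (simp add: Lp_fun_def q_def)
  define nf where "nf = (LINT t|?M. \<bar>f t\<bar> powr q)"
  define ng where "ng = (LINT t|?M. \<bar>g t\<bar> powr q)"
  have nn: "nf \<ge> 0" "ng \<ge> 0" by (auto simp: nf_def ng_def intro!: integral_nonneg_AE)
  have S: "(LINT t|?M. \<bar>f t + g t\<bar> powr q) powr (1 / q) \<le> nf powr (1/q) + ng powr (1/q) + e"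
    if "e > 0" for e
  proof -
    define a where "a = nf powr (1/q) + e / 2"
    define b where "b = ng powr (1/q) + e / 2"
    have ab: "a > 0" "b > 0"
      unfolding a_def b_def using that by (smt (verit) half_gt_zero powr_ge_zero)+
    have "nf = (nf powr (1/q)) powr q" using nn q by (simp add: powr_powr)
    also have "\<dots> \<le> a powr q" using q that by (intro powr_mono2) (auto simp: a_def)
    finally have A: "nf / a powr q \<le> 1" using ab by (simp add: divide_le_eq_1)
    have "ng = (ng powr (1/q)) powr q" using nn q by (simp add: powr_powr)
    also have "\<dots> \<le> b powr q" using q that by (intro powr_mono2) (auto simp: b_def)
    finally have B: "ng / b powr q \<le> 1" using ab by (simp add: divide_le_eq_1)
    have "(LINT t|?M. \<bar>f t + g t\<bar> powr q) \<le>
       (LINT t|?M. (a + b) powr q * (a / (a + b) * (\<bar>f t\<bar> powr q / a powr q) + b / (a + b) * (\<bar>g t\<bar> powr q / b powr q)))"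
      by (intro integral_mono ints intR pt ab)
    also have "\<dots> = (a + b) powr q * (a / (a + b) * (nf / a powr q) + b / (a + b) * (ng / b powr q))"
      using int by (simp add: nf_def ng_def)
    also have "\<dots> \<le> (a + b) powr q * (a / (a + b) * 1 + b / (a + b) * 1)"
      using ab A B by (intro mult_left_mono add_mono) auto
    also have "a / (a + b) * 1 + b / (a + b) * 1 = 1"
      using ab by (simp flip: add_divide_distrib)
    finally have "(LINT t|?M. \<bar>f t + g t\<bar> powr q) \<le> (a + b) powr q" by simp
    then have "(LINT t|?M. \<bar>f t + g t\<bar> powr q) powr (1/q) \<le> ((a + b) powr q) powr (1/q)"
      using q by (intro powr_mono2) (auto intro!: integral_nonneg_AE)
    also have "\<dots> = a + b" using q ab by (simp add: powr_powr)
    finally show ?thesis by (simp add: a_def b_def)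
  qed
  have "(LINT t|?M. \<bar>f t + g t\<bar> powr q) powr (1 / q) \<le> nf powr (1/q) + ng powr (1/q)"
    by (rule field_le_epsilon) (rule S)
  then show "Lp_seminorm p (\<lambda>t. f t + g t) \<le> Lp_seminorm p f + Lp_seminorm p g"
    using p by (simp add: Lp_seminorm_def q_def nf_def ng_def)
qed

lemma esssup_abs_nonneg:
  "0 \<le> esssup (lebesgue_on {0..1::real}) (\<lambda>t. ereal \<bar>f t\<bar>)"
proof (cases "(\<lambda>t. ereal \<bar>f t\<bar>) \<in> borel_measurable (lebesgue_on {0..1::real})")
  case True
  have "emeasure (lebesgue_on {0..1::real}) (space (lebesgue_on {0..1})) \<noteq> 0"
    by (simp add: emeasure_restrict_space space_restrict_space)
  then have "0 = esssup (lebesgue_on {0..1::real}) (\<lambda>t. 0::ereal)"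
    by (simp add: esssup_const)
  also have "\<dots> \<le> esssup (lebesgue_on {0..1::real}) (\<lambda>t. ereal \<bar>f t\<bar>)"
    by (intro esssup_mono) auto
  finally show ?thesis .
next
  case False
  then show ?thesis by (simp add: esssup_non_measurable top_ereal_def)
qed

lemma Lp_fun_add_infinite:
  assumes f: "f \<in> borel_measurable (lebesgue_on {0..1})" "Lp_fun \<infinity> f"
    and g: "g \<in> borel_measurable (lebesgue_on {0..1})" "Lp_fun \<infinity> g"
  shows "Lp_fun \<infinity> (\<lambda>t. f t + g t)"
    and "Lp_seminorm \<infinity> (\<lambda>t. f t + g t) \<le> Lp_seminorm \<infinity> f + Lp_seminorm \<infinity> g"
proof -
  let ?e = "\<lambda>h :: real \<Rightarrow> real. esssup (lebesgue_on {0..1}) (\<lambda>t. ereal \<bar>h t\<bar>)"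
  have "?e (\<lambda>t. f t + g t) \<le> esssup (lebesgue_on {0..1}) (\<lambda>t. ereal \<bar>f t\<bar> + ereal \<bar>g t\<bar>)"
    using f g by (intro esssup_mono) auto
  also have "\<dots> \<le> ?e f + ?e g" by (rule esssup_add)
  finally have le: "?e (\<lambda>t. f t + g t) \<le> ?e f + ?e g" .
  have fin: "?e f < \<infinity>" "?e g < \<infinity>" using f g by (auto simp: Lp_fun_def)
  show "Lp_fun \<infinity> (\<lambda>t. f t + g t)"
    using le fin by (auto simp: Lp_fun_def)
  show "Lp_seminorm \<infinity> (\<lambda>t. f t + g t) \<le> Lp_seminorm \<infinity> f + Lp_seminorm \<infinity> g"
    using le fin esssup_abs_nonneg[of f] esssup_abs_nonneg[of g]
      esssup_abs_nonneg[of "\<lambda>t. f t + g t"]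
    by (cases "?e f"; cases "?e g"; cases "?e (\<lambda>t. f t + g t)") (auto simp: Lp_seminorm_def)
qed

lemma Lp_add:
  assumes "1 \<le> p" "x \<in> Lp p" "y \<in> Lp p"
  shows "x + y \<in> Lp p" "Lp_norm p (x + y) \<le> Lp_norm p x + Lp_norm p y"
proof -
  have "in_Lp p (x + y) \<and> Lp_norm p (x + y) \<le> Lp_norm p x + Lp_norm p y"
    using assms unfolding Lp_def mem_Collect_eq
  proof transfer
    fix p and f g :: "real \<Rightarrow> real"
    assume "1 \<le> p"
      and "f \<in> borel_measurable (lebesgue_on {0..1}) \<and> f \<in> borel_measurable (lebesgue_on {0..1}) \<and>
        (AE t in lebesgue_on {0..1}. f t = f t)" and "Lp_fun p f"
      and "g \<in> borel_measurable (lebesgue_on {0..1}) \<and> g \<in> borel_measurable (lebesgue_on {0..1}) \<and>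
        (AE t in lebesgue_on {0..1}. g t = g t)" and "Lp_fun p g"
    then show "Lp_fun p (\<lambda>t. f t + g t) \<and> Lp_seminorm p (\<lambda>t. f t + g t) \<le> Lp_seminorm p f + Lp_seminorm p g"
      using Lp_fun_add_finite[of f p g] Lp_fun_add_infinite[of f g] by (cases "p = \<infinity>") simp_all
  qed
  then show "x + y \<in> Lp p" "Lp_norm p (x + y) \<le> Lp_norm p x + Lp_norm p y"
    by (auto simp: Lp_def)
qed

lemma Lp_uminus: "x \<in> Lp p \<Longrightarrow> - x \<in> Lp p"
  unfolding Lp_def mem_Collect_eq by transfer (simp only: Lp_fun_def abs_minus_cancel)

lemma Lp_norm_uminus: "Lp_norm p (- x) = Lp_norm p x"
  by transfer (simp add: Lp_seminorm_def)

lemma Lp_norm_nonneg: "0 \<le> Lp_norm p x"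
  by transfer (auto simp: Lp_seminorm_def intro!: real_of_ereal_pos esssup_abs_nonneg)

lemma Lp_norm_eq_0:
  assumes "1 \<le> p" "x \<in> Lp p"
  shows "Lp_norm p x = 0 \<longleftrightarrow> x = 0"
  using assms unfolding Lp_def mem_Collect_eq
proof transfer
  fix p and f :: "real \<Rightarrow> real"
  let ?M = "lebesgue_on {0..1::real}"
  assume p: "1 \<le> p" and "f \<in> borel_measurable ?M \<and> f \<in> borel_measurable ?M \<and> (AE t in ?M. f t = f t)"
    and L: "Lp_fun p f"
  then have f: "f \<in> borel_measurable ?M" by simp
  have "Lp_seminorm p f = 0 \<longleftrightarrow> (AE t in ?M. f t = 0)"
  proof (cases "p = \<infinity>")
    case True
    let ?e = "esssup ?M (\<lambda>t. ereal \<bar>f t\<bar>)"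
    have "?e < \<infinity>" using L True by (simp add: Lp_fun_def)
    then have "Lp_seminorm p f = 0 \<longleftrightarrow> ?e = 0"
      using esssup_abs_nonneg[of f] True by (cases ?e) (auto simp: Lp_seminorm_def)
    also have "\<dots> \<longleftrightarrow> ?e \<le> 0" using esssup_abs_nonneg[of f] by auto
    also have "\<dots> \<longleftrightarrow> (AE t in ?M. f t = 0)"
    proof
      assume "?e \<le> 0"
      have "f t = 0" if "ereal \<bar>f t\<bar> \<le> ?e" for t
        using order_trans[OF that \<open>?e \<le> 0\<close>] by (simp add: zero_ereal_def)
      with esssup_AE[of "\<lambda>t. ereal \<bar>f t\<bar>" ?M] show "AE t in ?M. f t = 0"
        by (rule eventually_mono)
    next
      assume "AE t in ?M. f t = 0"
      then show "?e \<le> 0" using f by (intro esssup_I) auto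
    qed
    finally show ?thesis .
  next
    case False
    define q where "q = real_of_ereal p"
    have q: "q \<ge> 1" using p False by (cases p) (auto simp: q_def one_ereal_def)
    have "integrable ?M (\<lambda>t. \<bar>f t\<bar> powr q)" using L False by (simp add: Lp_fun_def q_def)
    then have "(LINT t|?M. \<bar>f t\<bar> powr q) = 0 \<longleftrightarrow> (AE t in ?M. \<bar>f t\<bar> powr q = 0)"
      by (intro integral_nonneg_eq_0_iff_AE) auto
    then show ?thesis using q False by (simp add: Lp_seminorm_def q_def)
  qed
  then show "Lp_seminorm p f = 0 \<longleftrightarrow>
     f \<in> borel_measurable ?M \<and> (\<lambda>t. 0::real) \<in> borel_measurable ?M \<and> (AE t in ?M. f t = 0)"
    using f by simp
qed

lemma Metric_space_Lp:
  assumes "1 \<le> p"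
  shows "Metric_space (Lp p) (Lp_dist p)"
proof
  have D: "x - y \<in> Lp p" if "x \<in> Lp p" "y \<in> Lp p" for x y
    using Lp_add(1)[OF assms that(1) Lp_uminus[OF that(2)]] by simp
  fix x y z :: L0
  show "0 \<le> Lp_dist p x y" by (simp add: Lp_dist_def Lp_norm_nonneg)
  show "Lp_dist p x y = Lp_dist p y x"
    unfolding Lp_dist_def using Lp_norm_uminus[of p "x - y"] by simp
  show "Lp_dist p x y = 0 \<longleftrightarrow> x = y" if "x \<in> Lp p" "y \<in> Lp p"
    using Lp_norm_eq_0[OF assms D[OF that]] by (simp add: Lp_dist_def)
  show "Lp_dist p x z \<le> Lp_dist p x y + Lp_dist p y z"
    if "x \<in> Lp p" "y \<in> Lp p" "z \<in> Lp p"
    using Lp_add(2)[OF assms D[of x y] D[of y z]] that by (simp add: Lp_dist_def)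
qed


section \<open>Proper metric spaces\<close>

definition proper_metric_space :: "'a set \<Rightarrow> ('a \<Rightarrow> 'a \<Rightarrow> real) \<Rightarrow> bool" where
  "proper_metric_space M d \<longleftrightarrow>
     Metric_space M d \<and>
     (\<forall>x\<in>M. \<forall>r. compactin (Metric_space.mtopology M d) (Metric_space.mcball M d x r))"


section \<open>Banach--Mazur distance and the spaces \<open>\<ell>\<^sub>p\<^sup>n\<close>\<close>

text \<open>A normed space is given here by a linear subspace \<open>E\<close> of a real vector space together with a
  function \<open>N\<close> which is a norm on \<open>E\<close>.\<close>

definition bounded_linear_between ::
  "'a::real_vector set \<Rightarrow> ('a \<Rightarrow> real) \<Rightarrow> 'b::real_vector set \<Rightarrow> ('b \<Rightarrow> real) \<Rightarrow> ('a \<Rightarrow> 'b) \<Rightarrow> bool" where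
  "bounded_linear_between E NE F NF T \<longleftrightarrow>
     T ` E \<subseteq> F \<and>
     (\<forall>x\<in>E. \<forall>y\<in>E. T (x + y) = T x + T y) \<and>
     (\<forall>c. \<forall>x\<in>E. T (c *\<^sub>R x) = c *\<^sub>R T x) \<and>
     (\<exists>K. \<forall>x\<in>E. NF (T x) \<le> K * NE x)"

text \<open>As for \<^const>\<open>onorm\<close>, the quotient at the zero vector is \<open>0 / 0 = 0\<close>.\<close>

definition onorm_between ::
  "'a set \<Rightarrow> ('a \<Rightarrow> real) \<Rightarrow> ('b \<Rightarrow> real) \<Rightarrow> ('a \<Rightarrow> 'b) \<Rightarrow> real" where
  "onorm_between E NE NF T = (SUP x\<in>E. NF (T x) / NE x)"

definition linear_isomorphisms ::
  "'a::real_vector set \<Rightarrow> ('a \<Rightarrow> real) \<Rightarrow> 'b::real_vector set \<Rightarrow> ('b \<Rightarrow> real) \<Rightarrow> ('a \<Rightarrow> 'b) set" where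
  "linear_isomorphisms E NE F NF =
     {T. bij_betw T E F \<and> bounded_linear_between E NE F NF T \<and>
         bounded_linear_between F NF E NE (inv_into E T)}"

text \<open>Meaningful only if \<^const>\<open>linear_isomorphisms\<close> is nonempty.\<close>

definition banach_mazur_dist ::
  "'a::real_vector set \<Rightarrow> ('a \<Rightarrow> real) \<Rightarrow> 'b::real_vector set \<Rightarrow> ('b \<Rightarrow> real) \<Rightarrow> real" where
  "banach_mazur_dist E NE F NF =
     (INF T\<in>linear_isomorphisms E NE F NF.
        onorm_between E NE NF T * onorm_between F NF NE (inv_into E T))"

instantiation "fun" :: (type, real_vector) real_vector
begin

definition "c *\<^sub>R f = (\<lambda>x. c *\<^sub>R f x)"

instance
  by standard (auto simp: scaleR_fun_def fun_eq_iff algebra_simps)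

end

text \<open>\<open>\<real>\<^sup>n\<close> is realised as the space of real sequences vanishing from index \<open>n\<close> on, so that \<open>n\<close> can
  be quantified over.\<close>

definition lpn_space :: "nat \<Rightarrow> (nat \<Rightarrow> real) set" where
  "lpn_space n = {x. \<forall>i\<ge>n. x i = 0}"

definition lpn_norm :: "ereal \<Rightarrow> nat \<Rightarrow> (nat \<Rightarrow> real) \<Rightarrow> real" where
  "lpn_norm p n x =
     (if p = \<infinity> then (MAX i\<in>{..<n}. \<bar>x i\<bar>)
      else (\<Sum>i<n. \<bar>x i\<bar> powr real_of_ereal p) powr (1 / real_of_ereal p))"

definition contains_lpn_uniformly :: "ereal \<Rightarrow> 'b::banach itself \<Rightarrow> bool" where
  "contains_lpn_uniformly p (_ :: 'b itself) \<longleftrightarrow>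
     (\<exists>C\<ge>1. \<exists>E :: nat \<Rightarrow> 'b set. \<forall>n\<ge>1.
        subspace (E n) \<and>
        linear_isomorphisms (E n) norm (lpn_space n) (lpn_norm p n) \<noteq> {} \<and>
        banach_mazur_dist (E n) norm (lpn_space n) (lpn_norm p n) \<le> C)"

end

theory Submission
  imports Defs
begin

text \<open>
  First, \<open>Y\<close> contains copies of the spaces \<open>\<ell>\<^sub>p\<^sup>n\<close> with the absolute distortion constant \<open>8\<close>, and
  these can be chosen almost independent of any given finite-dimensional subspace. For \<open>p = \<infinity>\<close> this
  is James' blocking argument. For \<open>p < \<infinity>\<close> take vectors of \<open>\<ell>\<^sub>p\<^sup>N\<close> whose mass is spread
  evenly over geometric levels and place their coordinates at random: the norm of a linear combination is
  concentrated around its mean, the mean is invariant under permutations and changes of sign, and for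
  such a norm scaling amounts to a shift of the levels, so that it is comparable to the norm of
  \<open>\<ell>\<^sub>p\<^sup>n\<close>.

  Secondly, averaging over the cells of a finite partition of \<open>[0,1]\<close> is a contraction of \<open>L\<^sub>p\<close> onto
  \<open>\<ell>\<^sub>p\<^sup>N\<close> which almost preserves the distances that are not too small within a bounded part of
  \<open>M\<close>. One such linear map \<open>U\<^sub>j\<close> into an independent copy is used for each pair of an annulus
  \<open>n\<close> and a depth \<open>k\<close>, and \<open>f\<close> is the sum of the \<open>U\<^sub>j\<close> with weights \<open>2\<^bsup>-k-1\<^esup>\<close> times a tent
  function of the logarithm of the norm. The logarithmic scale makes the cutoffs nearly constant, and the
  depth at which a distance \<open>t\<close> becomes visible is dictated by \<open>\<mu> t\<close>.
\<close>

section \<open>Concentration of measure for random injections\<close>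

text \<open>The obstacle is that the hypothesis on \<open>Y\<close> allows an arbitrary distortion,
  whereas the bounds 9 and 1/16 are absolute. For the averaged norm the distortion can be removed,
  since it enters only through the levels at the ends of the range, whose share of the mass tends to
  0 as the number of levels grows; what remains is the loss from rounding to powers of 2/3, which is
  absolute. The constant 8 suffices in place of almost isometric copies: with weights of total at
  most 1 it contributes 8 to the upper bound, and the variation of the cutoffs adds only 1/16. For
  finite exponents independence comes from symmetry: over random signs the mean of the norm of
  \<open>z + v\<close> is at least the norm of \<open>z\<close>, and concentration makes this true
  for one placement, simultaneously on finite nets. The lower bound needs independence because it
  rules out cancellation: a single summand of \<open>f x - f y\<close> is controlled by the whole
  sum.\<close>

definition avg :: "'a set \<Rightarrow> ('a \<Rightarrow> real) \<Rightarrow> real" where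
  "avg S g = (\<Sum>x\<in>S. g x) / card S"

definition injs :: "'i set \<Rightarrow> 'a set \<Rightarrow> ('i \<Rightarrow> 'a) set" where
  "injs I A = {w \<in> I \<rightarrow>\<^sub>E A. inj_on w I}"

definition hdist :: "'i set \<Rightarrow> ('i \<Rightarrow> 'a) \<Rightarrow> ('i \<Rightarrow> 'a) \<Rightarrow> nat" where
  "hdist I w w' = card {i \<in> I. w i \<noteq> w' i}"

lemma avg_le:
  assumes "finite S" "S \<noteq> {}" "\<And>x. x \<in> S \<Longrightarrow> g x \<le> c"
  shows "avg S g \<le> c"
proof -
  have "(\<Sum>x\<in>S. g x) \<le> of_nat (card S) * c" by (rule sum_bounded_above) (use assms in auto)
  moreover have "card S > 0" using assms by (simp add: card_gt_0_iff)
  ultimately show ?thesis by (simp add: avg_def field_simps)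
qed

lemma avg_uminus: "avg S (\<lambda>x. - g x) = - avg S g"
  by (simp add: avg_def sum_negf)

lemma avg_ge:
  assumes "finite S" "S \<noteq> {}" "\<And>x. x \<in> S \<Longrightarrow> c \<le> g x"
  shows "c \<le> avg S g"
  using avg_le[of S "\<lambda>x. - g x" "- c"] assms by (simp add: avg_uminus)

lemma avg_mono:
  assumes "\<And>x. x \<in> S \<Longrightarrow> g x \<le> h x"
  shows "avg S g \<le> avg S h"
  unfolding avg_def by (intro divide_right_mono sum_mono assms) auto

lemma avg_add: "avg S (\<lambda>x. g x + h x) = avg S g + avg S h"
  by (simp add: avg_def sum.distrib add_divide_distrib)

lemma avg_cmult: "avg S (\<lambda>x. c * g x) = c * avg S g"
  by (simp add: avg_def sum_distrib_left)

lemma sum_diff_avg: 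
  assumes "finite S"
  shows "(\<Sum>x\<in>S. g x - avg S g) = 0"
  using assms by (cases "S = {}") (simp_all add: avg_def sum_subtractf)

text \<open>The cross term vanishes because deviations from the mean sum to 0. With \<open>S\<close>
  a fibre and \<open>c\<close> the global mean, this separates the variance within the fibre from
  the deviation of its conditional mean.\<close>

lemma sum_sq_diff:
  assumes "finite S"
  shows "(\<Sum>x\<in>S. (g x - c)\<^sup>2) = (\<Sum>x\<in>S. (g x - avg S g)\<^sup>2) + card S * (avg S g - c)\<^sup>2"
proof -
  have "(\<Sum>x\<in>S. (g x - c)\<^sup>2) = 
    (\<Sum>x\<in>S. (g x - avg S g)\<^sup>2 + 2 * (avg S g - c) * (g x - avg S g) + (avg S g - c)\<^sup>2)"
    by (intro sum.cong) (auto simp: power2_eq_square algebra_simps)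
  also have "\<dots> = (\<Sum>x\<in>S. (g x - avg S g)\<^sup>2) + 2 * (avg S g - c) * (\<Sum>x\<in>S. g x - avg S g) 
      + card S * (avg S g - c)\<^sup>2"
    by (simp add: sum.distrib sum_distrib_left)
  finally show ?thesis by (simp add: sum_diff_avg[OF assms])
qed

section \<open>Injections: fibres, transpositions and variance\<close>

lemma finite_injs: "finite I \<Longrightarrow> finite A \<Longrightarrow> finite (injs I A)"
  unfolding injs_def by (rule finite_subset[OF _ finite_PiE[of I "\<lambda>_. A"]]) auto

lemma injs_ne:
  assumes "finite I" "finite A" "card I \<le> card A"
  shows "injs I A \<noteq> {}"
proof -
  obtain f where "f ` I \<subseteq> A" "inj_on f I" using card_le_inj[OF assms] by blast
  then have "restrict f I \<in> injs I A" by (auto simp: injs_def inj_on_def)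
  then show ?thesis by blast
qed

text \<open>Once the value \<open>a\<close> at \<open>i\<close> is exposed, the rest is an injection
  avoiding \<open>a\<close>; this disintegration drives the induction on the domain.\<close>

lemma injs_insert:
  assumes "i \<notin> I"
  shows "injs (insert i I) A = (\<Union>a\<in>A. (\<lambda>w. w(i := a)) ` injs I (A - {a}))" (is "?L = ?R")
proof
  show "?L \<subseteq> ?R"
  proof
    fix w assume w: "w \<in> ?L"
    then have wi: "w i \<in> A" and inj: "inj_on w (insert i I)" and P: "w \<in> insert i I \<rightarrow>\<^sub>E A"
      by (auto simp: injs_def)
    have "w(i := undefined) \<in> injs I (A - {w i})"
      using inj P assms by (auto simp: injs_def inj_on_def PiE_iff extensional_def)
    moreover have "w = (w(i := undefined))(i := w i)" by simp
    ultimately show "w \<in> ?R" using wi by blast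
  qed
  show "?R \<subseteq> ?L"
    using assms by (auto simp: injs_def inj_on_def PiE_iff extensional_def split: if_splits)
qed

lemma injs_swap:
  assumes "a \<in> A" "b \<in> A"
  shows "bij_betw (\<lambda>w. restrict (\<lambda>j. Transposition.transpose a b (w j)) I) (injs I (A - {a})) (injs I (A - {b}))"
proof (rule bij_betwI[where g = "\<lambda>w. restrict (\<lambda>j. Transposition.transpose a b (w j)) I"])
  have *: "restrict (\<lambda>j. Transposition.transpose a b (w j)) I \<in> injs I (A - {b})" 
    if "a \<in> A" "b \<in> A" "w \<in> injs I (A - {a})" for a b w
    using that by (auto simp: injs_def inj_on_def PiE_iff extensional_def Transposition.transpose_eq_iff)
      (auto simp: Transposition.transpose_def split: if_splits)
  show "(\<lambda>w. restrict (\<lambda>j. Transposition.transpose a b (w j)) I) \<in> injs I (A - {a}) \<rightarrow> injs I (A - {b})"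
    using * assms by blast
  show "(\<lambda>w. restrict (\<lambda>j. Transposition.transpose a b (w j)) I) \<in> injs I (A - {b}) \<rightarrow> injs I (A - {a})"
    using *[of b a] assms by (auto simp: Transposition.transpose_commute)
qed (auto simp: injs_def fun_eq_iff PiE_iff extensional_def)

text \<open>\<open>w\<close> avoids \<open>a\<close>, so on \<open>I\<close> the transposition acts
  only where \<open>w\<close> takes the value \<open>b\<close>; by injectivity this is at most one
  point. The point \<open>i\<close> is the other one.\<close>

lemma hdist_swap:
  assumes "finite I" "i \<notin> I" "a \<in> A" "w \<in> injs I (A - {a})"
  shows "hdist (insert i I) (w(i := a)) ((restrict (\<lambda>j. Transposition.transpose a b (w j)) I)(i := b)) \<le> 2"
proof -
  have sub: "{j \<in> insert i I. (w(i := a)) j \<noteq> ((restrict (\<lambda>j. Transposition.transpose a b (w j)) I)(i := b)) j}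
     \<subseteq> insert i {j\<in>I. w j = b}"
    using assms by (auto simp: injs_def Transposition.transpose_def PiE_iff split: if_splits)
  have "card {j\<in>I. w j = b} \<le> 1"
  proof -
    have "inj_on w {j\<in>I. w j = b}" using assms by (auto simp: injs_def inj_on_def)
    then have "card {j\<in>I. w j = b} \<le> card {b}" by (rule card_inj_on_le) auto
    then show ?thesis by simp
  qed
  moreover have "card (insert i {j\<in>I. w j = b}) \<le> Suc (card {j\<in>I. w j = b})"
    by (rule card_insert_le_m1) auto
  ultimately show ?thesis unfolding hdist_def
    using card_mono[OF _ sub] assms(1) by simp
qed

lemma hdist_upd:
  assumes "i \<notin> I"
  shows "hdist (insert i I) (w(i := a)) (w'(i := a)) = hdist I w w'"
  unfolding hdist_def using assms by (intro arg_cong[where f = card]) auto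

text \<open>Efron--Stein for random injections: exposing one value at a time, the conditional means for two
  different values of the exposed coordinate are coupled by a transposition, which moves at most two
  coordinates.\<close>

lemma variance_injs:
  fixes g :: "('i \<Rightarrow> 'a) \<Rightarrow> real"
  assumes "finite I" "finite A" 
    and "\<And>w w'. w \<in> injs I A \<Longrightarrow> w' \<in> injs I A \<Longrightarrow> \<bar>g w - g w'\<bar> \<le> hdist I w w'"
  shows "(\<Sum>w\<in>injs I A. (g w - avg (injs I A) g)\<^sup>2) \<le> 4 * card I * card (injs I A)"
  using assms
proof (induction I arbitrary: A g rule: finite_induct)
  case empty
  then show ?case by (simp add: injs_def avg_def)
next
  case (insert i I)
  note A = \<open>finite A\<close> and lip = insert.prems(2)
  define F where "F a = injs I (A - {a})" for a
  define \<Phi> where "\<Phi> a w = w(i := a)" for a and w :: "'i \<Rightarrow> 'a"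
  define h where "h a w = g (\<Phi> a w)" for a w
  define e where "e a = avg (F a) (h a)" for a
  define \<mu> where "\<mu> = avg (injs (insert i I) A) g"
  have finF: "finite (F a)" for a using insert A by (auto simp: F_def finite_injs)
  have mem: "\<Phi> a w \<in> injs (insert i I) A" if "a \<in> A" "w \<in> F a" for a w
    using that injs_insert[OF insert(2), of A] by (auto simp: F_def \<Phi>_def)
  have inj: "inj_on (\<Phi> a) (F a)" if "a \<in> A" for a
    using insert(2) by (auto simp: inj_on_def \<Phi>_def F_def injs_def PiE_iff extensional_def fun_eq_iff split: if_splits) metis
  have split: "(\<Sum>w\<in>injs (insert i I) A. k w) = (\<Sum>a\<in>A. \<Sum>w\<in>F a. k (\<Phi> a w))" for k :: "_ \<Rightarrow> real"
  proof -
    have "(\<Sum>w\<in>injs (insert i I) A. k w) = (\<Sum>a\<in>A. \<Sum>w\<in>\<Phi> a ` F a. k w)"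
      unfolding injs_insert[OF insert(2)] F_def \<Phi>_def
    proof (rule sum.UNION_disjoint)
      show "\<forall>a\<in>A. \<forall>b\<in>A. a \<noteq> b \<longrightarrow> (\<lambda>w. w(i := a)) ` injs I (A - {a}) \<inter> (\<lambda>w. w(i := b)) ` injs I (A - {b}) = {}"
        by (auto dest: fun_cong[of _ _ i])
    qed (use insert A in \<open>auto simp: finite_injs\<close>)
    also have "\<dots> = (\<Sum>a\<in>A. \<Sum>w\<in>F a. k (\<Phi> a w))"
      by (rule sum.cong[OF refl]) (simp add: sum.reindex[OF inj])
    finally show ?thesis .
  qed
  have cardF: "card (F a) = card (F b)" if "a \<in> A" "b \<in> A" for a b
    unfolding F_def using bij_betw_same_card[OF injs_swap[OF that, of I]] .
  \<comment> \<open>Summing over one fibre and reindexing by the coupling compares two conditional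
    means, since coupled injections are at Hamming distance at most 2.\<close>
  have diff: "e a \<le> e b + 2" if ab: "a \<in> A" "b \<in> A" for a b
  proof (cases "F a = {}")
    case True
    then have "F b = {}" using cardF[OF ab] finF by (metis card_0_eq)
    with True show ?thesis by (simp add: e_def avg_def)
  next
    case False
    let ?t = "\<lambda>w. restrict (\<lambda>j. Transposition.transpose a b (w j)) I"
    have "(\<Sum>w\<in>F a. h a w) \<le> (\<Sum>w\<in>F a. h b (?t w) + 2)"
    proof (rule sum_mono)
      fix w assume w: "w \<in> F a"
      have t: "?t w \<in> F b" using injs_swap[OF ab, of I] w unfolding F_def bij_betw_def by blast
      have "\<bar>h a w - h b (?t w)\<bar> \<le> hdist (insert i I) (\<Phi> a w) (\<Phi> b (?t w))"
        unfolding h_def by (intro lip mem ab w t)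
      also have "\<dots> \<le> real 2" unfolding \<Phi>_def of_nat_le_iff
        by (rule hdist_swap[OF insert(1,2) ab(1)]) (use w F_def in auto)
      finally show "h a w \<le> h b (?t w) + 2" by simp
    qed
    also have "\<dots> = (\<Sum>w\<in>F a. h b (?t w)) + 2 * card (F a)" by (simp add: sum.distrib)
    also have "(\<Sum>w\<in>F a. h b (?t w)) = (\<Sum>w\<in>F b. h b w)"
      unfolding F_def by (rule sum.reindex_bij_betw[OF injs_swap[OF ab]])
    finally have "(\<Sum>w\<in>F a. h a w) \<le> (\<Sum>w\<in>F b. h b w) + 2 * card (F a)" .
    moreover have "card (F a) > 0" using False finF[of a] by (simp add: card_gt_0_iff)
    ultimately show ?thesis using cardF[OF ab] by (simp add: e_def avg_def field_simps)
  qed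
  have cardtot: "real (card (injs (insert i I) A)) = (\<Sum>b\<in>A. real (card (F b)))"
    using split[of "\<lambda>_. 1"] by simp
  have sumg: "(\<Sum>w\<in>injs (insert i I) A. g w) = (\<Sum>b\<in>A. card (F b) * e b)"
    unfolding split e_def avg_def h_def[symmetric]
    by (intro sum.cong refl) (metis (no_types, lifting) finF card_eq_0_iff mult_eq_0_iff nonzero_mult_div_cancel_left of_nat_eq_0_iff sum.empty times_divide_eq_right)
  \<comment> \<open>All fibres have the same size, so the global mean is the plain average of the
    \<open>e b\<close>, each of which is within 2 of \<open>e a\<close>.\<close>
  have dev: "(e a - \<mu>)\<^sup>2 \<le> 4" if a: "a \<in> A" "F a \<noteq> {}" for a
  proof -
    define c where "c = card (F a)"
    have c: "c > 0" using a finF by (simp add: c_def card_gt_0_iff)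
    have cb: "card (F b) = c" if "b \<in> A" for b unfolding c_def by (rule cardF[OF that a(1)])
    have n: "card A > 0" using a A by (auto simp: card_gt_0_iff)
    have "\<mu> = (\<Sum>b\<in>A. c * e b) / (\<Sum>b\<in>A. real c)"
      unfolding \<mu>_def avg_def cardtot sumg using cb by simp
    also have "\<dots> = avg A e" using c n by (simp add: avg_def field_simps flip: sum_distrib_left)
    finally have m: "\<mu> = avg A e" .
    have "\<mu> \<le> e a + 2" unfolding m using a diff[of _ a] A by (intro avg_le) auto
    moreover have "e a - 2 \<le> \<mu>" unfolding m using a diff[of a] A by (intro avg_ge) (auto simp: algebra_simps)
    ultimately have "\<bar>e a - \<mu>\<bar> \<le> 2" by simp
    then have "\<bar>e a - \<mu>\<bar>\<^sup>2 \<le> 2\<^sup>2" by (intro power_mono) auto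
    then show ?thesis by simp
  qed
  have "(\<Sum>w\<in>injs (insert i I) A. (g w - \<mu>)\<^sup>2) = (\<Sum>a\<in>A. \<Sum>w\<in>F a. (h a w - \<mu>)\<^sup>2)"
    unfolding split h_def ..
  also have "\<dots> \<le> (\<Sum>a\<in>A. 4 * real (card I) * real (card (F a)) + real (card (F a)) * 4)"
  proof (rule sum_mono)
    fix a assume a: "a \<in> A"
    have "(\<Sum>w\<in>F a. (h a w - e a)\<^sup>2) \<le> 4 * card I * card (F a)"
      unfolding e_def F_def
    proof (rule insert.IH)
      show "finite (A - {a})" using A by simp
      fix w w' assume w: "w \<in> injs I (A - {a})" "w' \<in> injs I (A - {a})"
      have "\<bar>h a w - h a w'\<bar> \<le> hdist (insert i I) (\<Phi> a w) (\<Phi> a w')"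
        unfolding h_def by (intro lip mem a) (use w F_def in auto)
      then show "\<bar>h a w - h a w'\<bar> \<le> hdist I w w'"
        unfolding \<Phi>_def hdist_upd[OF insert(2)] .
    qed
    moreover have "card (F a) * (e a - \<mu>)\<^sup>2 \<le> real (card (F a)) * 4"
    proof (cases "F a = {}")
      case True then show ?thesis by simp
    next
      case False with dev[OF a] show ?thesis by (intro mult_left_mono) auto
    qed
    moreover have "(\<Sum>w\<in>F a. (h a w - \<mu>)\<^sup>2) = (\<Sum>w\<in>F a. (h a w - e a)\<^sup>2) + card (F a) * (e a - \<mu>)\<^sup>2"
      unfolding e_def by (rule sum_sq_diff[OF finF])
    ultimately show "(\<Sum>w\<in>F a. (h a w - \<mu>)\<^sup>2) \<le> 4 * real (card I) * real (card (F a)) + real (card (F a)) * 4" by simp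
  qed
  also have "\<dots> = 4 * card (insert i I) * card (injs (insert i I) A)"
    using insert(1,2) by (simp add: cardtot sum.distrib algebra_simps sum_distrib_left)
  finally show ?case by (simp add: \<mu>_def)
qed

lemma hdist_self [simp]: "hdist I w w = 0"
  by (simp add: hdist_def)

lemma hdist_commute: "hdist I w w' = hdist I w' w"
  unfolding hdist_def by (intro arg_cong[where f = card]) auto

lemma hdist_triangle:
  assumes "finite I"
  shows "hdist I u w \<le> hdist I u v + hdist I v w"
proof -
  have "card {i\<in>I. u i \<noteq> w i} \<le> card ({i\<in>I. u i \<noteq> v i} \<union> {i\<in>I. v i \<noteq> w i})"
    using assms by (intro card_mono) auto
  also have "\<dots> \<le> card {i\<in>I. u i \<noteq> v i} + card {i\<in>I. v i \<noteq> w i}" by (rule card_Un_le)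
  finally show ?thesis by (simp add: hdist_def)
qed

text \<open>Unless it is negligible, a set has a Hamming neighbourhood carrying almost all of the injections;
  applied to the set where \<open>h\<close> is below its mean.\<close>

lemma concentration_above:
  fixes h :: "('i \<Rightarrow> 'a) \<Rightarrow> real" and I :: "'i set" and A :: "'a set" and s :: real
  defines "\<Omega> \<equiv> injs I A"
  assumes fin: "finite I" "finite A" "card I \<le> card A" and "\<eta> > 0" "R \<ge> 0" "s > 0"
    and range: "\<And>u v. u \<in> \<Omega> \<Longrightarrow> v \<in> \<Omega> \<Longrightarrow> h u - h v \<le> R"
    and lip: "\<And>u v. u \<in> \<Omega> \<Longrightarrow> v \<in> \<Omega> \<Longrightarrow> hdist I u v \<le> s \<Longrightarrow> h u - h v \<le> \<eta>"
    and s: "16 * (R + \<eta>) / \<eta> * card I \<le> s\<^sup>2"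
  shows "card {w\<in>\<Omega>. h w > avg \<Omega> h + 2 * \<eta>} * s\<^sup>2 \<le> 16 * card I * card \<Omega>"
proof -
  have fin\<Omega>: "finite \<Omega>" and ne: "\<Omega> \<noteq> {}"
    unfolding \<Omega>_def using fin by (auto simp: finite_injs dest: injs_ne)
  define B where "B = {w\<in>\<Omega>. h w \<le> avg \<Omega> h + \<eta>}"
  have B\<Omega>: "B \<subseteq> \<Omega>" and finB: "finite B" using fin\<Omega> by (auto simp: B_def)
  \<comment> \<open>Outside \<open>B\<close> the deviation from the mean exceeds \<eta>, and on
    \<open>B\<close> it is at least \<open>- R\<close>. As deviations sum to 0, \<open>B\<close> has
    proportion at least \<open>\<eta> / (R + \<eta>)\<close>.\<close>
  have "(\<Sum>w\<in>\<Omega>. \<eta> - (if w \<in> B then R + \<eta> else 0)) \<le> (\<Sum>w\<in>\<Omega>. h w - avg \<Omega> h)"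
  proof (rule sum_mono)
    fix w assume w: "w \<in> \<Omega>"
    have "avg \<Omega> h \<le> h w + R"
      by (rule avg_le[OF fin\<Omega> ne]) (use range[OF _ w] in \<open>auto simp: algebra_simps\<close>)
    then show "\<eta> - (if w \<in> B then R + \<eta> else 0) \<le> h w - avg \<Omega> h"
      using w by (auto simp: B_def)
  qed
  also have "\<dots> = 0" by (rule sum_diff_avg[OF fin\<Omega>])
  also have "(\<Sum>w\<in>\<Omega>. \<eta> - (if w \<in> B then R + \<eta> else 0)) = card \<Omega> * \<eta> - card B * (R + \<eta>)"
    using fin\<Omega> B\<Omega> by (simp add: sum_subtractf sum.If_cases Int_absorb1)
  finally have cB: "card \<Omega> * \<eta> \<le> card B * (R + \<eta>)" by simp
  have cO: "card \<Omega> > 0" using fin\<Omega> ne by (simp add: card_gt_0_iff)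
  then have "card \<Omega> * \<eta> > 0" using \<open>\<eta> > 0\<close> by simp
  then have "B \<noteq> {}" using cB by auto
  \<comment> \<open>The Hamming distance to \<open>B\<close>: it is 1-Lipschitz, hence has small
    variance, and it vanishes on \<open>B\<close>. Both together bound its mean \<mu>.\<close>
  define g where "g w = (MIN v\<in>B. real (hdist I w v))" for w
  have g_ex: "\<exists>v\<in>B. g w = hdist I w v" for w
  proof -
    have "g w \<in> (\<lambda>v. real (hdist I w v)) ` B"
      unfolding g_def using finB \<open>B \<noteq> {}\<close> by (intro Min_in) auto
    then show ?thesis by auto
  qed
  have g_le: "g w \<le> hdist I w v" if "v \<in> B" for w v
    unfolding g_def using finB that by (intro Min_le) auto
  have g0: "g w \<ge> 0" for w using g_ex[of w] by auto
  have g_diff: "g u \<le> g w + hdist I u w" for u w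
  proof -
    obtain v where v: "v \<in> B" "g w = hdist I w v" using g_ex by blast
    have "g u \<le> hdist I u v" by (rule g_le[OF v(1)])
    also have "\<dots> \<le> real (hdist I u w + hdist I w v)"
      unfolding of_nat_le_iff by (rule hdist_triangle[OF fin(1)])
    finally show ?thesis using v by simp
  qed
  define \<mu> where "\<mu> = avg \<Omega> g"
  have var: "(\<Sum>w\<in>\<Omega>. (g w - \<mu>)\<^sup>2) \<le> 4 * card I * card \<Omega>"
    unfolding \<mu>_def \<Omega>_def
  proof (rule variance_injs[OF fin(1,2)])
    fix u w show "\<bar>g u - g w\<bar> \<le> hdist I u w"
      using g_diff[of u w] g_diff[of w u] hdist_commute[of I u w] by simp
  qed
  have \<mu>0: "\<mu> \<ge> 0" unfolding \<mu>_def by (rule avg_ge[OF fin\<Omega> ne g0])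
  have "card B * \<mu>\<^sup>2 = (\<Sum>w\<in>B. (g w - \<mu>)\<^sup>2)"
  proof -
    have "g w = 0" if "w \<in> B" for w using g_le[OF that, of w] g0[of w] by simp
    then show ?thesis by simp
  qed
  also have "\<dots> \<le> (\<Sum>w\<in>\<Omega>. (g w - \<mu>)\<^sup>2)" by (rule sum_mono2[OF fin\<Omega> B\<Omega>]) auto
  also note var
  finally have "card B * \<mu>\<^sup>2 \<le> 4 * card I * card \<Omega>" .
  then have "card B * \<mu>\<^sup>2 * (R + \<eta>) \<le> 4 * card I * card \<Omega> * (R + \<eta>)"
    using assms(5,6) by (intro mult_right_mono) auto
  moreover have "card \<Omega> * \<eta> * \<mu>\<^sup>2 \<le> card B * (R + \<eta>) * \<mu>\<^sup>2"
    by (intro mult_right_mono cB) auto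
  ultimately have "card \<Omega> * (\<eta> * \<mu>\<^sup>2) \<le> card \<Omega> * (4 * card I * (R + \<eta>))" by (simp add: algebra_simps)
  then have "\<eta> * \<mu>\<^sup>2 \<le> 4 * card I * (R + \<eta>)" using cO by simp
  then have "4 * \<mu>\<^sup>2 \<le> 16 * (R + \<eta>) / \<eta> * card I" using \<open>\<eta> > 0\<close> by (simp add: field_simps)
  also note s
  finally have "(2 * \<mu>)\<^sup>2 \<le> s\<^sup>2" by (simp add: power_mult_distrib)
  then have \<mu>s: "2 * \<mu> \<le> s" by (rule power2_le_imp_le) (use \<open>s > 0\<close> in simp)
  define C where "C = {w\<in>\<Omega>. h w > avg \<Omega> h + 2 * \<eta>}"
  \<comment> \<open>Chebyshev: within distance \<open>s\<close> the function \<open>h\<close> gains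
    at most \<eta>, so a point of \<open>C\<close> is farther than \<open>s\<close> from
    \<open>B\<close> and \<open>g\<close> exceeds its mean there by at least
    \<open>s/2\<close>.\<close>
  have "card C * (s/2)\<^sup>2 = (\<Sum>w\<in>C. (s/2)\<^sup>2)" by simp
  also have "\<dots> \<le> (\<Sum>w\<in>C. (g w - \<mu>)\<^sup>2)"
  proof (rule sum_mono)
    fix w assume w: "w \<in> C"
    have "g w > s"
    proof (rule ccontr)
      assume "\<not> g w > s"
      moreover obtain v where v: "v \<in> B" "g w = hdist I w v" using g_ex by blast
      ultimately have "h w - h v \<le> \<eta>" using w B\<Omega> by (intro lip) (auto simp: C_def)
      then show False using v(1) w by (simp add: B_def C_def)
    qed
    then show "(s/2)\<^sup>2 \<le> (g w - \<mu>)\<^sup>2" using \<mu>s \<open>s > 0\<close> by (intro power_mono) auto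
  qed
  also have "\<dots> \<le> (\<Sum>w\<in>\<Omega>. (g w - \<mu>)\<^sup>2)" by (rule sum_mono2[OF fin\<Omega>]) (auto simp: C_def)
  also note var
  finally show ?thesis by (simp add: C_def power_divide)
qed

text \<open>Union bound over the upper tails of \<open>h\<close> and of \<open>- h\<close>: the
  \<open>2 * card H\<close> exceptional sets have proportion at most
  \<open>16 * card I / s\<^sup>2\<close> each, so \<open>sH\<close> leaves an injection outside all
  of them.\<close>

lemma concentration_injs:
  fixes I :: "'i set" and A :: "'a set" and H :: "(('i \<Rightarrow> 'a) \<Rightarrow> real) set" and s :: real
  defines "\<Omega> \<equiv> injs I A"
  assumes fin: "finite I" "finite A" "card I \<le> card A" "finite H" and pos: "\<eta> > 0" "R \<ge> 0" "s > 0"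
    and range: "\<And>h u v. h \<in> H \<Longrightarrow> u \<in> \<Omega> \<Longrightarrow> v \<in> \<Omega> \<Longrightarrow> h u - h v \<le> R"
    and lip: "\<And>h u v. h \<in> H \<Longrightarrow> u \<in> \<Omega> \<Longrightarrow> v \<in> \<Omega> \<Longrightarrow> hdist I u v \<le> s \<Longrightarrow> h u - h v \<le> \<eta>"
    and s: "16 * (R + \<eta>) / \<eta> * card I \<le> s\<^sup>2" and sH: "32 * card I * card H < s\<^sup>2"
  shows "\<exists>w\<in>\<Omega>. \<forall>h\<in>H. \<bar>h w - avg \<Omega> h\<bar> \<le> 2 * \<eta>"
proof (rule ccontr)
  assume neg: "\<not> (\<exists>w\<in>\<Omega>. \<forall>h\<in>H. \<bar>h w - avg \<Omega> h\<bar> \<le> 2 * \<eta>)"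
  define U where "U h = {w\<in>\<Omega>. h w > avg \<Omega> h + 2 * \<eta>}" for h
  define V where "V h = {w\<in>\<Omega>. - h w > avg \<Omega> (\<lambda>w. - h w) + 2 * \<eta>}" for h
  have fin\<Omega>: "finite \<Omega>" and ne: "\<Omega> \<noteq> {}"
    unfolding \<Omega>_def using fin by (auto simp: finite_injs dest: injs_ne)
  have "\<Omega> \<subseteq> (\<Union>h\<in>H. U h \<union> V h)"
  proof
    fix w assume "w \<in> \<Omega>"
    with neg obtain h where h: "h \<in> H" "\<not> \<bar>h w - avg \<Omega> h\<bar> \<le> 2 * \<eta>" by blast
    then have "w \<in> U h \<union> V h" using \<open>w \<in> \<Omega>\<close> by (auto simp: U_def V_def avg_uminus abs_if split: if_splits)
    then show "w \<in> (\<Union>h\<in>H. U h \<union> V h)" using h by blast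
  qed
  then have "card \<Omega> \<le> card (\<Union>h\<in>H. U h \<union> V h)"
    by (rule card_mono[rotated]) (use fin\<Omega> fin in \<open>auto simp: U_def V_def\<close>)
  also have "\<dots> \<le> (\<Sum>h\<in>H. card (U h \<union> V h))" by (rule card_UN_le[OF fin(4)])
  also have "\<dots> \<le> (\<Sum>h\<in>H. card (U h) + card (V h))" by (intro sum_mono card_Un_le)
  finally have "real (card \<Omega>) * s\<^sup>2 \<le> real (\<Sum>h\<in>H. card (U h) + card (V h)) * s\<^sup>2"
    by (intro mult_right_mono of_nat_mono) auto
  also have "\<dots> = (\<Sum>h\<in>H. card (U h) * s\<^sup>2 + card (V h) * s\<^sup>2)"
    by (simp add: sum_distrib_right distrib_right)
  also have "\<dots> \<le> (\<Sum>h\<in>H. real (16 * card I * card \<Omega>) + real (16 * card I * card \<Omega>))"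
  proof (intro sum_mono add_mono)
    fix h assume h: "h \<in> H"
    show "card (U h) * s\<^sup>2 \<le> 16 * card I * card \<Omega>"
      unfolding U_def \<Omega>_def
      by (rule concentration_above[OF fin(1-3) pos _ _ s]) (use range[OF h] lip[OF h] in \<open>auto simp: \<Omega>_def\<close>)
    show "card (V h) * s\<^sup>2 \<le> 16 * card I * card \<Omega>"
      unfolding V_def \<Omega>_def
    proof (rule concentration_above[OF fin(1-3) pos _ _ s])
      fix u v assume uv: "u \<in> injs I A" "v \<in> injs I A"
      show "- h u - - h v \<le> R" using range[OF h, of v u] uv by (simp add: \<Omega>_def)
      assume "hdist I u v \<le> s"
      then show "- h u - - h v \<le> \<eta>"
        using lip[OF h, of v u] uv by (simp add: \<Omega>_def hdist_commute)
    qed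
  qed
  also have "\<dots> = card \<Omega> * (32 * card I * card H)" by simp
  finally have "card \<Omega> * s\<^sup>2 \<le> card \<Omega> * (32 * card I * card H)" by simp
  moreover have "card \<Omega> > 0" using fin\<Omega> ne by (simp add: card_gt_0_iff)
  ultimately have "s\<^sup>2 \<le> 32 * card I * card H" by simp
  with sH show False by simp
qed


section \<open>A symmetric norm obtained by averaging\<close>

definition lq_norm :: "real \<Rightarrow> 'i set \<Rightarrow> ('i \<Rightarrow> real) \<Rightarrow> real" where
  "lq_norm q S x = (\<Sum>i\<in>S. \<bar>x i\<bar> powr q) powr (1 / q)"

abbreviation lincomb :: "nat \<Rightarrow> (nat \<Rightarrow> real) \<Rightarrow> (nat \<Rightarrow> 'b) \<Rightarrow> 'b::real_vector" where
  "lincomb n a u \<equiv> (\<Sum>i<n. a i *\<^sub>R u i)"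

lemma lq_norm_nonneg [simp]: "lq_norm q S x \<ge> 0"
  by (simp add: lq_norm_def)

lemma lq_norm_powr: "q > 0 \<Longrightarrow> lq_norm q S x powr q = (\<Sum>i\<in>S. \<bar>x i\<bar> powr q)"
  by (simp add: lq_norm_def powr_powr sum_nonneg)

lemma lq_norm_cmult: "q > 0 \<Longrightarrow> lq_norm q S (\<lambda>i. c * x i) = \<bar>c\<bar> * lq_norm q S x"
  by (simp add: lq_norm_def abs_mult powr_mult powr_powr flip: sum_distrib_left)

lemma lq_norm_eq_0_iff:
  assumes "finite S" "q > 0"
  shows "lq_norm q S x = 0 \<longleftrightarrow> (\<forall>i\<in>S. x i = 0)"
  using assms by (simp add: lq_norm_def sum_nonneg_eq_0_iff)

lemma abs_le_lq_norm:
  assumes "finite S" "q > 0" "i \<in> S"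
  shows "\<bar>x i\<bar> \<le> lq_norm q S x"
proof -
  have "\<bar>x i\<bar> powr q \<le> (\<Sum>i\<in>S. \<bar>x i\<bar> powr q)"
    using assms by (intro member_le_sum) auto
  then have "(\<bar>x i\<bar> powr q) powr (1/q) \<le> lq_norm q S x"
    unfolding lq_norm_def using assms by (intro powr_mono2) auto
  then show ?thesis using assms by (simp add: powr_powr)
qed

lemma lq_norm_le_card:
  fixes s v :: real
  assumes "q > 0" "v \<ge> 0" "\<And>i. i \<in> S \<Longrightarrow> \<bar>x i\<bar> \<le> v" "card S \<le> s"
  shows "lq_norm q S x \<le> v * s powr (1/q)"
proof -
  have "(\<Sum>i\<in>S. \<bar>x i\<bar> powr q) \<le> of_nat (card S) * v powr q"
    using assms by (intro sum_bounded_above powr_mono2) auto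
  also have "\<dots> \<le> s * v powr q" using assms(4) by (intro mult_right_mono) auto
  finally have "lq_norm q S x \<le> (s * v powr q) powr (1/q)"
    unfolding lq_norm_def using assms(1) by (intro powr_mono2) (auto intro: sum_nonneg)
  then show ?thesis using assms(1,2) by (simp add: powr_mult powr_powr mult.commute)
qed

section \<open>Permutations and level-preserving matchings\<close>

lemma inj_extends_to_permutation:
  assumes "finite J" "S \<subseteq> J" "\<sigma> ` S \<subseteq> J" "inj_on \<sigma> S"
  shows "\<exists>\<pi>. \<pi> permutes J \<and> (\<forall>s\<in>S. \<pi> s = \<sigma> s)"
proof -
  have "card (J - S) = card (J - \<sigma> ` S)"
    using assms by (simp add: card_Diff_subset finite_subset card_image)
  then obtain \<tau> where \<tau>: "bij_betw \<tau> (J - S) (J - \<sigma> ` S)"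
    using assms(1) finite_same_card_bij[of "J - S" "J - \<sigma> ` S"] by auto
  define \<pi> where "\<pi> j = (if j \<in> S then \<sigma> j else if j \<in> J then \<tau> j else j)" for j
  have "bij_betw \<pi> S (\<sigma> ` S)"
    using assms(4) by (auto simp: bij_betw_def \<pi>_def inj_on_def)
  moreover have "bij_betw \<pi> (J - S) (J - \<sigma> ` S)"
    using \<tau> by (subst bij_betw_cong[of _ _ \<tau>]) (auto simp: \<pi>_def)
  ultimately have "bij_betw \<pi> (S \<union> (J - S)) (\<sigma> ` S \<union> (J - \<sigma> ` S))"
    by (rule bij_betw_combine) auto
  then have "bij_betw \<pi> J J" using assms by (simp add: Un_absorb1)
  then have "\<pi> permutes J" using assms by (intro bij_imp_permutes) (auto simp: \<pi>_def)
  then show ?thesis by (auto simp: \<pi>_def)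
qed

text \<open>Injections chosen separately on each level glue together, because the level of an image
  determines the piece it comes from.\<close>

lemma levelwise_injection:
  assumes "finite S" "finite T"
    and "\<And>l. card {s\<in>S. f s = l} \<le> card {t\<in>T. g t = l}"
  shows "\<exists>\<sigma>. inj_on \<sigma> S \<and> (\<forall>s\<in>S. \<sigma> s \<in> T \<and> g (\<sigma> s) = f s)"
proof -
  have "\<exists>\<sigma>. \<sigma> ` {s\<in>S. f s = l} \<subseteq> {t\<in>T. g t = l} \<and> inj_on \<sigma> {s\<in>S. f s = l}" for l
    by (rule card_le_inj[OF _ _ assms(3)[of l]]) (use assms(1,2) in simp_all)
  then have "\<exists>\<sigma>. \<forall>l. \<sigma> l ` {s\<in>S. f s = l} \<subseteq> {t\<in>T. g t = l} \<and> inj_on (\<sigma> l) {s\<in>S. f s = l}"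
    by (intro choice allI)
  then obtain \<sigma> where \<sigma>: "\<And>l. \<sigma> l ` {s\<in>S. f s = l} \<subseteq> {t\<in>T. g t = l}"
     "\<And>l. inj_on (\<sigma> l) {s\<in>S. f s = l}" by blast
  have *: "\<sigma> (f s) s \<in> T \<and> g (\<sigma> (f s) s) = f s" if "s \<in> S" for s
    using \<sigma>(1)[of "f s"] that by auto
  have "inj_on (\<lambda>s. \<sigma> (f s) s) S"
  proof (rule inj_onI)
    fix s t assume st: "s \<in> S" "t \<in> S" "\<sigma> (f s) s = \<sigma> (f t) t"
    then have "f s = f t" using *[of s] *[of t] by metis
    then show "s = t" using \<sigma>(2)[of "f t"] st by (auto simp: inj_on_def)
  qed
  with * show ?thesis by blast
qed

text \<open>Each coordinate is used with both signs, at different random positions. A change of sign then is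
  a permutation of the coordinates, so that a norm which is invariant under permutations is also
  unconditional.\<close>

definition word :: "('j \<Rightarrow> real) \<Rightarrow> 'j \<times> bool \<Rightarrow> real" where
  "word x = (\<lambda>(j, b). if b then x j else - x j)"

text \<open>The lower constant is normalised to 1, so that \<open>C\<close> is the whole distortion.
  It may be large and must not enter the constant 8 of \<open>krivine_finite\<close>.\<close>

locale lq_basis =
  fixes e :: "nat \<Rightarrow> 'b::real_normed_vector" and L :: nat and q C :: real
  assumes q: "q \<ge> 1" and C: "C \<ge> 1"
    and lower: "\<And>a. lq_norm q {..<L} a \<le> norm (lincomb L a e)"
    and upper: "\<And>a. norm (lincomb L a e) \<le> C * lq_norm q {..<L} a"
begin

lemma embed:
  assumes "finite S" "inj_on w S" "w ` S \<subseteq> {..<L}"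
  shows "lq_norm q S x \<le> norm (\<Sum>i\<in>S. x i *\<^sub>R e (w i))"
    and "norm (\<Sum>i\<in>S. x i *\<^sub>R e (w i)) \<le> C * lq_norm q S x"
proof -
  define a where "a l = (if l \<in> w ` S then x (inv_into S w l) else 0)" for l
  have "(lincomb L a e) = (\<Sum>l\<in>w ` S. a l *\<^sub>R e l)"
    using assms by (intro sum.mono_neutral_right) (auto simp: a_def)
  also have "\<dots> = (\<Sum>i\<in>S. x i *\<^sub>R e (w i))"
    using assms by (subst sum.reindex) (auto simp: a_def)
  finally have 1: "(lincomb L a e) = (\<Sum>i\<in>S. x i *\<^sub>R e (w i))" .
  have "(\<Sum>l<L. \<bar>a l\<bar> powr q) = (\<Sum>l\<in>w ` S. \<bar>a l\<bar> powr q)"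
    using assms q by (intro sum.mono_neutral_right) (auto simp: a_def)
  also have "\<dots> = (\<Sum>i\<in>S. \<bar>x i\<bar> powr q)"
    using assms by (subst sum.reindex) (auto simp: a_def)
  finally have 2: "lq_norm q {..<L} a = lq_norm q S x" by (simp add: lq_norm_def)
  show "lq_norm q S x \<le> norm (\<Sum>i\<in>S. x i *\<^sub>R e (w i))"
    "norm (\<Sum>i\<in>S. x i *\<^sub>R e (w i)) \<le> C * lq_norm q S x"
    using lower[of a] upper[of a] by (simp_all add: 1 2)
qed

end

locale random_lq = lq_basis e L q C for e :: "nat \<Rightarrow> 'b::real_normed_vector" and L q C +
  fixes J :: "'j set"
  assumes finJ: "finite J" and cardJ: "card (J \<times> (UNIV::bool set)) \<le> L"
begin

definition I where "I = J \<times> (UNIV :: bool set)"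

definition \<Omega> where "\<Omega> = injs I {..<L}"

definition \<Phi> :: "('j \<times> bool \<Rightarrow> nat) \<Rightarrow> ('j \<times> bool \<Rightarrow> real) \<Rightarrow> 'b" where
  "\<Phi> w X = (\<Sum>i\<in>I. X i *\<^sub>R e (w i))"

text \<open>The expected norm when \<open>z\<close> is fixed and the entries of \<open>X\<close> are
  put at random basis positions. The shift \<open>z\<close> is kept because independence from a
  given subspace is proved through it.\<close>

definition mean :: "'b \<Rightarrow> ('j \<times> bool \<Rightarrow> real) \<Rightarrow> real" where
  "mean z X = avg \<Omega> (\<lambda>w. norm (z + \<Phi> w X))"

definition \<nu> :: "('j \<Rightarrow> real) \<Rightarrow> real" where
  "\<nu> x = mean 0 (word x)"

lemma q0: "q > 0" using q by simp

lemma finI: "finite I" by (simp add: I_def finJ)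

lemma fin\<Omega>: "finite \<Omega>" by (simp add: \<Omega>_def finite_injs finI)

lemma ne\<Omega>: "\<Omega> \<noteq> {}"
  unfolding \<Omega>_def by (rule injs_ne) (use finI cardJ in \<open>auto simp: I_def\<close>)

lemma \<Omega>D: "w \<in> \<Omega> \<Longrightarrow> inj_on w I \<and> w ` I \<subseteq> {..<L}"
  by (auto simp: \<Omega>_def injs_def)

lemma \<Phi>_add: "\<Phi> w (\<lambda>i. X i + Y i) = \<Phi> w X + \<Phi> w Y"
  by (simp add: \<Phi>_def scaleR_add_left sum.distrib)

lemma \<Phi>_scale: "\<Phi> w (\<lambda>i. c * X i) = c *\<^sub>R \<Phi> w X"
  by (simp add: \<Phi>_def scaleR_sum_right)

lemma \<Phi>_bounds:
  assumes "w \<in> \<Omega>"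
  shows "lq_norm q I X \<le> norm (\<Phi> w X)" "norm (\<Phi> w X) \<le> C * lq_norm q I X"
  unfolding \<Phi>_def using embed[of I w X] \<Omega>D[OF assms] finI by auto

text \<open>Permuting the entries amounts to precomposing the placement with the inverse
  permutation, which is a bijection of the set of placements.\<close>

lemma mean_perm:
  assumes "\<tau> permutes I"
  shows "mean z (X \<circ> \<tau>) = mean z X"
proof -
  let ?t = "\<lambda>w. restrict (w \<circ> inv \<tau>) I"
  have inv: "inv \<tau> permutes I" using assms by (rule permutes_inv)
  have restr: "restrict (w \<circ> \<sigma>) I \<in> \<Omega>" if "w \<in> \<Omega>" "\<sigma> permutes I" for w \<sigma>
  proof -
    have "inj_on (w \<circ> \<sigma>) I"
      using \<Omega>D[OF that(1)] permutes_image[OF that(2)] permutes_inj_on[OF that(2)]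
      by (intro comp_inj_on) auto
    then show ?thesis
      using \<Omega>D[OF that(1)] permutes_in_image[OF that(2)]
      by (fastforce simp: \<Omega>_def injs_def image_subset_iff)
  qed
  have b: "bij_betw ?t \<Omega> \<Omega>"
  proof (rule bij_betwI[where g = "\<lambda>w. restrict (w \<circ> \<tau>) I"])
    fix w assume "w \<in> \<Omega>"
    then have ext: "w \<in> extensional I" by (simp add: \<Omega>_def injs_def PiE_iff)
    show "restrict (restrict (w \<circ> inv \<tau>) I \<circ> \<tau>) I = w"
      using ext permutes_inverses(2)[OF assms] permutes_in_image[OF assms]
      by (auto simp: fun_eq_iff extensional_def)
    show "restrict (restrict (w \<circ> \<tau>) I \<circ> inv \<tau>) I = w"
      using ext permutes_inverses(1)[OF assms] permutes_in_image[OF inv]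
      by (auto simp: fun_eq_iff extensional_def)
  qed (use restr inv assms in auto)
  have "\<Phi> w (X \<circ> \<tau>) = \<Phi> (?t w) X" for w
  proof -
    have "\<Phi> w (X \<circ> \<tau>) = (\<Sum>i\<in>I. X (\<tau> i) *\<^sub>R e (w (inv \<tau> (\<tau> i))))"
      using permutes_inverses(2)[OF assms] by (simp add: \<Phi>_def)
    also have "\<dots> = (\<Sum>i\<in>I. X i *\<^sub>R e (w (inv \<tau> i)))"
      using sum.permute[OF assms, of "\<lambda>i. X i *\<^sub>R e (w (inv \<tau> i))"] by (simp add: comp_def)
    finally show ?thesis by (simp add: \<Phi>_def)
  qed
  then have "mean z (X \<circ> \<tau>) = avg \<Omega> (\<lambda>w. norm (z + \<Phi> (?t w) X))" by (simp add: mean_def)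
  also have "\<dots> = mean z X"
    using sum.reindex_bij_betw[OF b, of "\<lambda>w. norm (z + \<Phi> w X)"] by (simp add: mean_def avg_def)
  finally show ?thesis .
qed

lemma mean_cong: "(\<And>i. i \<in> I \<Longrightarrow> X i = Y i) \<Longrightarrow> mean z X = mean z Y"
  by (simp add: mean_def \<Phi>_def)

lemma \<nu>_cong: "(\<And>j. j \<in> J \<Longrightarrow> x j = y j) \<Longrightarrow> \<nu> x = \<nu> y"
  unfolding \<nu>_def by (rule mean_cong) (auto simp: word_def I_def)

lemma \<nu>_triangle: "\<nu> (\<lambda>j. x j + y j) \<le> \<nu> x + \<nu> y"
proof -
  have "word (\<lambda>j. x j + y j) = (\<lambda>i. word x i + word y i)" by (auto simp: word_def)
  then show ?thesis unfolding \<nu>_def mean_def avg_add[symmetric]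
    by (auto simp: \<Phi>_add intro!: avg_mono norm_triangle_ineq)
qed

lemma \<nu>_scale: "\<nu> (\<lambda>j. c * x j) = \<bar>c\<bar> * \<nu> x"
proof -
  have "word (\<lambda>j. c * x j) = (\<lambda>i. c * word x i)" by (auto simp: word_def)
  then show ?thesis unfolding \<nu>_def mean_def by (simp add: \<Phi>_scale avg_cmult)
qed

text \<open>Each coordinate owns a positive and a negative slot; the permutation exchanging them
  everywhere changes the sign of the vector.\<close>

lemma mean_uminus: "mean z (word (\<lambda>j. - x j)) = mean z (word x)"
proof -
  define \<tau> where "\<tau> i = (if fst i \<in> J then (fst i, \<not> snd i) else i)" for i :: "'j \<times> bool"
  have "bij_betw \<tau> I I"
    by (rule bij_betwI[where g = \<tau>]) (auto simp: I_def \<tau>_def)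
  then have "\<tau> permutes I" by (rule bij_imp_permutes) (auto simp: I_def \<tau>_def)
  from mean_perm[OF this, of z "word x"]
  have "mean z (word x \<circ> \<tau>) = mean z (word x)" .
  moreover have "mean z (word x \<circ> \<tau>) = mean z (word (\<lambda>j. - x j))"
    by (rule mean_cong) (auto simp: word_def I_def \<tau>_def)
  ultimately show ?thesis by simp
qed

text \<open>\<open>z\<close> is the midpoint of \<open>z + \<Phi> w (word x)\<close> and
  \<open>z - \<Phi> w (word x)\<close>, and by \<open>mean_uminus\<close> both signs have the same
  mean. A fixed vector is thus never shortened on average, which is the source of
  independence.\<close>

lemma norm_le_mean: "norm z \<le> mean z (word x)"
proof -
  have *: "\<Phi> w (word (\<lambda>j. - x j)) = - \<Phi> w (word x)" for w
    using \<Phi>_scale[of w "-1" "word x"] by (simp add: word_def case_prod_unfold if_distrib cong: if_cong)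
  have "norm z \<le> avg \<Omega> (\<lambda>w. 1/2 * (norm (z + \<Phi> w (word x)) + norm (z + \<Phi> w (word (\<lambda>j. - x j)))))"
  proof (rule avg_ge[OF fin\<Omega> ne\<Omega>])
    fix w
    have "norm (2 *\<^sub>R z) = norm ((z + \<Phi> w (word x)) + (z - \<Phi> w (word x)))" by (simp add: scaleR_2)
    also have "\<dots> \<le> norm (z + \<Phi> w (word x)) + norm (z - \<Phi> w (word x))" by (rule norm_triangle_ineq)
    finally show "norm z \<le> 1/2 * (norm (z + \<Phi> w (word x)) + norm (z + \<Phi> w (word (\<lambda>j. - x j))))"
      by (simp add: *)
  qed
  also have "\<dots> = mean z (word x)"
    unfolding avg_cmult avg_add using mean_uminus[of z x] by (simp add: mean_def)
  finally show ?thesis .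
qed

lemma \<nu>_perm:
  assumes "\<pi> permutes J"
  shows "\<nu> (x \<circ> \<pi>) = \<nu> x"
proof -
  have "map_prod \<pi> id permutes I"
  proof (rule bij_imp_permutes)
    show "bij_betw (map_prod \<pi> id) I I"
      unfolding I_def by (rule bij_betw_map_prod) (auto simp: permutes_imp_bij[OF assms])
    show "map_prod \<pi> id i = i" if "i \<notin> I" for i
      using that permutes_not_in[OF assms, of "fst i"] by (cases i) (simp add: I_def)
  qed
  moreover have eq: "word x \<circ> map_prod \<pi> id = word (x \<circ> \<pi>)" by (auto simp: word_def fun_eq_iff)
  ultimately show ?thesis using mean_perm[of "map_prod \<pi> id" 0 "word x"]
    unfolding \<nu>_def by simp
qed

lemma \<nu>_flip: "\<nu> (x(j := - x j)) = \<nu> x"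
proof (cases "j \<in> J")
  case True
  let ?t = "Transposition.transpose (j, True) (j, False)"
  have "?t permutes I" by (rule permutes_swap_id) (auto simp: I_def True)
  from mean_perm[OF this, of 0 "word x"]
  have "mean 0 (word x \<circ> ?t) = \<nu> x" by (simp add: \<nu>_def)
  moreover have "word x \<circ> ?t = word (x(j := - x j))"
    by (auto simp: fun_eq_iff word_def Transposition.transpose_def)
  ultimately show ?thesis by (simp add: \<nu>_def)
next
  case False
  then show ?thesis by (intro \<nu>_cong) auto
qed

text \<open>A value of smaller modulus is a convex combination of \<open>x j\<close> and
  \<open>- x j\<close>; flipping a single sign preserves \<nu>, so convexity gives the
  claim.\<close>

lemma \<nu>_decrease:
  assumes "\<bar>t\<bar> \<le> \<bar>x j\<bar>"
  shows "\<nu> (x(j := t)) \<le> \<nu> x"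
proof (cases "x j = 0")
  case True then show ?thesis using assms by (metis abs_le_zero_iff abs_zero fun_upd_triv order_refl)
next
  case False
  define \<theta> where "\<theta> = (1 + t / x j) / 2"
  have "\<bar>t / x j\<bar> \<le> 1" using assms False by (simp add: divide_le_eq_1)
  then have "t / x j \<le> 1" "- 1 \<le> t / x j" by linarith+
  then have \<theta>: "0 \<le> \<theta>" "\<theta> \<le> 1" by (auto simp: \<theta>_def)
  have "\<nu> (x(j := t)) = \<nu> (\<lambda>i. \<theta> * x i + (1 - \<theta>) * (x(j := - x j)) i)"
    using False by (intro \<nu>_cong) (auto simp: \<theta>_def field_simps)
  also have "\<dots> \<le> \<theta> * \<nu> x + (1 - \<theta>) * \<nu> (x(j := - x j))"
    using \<nu>_triangle[of "\<lambda>i. \<theta> * x i" "\<lambda>i. (1 - \<theta>) * (x(j := - x j)) i"] \<theta>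
    by (simp only: \<nu>_scale abs_of_nonneg)
  also have "\<dots> = \<nu> x" by (simp add: \<nu>_flip algebra_simps)
  finally show ?thesis .
qed

lemma \<nu>_mono:
  assumes "\<And>j. j \<in> J \<Longrightarrow> \<bar>x j\<bar> \<le> \<bar>y j\<bar>"
  shows "\<nu> x \<le> \<nu> y"
proof -
  have "\<nu> (\<lambda>j. if j \<in> D then x j else y j) \<le> \<nu> y" if "finite D" "D \<subseteq> J" for D
    using that
  proof (induction D rule: finite_induct)
    case (insert d D)
    have "\<nu> ((\<lambda>j. if j \<in> D then x j else y j)(d := x d)) \<le> \<nu> (\<lambda>j. if j \<in> D then x j else y j)"
      using insert assms by (intro \<nu>_decrease) auto
    moreover have "(\<lambda>j. if j \<in> D then x j else y j)(d := x d) = (\<lambda>j. if j \<in> insert d D then x j else y j)"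
      by auto
    ultimately show ?case using insert by auto
  qed simp
  from this[OF finJ] have "\<nu> (\<lambda>j. if j \<in> J then x j else y j) \<le> \<nu> y" by simp
  moreover have "\<nu> (\<lambda>j. if j \<in> J then x j else y j) = \<nu> x" by (rule \<nu>_cong) simp
  ultimately show ?thesis by simp
qed

text \<open>\<open>f\<close> and \<open>g\<close> tag coordinates by levels. A matching of
  \<open>S\<close> into \<open>T\<close> within each level extends to a permutation of
  \<open>J\<close>, so invariance and monotonicity of \<nu> allow vectors to be compared by counting
  coordinates per level.\<close>

lemma \<nu>_dominate:
  assumes ST: "S \<subseteq> J" "T \<subseteq> J"
    and card: "\<And>l. card {s\<in>S. f s = l} \<le> card {t\<in>T. g t = l}"
    and le: "\<And>s t. s \<in> S \<Longrightarrow> t \<in> T \<Longrightarrow> f s = g t \<Longrightarrow> \<bar>x s\<bar> \<le> \<bar>y t\<bar>"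
    and x0: "\<And>j. j \<in> J - S \<Longrightarrow> x j = 0"
  shows "\<nu> x \<le> \<nu> y"
proof -
  obtain \<sigma> where \<sigma>: "inj_on \<sigma> S" "\<forall>s\<in>S. \<sigma> s \<in> T \<and> g (\<sigma> s) = f s"
    using levelwise_injection[OF _ _ card] ST finJ finite_subset by metis
  have "\<sigma> ` S \<subseteq> J" using \<sigma> ST by auto
  then obtain \<pi> where \<pi>: "\<pi> permutes J" "\<forall>s\<in>S. \<pi> s = \<sigma> s"
    using inj_extends_to_permutation[OF finJ ST(1) _ \<sigma>(1)] by blast
  have "\<nu> x \<le> \<nu> (y \<circ> \<pi>)"
  proof (rule \<nu>_mono)
    fix j assume "j \<in> J"
    then show "\<bar>x j\<bar> \<le> \<bar>(y \<circ> \<pi>) j\<bar>"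
      using \<sigma>(2) \<pi>(2) x0[of j] by (cases "j \<in> S") (auto intro!: le)
  qed
  then show ?thesis by (simp add: \<nu>_perm[OF \<pi>(1)])
qed

lemma lq_norm_word: "lq_norm q I (word x) = (2 * (\<Sum>j\<in>J. \<bar>x j\<bar> powr q)) powr (1/q)"
proof -
  have "(\<Sum>i\<in>I. \<bar>word x i\<bar> powr q) = (\<Sum>j\<in>J. \<Sum>b\<in>(UNIV::bool set). \<bar>word x (j, b)\<bar> powr q)"
    unfolding I_def by (simp add: sum.cartesian_product)
  then show ?thesis by (simp add: lq_norm_def word_def UNIV_bool sum_distrib_left)
qed

lemma \<nu>_bounds:
  shows "(2 * (\<Sum>j\<in>J. \<bar>x j\<bar> powr q)) powr (1/q) \<le> \<nu> x"
    and "\<nu> x \<le> C * (2 * (\<Sum>j\<in>J. \<bar>x j\<bar> powr q)) powr (1/q)"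
  unfolding lq_norm_word[symmetric] \<nu>_def mean_def
  by (auto intro!: avg_ge avg_le fin\<Omega> ne\<Omega> \<Phi>_bounds)

text \<open>Only the at most \<open>s\<close> coordinates where the placements disagree survive in
  the difference. Spread-out vectors have small \<open>v\<close>, hence are insensitive to moving
  few coordinates.\<close>

lemma \<Phi>_hamming:
  fixes s v :: real
  assumes "u \<in> \<Omega>" "w \<in> \<Omega>" "hdist I u w \<le> s" "v \<ge> 0" "\<And>i. i \<in> I \<Longrightarrow> \<bar>X i\<bar> \<le> v"
  shows "norm (\<Phi> u X - \<Phi> w X) \<le> 2 * C * v * s powr (1/q)"
proof -
  define D where "D = {i\<in>I. u i \<noteq> w i}"
  have D: "finite D" "D \<subseteq> I" "card D \<le> s" using finI assms(3) by (auto simp: D_def hdist_def)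
  have b: "norm (\<Sum>i\<in>D. X i *\<^sub>R e (w i)) \<le> C * (v * s powr (1/q))" if "w \<in> \<Omega>" for w
  proof -
    have "norm (\<Sum>i\<in>D. X i *\<^sub>R e (w i)) \<le> C * lq_norm q D X"
      using \<Omega>D[OF that] D by (intro embed) (auto intro: inj_on_subset)
    also have "\<dots> \<le> C * (v * s powr (1/q))"
      using D assms C q0 by (intro mult_left_mono lq_norm_le_card) auto
    finally show ?thesis .
  qed
  have "\<Phi> u X - \<Phi> w X = (\<Sum>i\<in>I. X i *\<^sub>R e (u i) - X i *\<^sub>R e (w i))"
    by (simp add: \<Phi>_def sum_subtractf)
  also have "\<dots> = (\<Sum>i\<in>D. X i *\<^sub>R e (u i) - X i *\<^sub>R e (w i))"
    using finI by (intro sum.mono_neutral_right) (auto simp: D_def)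
  finally have "norm (\<Phi> u X - \<Phi> w X) \<le> norm (\<Sum>i\<in>D. X i *\<^sub>R e (u i)) + norm (\<Sum>i\<in>D. X i *\<^sub>R e (w i))"
    by (simp add: sum_subtractf norm_triangle_ineq4)
  then show ?thesis using b[OF assms(1)] b[OF assms(2)] by simp
qed

text \<open>One placement serves all pairs \<open>(z, x)\<close> at once. The number
  \<open>s\<^sup>2\<close> has to dominate the number of coordinates, while \<eta> caps
  \<open>v * s powr (1/q)\<close>; both are possible for long spread-out vectors, where
  \<open>s\<close> can be proportional to the dimension.\<close>

lemma realize:
  fixes Z :: "'b set" and Xs :: "('j \<Rightarrow> real) set" and s \<eta> R v :: real
  assumes "finite Z" "finite Xs" and pos: "\<eta> > 0" "R \<ge> 0" "s > 0" "v \<ge> 0"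
    and v: "\<And>x j. x \<in> Xs \<Longrightarrow> j \<in> J \<Longrightarrow> \<bar>x j\<bar> \<le> v"
    and R: "\<And>x. x \<in> Xs \<Longrightarrow> lq_norm q I (word x) \<le> R"
    and \<eta>: "2 * C * v * s powr (1/q) \<le> \<eta>"
    and s1: "16 * (2 * C * R + \<eta>) / \<eta> * (2 * card J) \<le> s\<^sup>2"
    and s2: "32 * (2 * card J) * (card Z * card Xs) < s\<^sup>2"
  shows "\<exists>w\<in>\<Omega>. \<forall>z\<in>Z. \<forall>x\<in>Xs. \<bar>norm (z + \<Phi> w (word x)) - mean z (word x)\<bar> \<le> 2 * \<eta>"
proof -
  define h where "h = (\<lambda>(z, x) w. norm (z + \<Phi> w (word x)))"
  have cI: "card I = 2 * card J" by (simp add: I_def card_cartesian_product)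
  have diff: "h (z, x) u - h (z, x) w \<le> norm (\<Phi> u (word x) - \<Phi> w (word x))" for z x u w
    using norm_triangle_ineq2[of "z + \<Phi> u (word x)" "z + \<Phi> w (word x)"] by (simp add: h_def)
  have "\<exists>w\<in>injs I {..<L}. \<forall>k\<in>h ` (Z \<times> Xs). \<bar>k w - avg (injs I {..<L}) k\<bar> \<le> 2 * \<eta>"
  proof (rule concentration_injs[where s = s and R = "2 * C * R"])
    show "finite I" "finite {..<L}" "card I \<le> card {..<L}" "finite (h ` (Z \<times> Xs))"
      using finI cardJ assms by (auto simp: I_def)
    show "\<eta> > 0" "2 * C * R \<ge> 0" "s > 0" using pos C by auto
    show "16 * (2 * C * R + \<eta>) / \<eta> * card I \<le> s\<^sup>2" using s1 by (simp add: cI)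
    have "card (h ` (Z \<times> Xs)) \<le> card Z * card Xs"
      using assms card_image_le[of "Z \<times> Xs" h] by (simp add: card_cartesian_product)
    then have "real (32 * card I * card (h ` (Z \<times> Xs))) \<le> real (32 * card I * (card Z * card Xs))"
      by (intro of_nat_mono mult_left_mono) auto
    also have "\<dots> < s\<^sup>2" using s2 by (simp add: cI)
    finally show "32 * card I * card (h ` (Z \<times> Xs)) < s\<^sup>2" .
  next
    fix k u w assume k: "k \<in> h ` (Z \<times> Xs)" and uw: "u \<in> injs I {..<L}" "w \<in> injs I {..<L}"
    then obtain z x where zx: "k = h (z, x)" "x \<in> Xs" by auto
    have uw': "u \<in> \<Omega>" "w \<in> \<Omega>" using uw by (auto simp: \<Omega>_def)
    have "norm (\<Phi> u (word x) - \<Phi> w (word x)) \<le> C * lq_norm q I (word x) + C * lq_norm q I (word x)"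
      using norm_triangle_ineq4[of "\<Phi> u (word x)" "\<Phi> w (word x)"] \<Phi>_bounds(2)[OF uw'(1), of "word x"] 
        \<Phi>_bounds(2)[OF uw'(2), of "word x"] by linarith
    also have "\<dots> \<le> 2 * C * R" using mult_left_mono[OF R[OF zx(2)], of C] C by simp
    finally show "k u - k w \<le> 2 * C * R" using diff[of z x u w] zx by simp
    assume "hdist I u w \<le> s"
    then have "norm (\<Phi> u (word x) - \<Phi> w (word x)) \<le> 2 * C * v * s powr (1/q)"
      using v[OF zx(2)] pos by (intro \<Phi>_hamming uw') (auto simp: word_def I_def)
    then show "k u - k w \<le> \<eta>" using diff[of z x u w] \<eta> zx by simp
  qed
  then obtain w where w: "w \<in> \<Omega>" "\<And>k. k \<in> h ` (Z \<times> Xs) \<Longrightarrow> \<bar>k w - avg \<Omega> k\<bar> \<le> 2 * \<eta>"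
    unfolding \<Omega>_def by blast
  have "\<bar>norm (z + \<Phi> w (word x)) - mean z (word x)\<bar> \<le> 2 * \<eta>" if "z \<in> Z" "x \<in> Xs" for z x
    using w(2)[OF imageI[of "(z, x)"]] that by (simp add: h_def mean_def)
  with w(1) show ?thesis by blast
qed

end


section \<open>Vectors spread over geometric levels\<close>

text \<open>Values too small to be rounded within a factor 3/2 are sent to the last power
  \<open>(2/3)^N\<close>; hence the alternative \<open>j = N\<close>.\<close>

lemma geometric_round_up:
  fixes y :: real
  assumes "y \<le> 1"
  shows "\<exists>j\<le>N. y \<le> (2/3)^j \<and> ((2/3)^j \<le> 3/2 * y \<or> j = N)"
proof (induction N)
  case (Suc N)
  then obtain j where j: "j \<le> N" "y \<le> (2/3)^j" "(2/3)^j \<le> 3/2 * y \<or> j = N" by blast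
  show ?case
  proof (cases "(2/3)^j \<le> 3/2 * y")
    case True with j show ?thesis by (intro exI[of _ j]) auto
  next
    case False
    then have "j = N" "y < (2/3)^Suc N" using j by auto
    then show ?thesis by (intro exI[of _ "Suc N"]) auto
  qed
qed (use assms in auto)

lemma geometric_round_down:
  fixes y :: real
  assumes "y \<le> 1" "(2/3)^N \<le> y"
  shows "\<exists>j\<le>N. (2/3)^j \<le> y \<and> y \<le> 3/2 * (2/3)^j"
  using assms(2)
proof (induction N)
  case 0
  then show ?case using assms by (intro exI[of _ 0]) auto
next
  case (Suc N)
  show ?case
  proof (cases "(2/3)^N \<le> y")
    case True with Suc.IH show ?thesis by (metis le_SucI)
  next
    case False with Suc.prems show ?thesis by (intro exI[of _ "Suc N"]) auto
  qed
qed

text \<open>A vector with about \<open>(3/2)\<^sup>k\<close> coordinates of size \<open>(2/3)\<^bsup>k/q\<^esup>\<close> for each \<open>k < K\<close> has the same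
  \<open>q\<close>-mass on every level, and multiplying it by \<open>(2/3)\<^bsup>j/q\<^esup>\<close> amounts to a shift of the levels.\<close>

definition level_card :: "nat \<Rightarrow> nat \<Rightarrow> nat \<Rightarrow> nat" where
  "level_card K m k = m * 3 ^ k * 2 ^ (K - k)"

text \<open>The denominator makes the \<open>q\<close>-mass of each of the \<open>K\<close> levels
  equal to \<open>1 / (2 * K)\<close>; the 2 accounts for the two signed slots of
  \<open>word\<close>.\<close>

definition level_val :: "real \<Rightarrow> nat \<Rightarrow> nat \<Rightarrow> nat \<Rightarrow> real" where
  "level_val q K m k = ((2/3) ^ k / (2 * real K * real m * 2 ^ K)) powr (1/q)"

text \<open>In \<open>(i, k, c)\<close>, \<open>i\<close> is the coordinate of the space to be
  embedded, \<open>k\<close> the level, and \<open>c\<close> counts the repetitions on that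
  level.\<close>

definition coords :: "nat \<Rightarrow> nat \<Rightarrow> nat \<Rightarrow> (nat \<times> nat \<times> nat) set" where
  "coords n K m = (SIGMA i:{..<n}. SIGMA k:{..<K}. {..<level_card K m k})"

definition level_vec :: "real \<Rightarrow> nat \<Rightarrow> nat \<Rightarrow> (nat \<Rightarrow> real) \<Rightarrow> nat \<times> nat \<times> nat \<Rightarrow> real" where
  "level_vec q K m a = (\<lambda>(i, k, c). a i * level_val q K m k)"

abbreviation cut :: "(nat \<Rightarrow> bool) \<Rightarrow> (nat \<times> nat \<times> nat \<Rightarrow> real) \<Rightarrow> nat \<times> nat \<times> nat \<Rightarrow> real" where
  "cut P y \<equiv> \<lambda>(i, k, c). if P k then y (i, k, c) else 0"

text \<open>The factor \<open>2 ^ K\<close> clears the denominators of \<open>(3/2) ^ k\<close>, so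
  that the levels grow by the exact ratio 3/2 and a shift needs no rounding of
  cardinalities.\<close>

lemma real_level_card:
  assumes "k \<le> K"
  shows "real (level_card K m k) = real m * 2 ^ K * (3/2) ^ k"
proof -
  have "(2::real) ^ (K - k) = 2 ^ K / 2 ^ k" using assms by (simp add: power_diff)
  then show ?thesis by (simp add: level_card_def power_divide)
qed

lemma finite_coords [simp]: "finite (coords n K m)"
  by (simp add: coords_def)

lemma level_val_nonneg [simp]: "level_val q K m k \<ge> 0"
  by (simp add: level_val_def)

lemma level_val_add: "level_val q K m (k + j) = level_val q K m k * ((2/3) ^ j) powr (1/q)"
  unfolding level_val_def power_add by (subst powr_mult[symmetric]) (simp add: mult_ac)

lemma level_val_powr: "q > 0 \<Longrightarrow> level_val q K m k powr q = (2/3) ^ k / (2 * real K * real m * 2 ^ K)"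
  by (simp add: level_val_def powr_powr)

lemma level_mass:
  assumes "q > 0" "K > 0" "m > 0" "k < K"
  shows "real (level_card K m k) * level_val q K m k powr q = 1 / (2 * real K)"
proof -
  have "(3/2) ^ k * (2/3) ^ k = (1::real)" by (simp flip: power_mult_distrib)
  then show ?thesis using assms by (simp add: real_level_card level_val_powr field_simps)
qed

text \<open>Since \<open>q \<ge> 1\<close>, the size drops over two levels by
  \<open>(4/9) powr (1/q) \<ge> 4/9\<close>. A shift by two levels thus absorbs a factor 9/4 in
  cardinality at the price of a factor at most 9/4 in size.\<close>

lemma level_val_2:
  assumes "q \<ge> 1"
  shows "level_val q K m k \<le> 9/4 * level_val q K m (k + 2)"
proof -
  have "(4/9::real) powr 1 \<le> (4/9) powr (1/q)" using assms by (intro powr_mono') auto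
  then have "4/9 \<le> ((2/3)^2::real) powr (1/q)" by (simp add: power2_eq_square)
  then have "9/4 * level_val q K m k * (4/9) \<le> 9/4 * level_val q K m k * ((2/3)^2) powr (1/q)"
    by (intro mult_left_mono) auto
  then show ?thesis unfolding level_val_add by simp
qed

lemma sum_over_Sigma:
  assumes "finite A" "\<And>x. x \<in> A \<Longrightarrow> finite (B x)"
  shows "sum g (Sigma A B) = (\<Sum>x\<in>A. \<Sum>y\<in>B x. g (x, y))"
  using sum.Sigma[of A B "\<lambda>x y. g (x, y)"] assms by (simp add: case_prod_eta)

lemma sum_level_vec:
  assumes "q > 0" "K > 0" "m > 0"
  shows "(\<Sum>j\<in>coords n K m. \<bar>(cut P (level_vec q K m a) j)\<bar> powr q)
    = (\<Sum>i<n. \<bar>a i\<bar> powr q) * (card {k. k < K \<and> P k} / (2 * real K))"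
proof -
  have "(\<Sum>j\<in>coords n K m. \<bar>(cut P (level_vec q K m a) j)\<bar> powr q)
    = (\<Sum>i<n. \<Sum>k<K. \<Sum>c<level_card K m k. \<bar>if P k then level_vec q K m a (i, k, c) else 0\<bar> powr q)"
    unfolding coords_def by (subst sum_over_Sigma, simp, simp, rule sum.cong[OF refl], subst sum_over_Sigma, simp_all)
  also have "\<dots> = (\<Sum>i<n. \<Sum>k<K. if P k then \<bar>a i\<bar> powr q * (1 / (2 * real K)) else 0)"
  proof (intro sum.cong refl)
    fix i k assume k: "k \<in> {..<K}"
    show "(\<Sum>c<level_card K m k. \<bar>if P k then level_vec q K m a (i, k, c) else 0\<bar> powr q) =
      (if P k then \<bar>a i\<bar> powr q * (1 / (2 * real K)) else 0)"
    proof -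
      have "real (level_card K m k) * (\<bar>a i\<bar> powr q * level_val q K m k powr q) = \<bar>a i\<bar> powr q * (1 / (2 * real K))"
        using k by (subst level_mass[OF assms, symmetric]) auto
      then show ?thesis by (auto simp: level_vec_def abs_mult powr_mult)
    qed
  qed
  also have "\<dots> = (\<Sum>i<n. \<bar>a i\<bar> powr q * (card {k. k < K \<and> P k} / (2 * real K)))"
  proof (rule sum.cong[OF refl])
    fix i
    have "(\<Sum>k<K. if P k then \<bar>a i\<bar> powr q * (1 / (2 * real K)) else 0) =
      (\<Sum>k\<in>{k. k < K \<and> P k}. \<bar>a i\<bar> powr q * (1 / (2 * real K)))"
      by (rule sum.mono_neutral_cong_right) auto
    then show "(\<Sum>k<K. if P k then \<bar>a i\<bar> powr q * (1 / (2 * real K)) else 0) =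
      \<bar>a i\<bar> powr q * (card {k. k < K \<and> P k} / (2 * real K))" by simp
  qed
  also have "\<dots> = (\<Sum>i<n. \<bar>a i\<bar> powr q) * (card {k. k < K \<and> P k} / (2 * real K))"
    by (rule sum_distrib_right[symmetric])
  finally show ?thesis .
qed

definition first_unit :: "nat \<Rightarrow> real" where "first_unit i = (if i = 0 then 1 else 0)"

locale multiscale = random_lq e L q C "coords n K m"
  for e :: "nat \<Rightarrow> 'b::real_normed_vector" and L q C n K m +
  assumes nKm: "n > 0" "K > 0" "m > 0"
begin

abbreviation "x \<equiv> level_vec q K m"

lemma lq_norm_word_vec: "lq_norm q I (word (x a)) = lq_norm q {..<n} a"
proof -
  have "(\<Sum>j\<in>coords n K m. \<bar>x a j\<bar> powr q) = (\<Sum>i<n. \<bar>a i\<bar> powr q) * (1/2)"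
    using sum_level_vec[OF q0 nKm(2,3), where P = "\<lambda>_. True" and n = n and a = a] nKm by (simp add: case_prod_unfold)
  then have "2 * (\<Sum>j\<in>coords n K m. \<bar>x a j\<bar> powr q) = (\<Sum>i<n. \<bar>a i\<bar> powr q)" by simp
  then show ?thesis unfolding lq_norm_word by (simp only: lq_norm_def)
qed

text \<open>The levels kept carry at most the fraction \<open>N / K\<close> of the mass. This is
  where the distortion \<open>C\<close> is made harmless: it multiplies a quantity tending to 0 as
  \<open>K\<close> grows.\<close>

lemma edge:
  assumes "lq_norm q {..<n} a = 1" "card {k. k < K \<and> P k} \<le> N"
  shows "\<nu> (cut P (x a)) \<le> C * (real N / K) powr (1/q)"
proof -
  let ?x = "cut P (x a)"
  have 1: "(\<Sum>i<n. \<bar>a i\<bar> powr q) = 1" using lq_norm_powr[OF q0, of "{..<n}" a] assms by simp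
  have "2 * (\<Sum>j\<in>coords n K m. \<bar>?x j\<bar> powr q) = card {k. k < K \<and> P k} / K"
    unfolding sum_level_vec[OF q0 nKm(2,3)] 1 by simp
  also have "\<dots> \<le> real N / K" using assms by (intro divide_right_mono) auto
  finally have "C * (2 * (\<Sum>j\<in>coords n K m. \<bar>?x j\<bar> powr q)) powr (1/q) \<le> C * (real N / K) powr (1/q)"
    using q0 C by (intro mult_left_mono powr_mono2) (auto intro: sum_nonneg)
  with \<nu>_bounds(2)[of ?x] show ?thesis by linarith
qed

lemma lq_norm_first_unit: "lq_norm q {..<n} first_unit = 1"
proof -
  have "(\<Sum>i<n. \<bar>first_unit i\<bar> powr q) = (\<Sum>i<n. if i = 0 then 1 else 0)"
    by (intro sum.cong) (auto simp: first_unit_def)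
  also have "\<dots> = 1" using nKm by (simp add: sum.delta)
  finally show ?thesis by (simp add: lq_norm_def)
qed

lemma \<nu>_split: "\<nu> (x a) \<le> \<nu> (cut P (x a)) 
   + \<nu> (cut (\<lambda>k. \<not> P k) (x a))"
proof -
  have "x a = (\<lambda>j. (cut P (x a) j) +
     (cut (\<lambda>k. \<not> P k) (x a) j))"
    by auto
  then show ?thesis
    using \<nu>_triangle[of "cut P (x a)" "cut (\<lambda>k. \<not> P k) (x a)"]
    by (simp only:)
qed

text \<open>Round each \<open>\<bar>a i\<bar> powr q\<close> up to \<open>(2/3)^j i\<close>. Level
  \<open>k\<close> of coordinate \<open>i\<close> then looks like level \<open>k + j i\<close> of a
  unit vector, and level \<open>l\<close> of the superposition has at most
  \<open>level_card K m l\<close> times the sum of the \<open>(2/3)^j i\<close> coordinates. As this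
  sum is at most 9/4, they fit into level \<open>l + 2\<close> of one unit vector.\<close>

lemma \<nu>_upper:
  assumes a: "lq_norm q {..<n} a = 1" and N: "real n * (2/3)^N \<le> 1/3"
  shows "\<nu> (x a) \<le> 9/4 * \<nu> (x first_unit) + C * (real (N + 2) / K) powr (1/q)"
proof -
  have suma: "(\<Sum>i<n. \<bar>a i\<bar> powr q) = 1" using lq_norm_powr[OF q0, of "{..<n}" a] a by simp
  have "\<bar>a i\<bar> powr q \<le> 1" if "i < n" for i
    using member_le_sum[of i "{..<n}" "\<lambda>i. \<bar>a i\<bar> powr q"] that suma by auto
  then have "\<forall>i. \<exists>j. i < n \<longrightarrow> j \<le> N \<and> \<bar>a i\<bar> powr q \<le> (2/3)^j \<and> ((2/3)^j \<le> 3/2 * \<bar>a i\<bar> powr q \<or> j = N)"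
    using geometric_round_up by meson
  then obtain j where j: "\<And>i. i < n \<Longrightarrow> j i \<le> N" "\<And>i. i < n \<Longrightarrow> \<bar>a i\<bar> powr q \<le> (2/3)^j i"
    "\<And>i. i < n \<Longrightarrow> (2/3)^j i \<le> 3/2 * \<bar>a i\<bar> powr q \<or> j i = N" by metis
  have "(\<Sum>i<n. (2/3)^j i) \<le> (\<Sum>i<n. 3/2 * \<bar>a i\<bar> powr q + (2/3)^N)"
    using j(3) by (intro sum_mono) (force simp: add_increasing add_increasing2)
  also have "\<dots> = 3/2 + real n * (2/3)^N" unfolding sum.distrib sum_distrib_left[symmetric] suma by simp
  \<comment> \<open>Rounding contributes 3/2, and the coordinates sent to \<open>(2/3)^N\<close> at
    most 1/3; 9/4 leaves room and is exactly the growth over two levels.\<close>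
  finally have sumj: "(\<Sum>i<n. (2/3)^j i) \<le> (9/4::real)" using N by simp
  \<comment> \<open>A level is kept only if the shift by \<open>j i + 2 \<le> N + 2\<close> stays
    below \<open>K\<close>; the remaining top levels go to \<open>edge\<close>.\<close>
  define P where "P k \<longleftrightarrow> k + N + 2 < K" for k
  define S where "S = {s \<in> coords n K m. P (fst (snd s))}"
  \<comment> \<open>Levels 0 and 1 are excluded so that the truncated subtraction
    \<open>k - 2\<close> is a genuine shift.\<close>
  define T where "T = {t \<in> coords n K m. fst t = 0 \<and> fst (snd t) \<ge> 2}"
  have "\<nu> (cut P (x a)) \<le> \<nu> (\<lambda>j. 9/4 * x first_unit j)"
  proof (rule \<nu>_dominate[where S = S and T = T and f = "\<lambda>(i, k, c). k + j i" and g = "\<lambda>(i, k, c). k - 2"])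
    show "S \<subseteq> coords n K m" "T \<subseteq> coords n K m" by (auto simp: S_def T_def)
    show "(cut P (x a) s) = 0" if "s \<in> coords n K m - S" for s
      using that by (cases s) (auto simp: S_def)
    fix l
    let ?A = "{s \<in> S. (case s of (i, k, c) \<Rightarrow> k + j i) = l}"
    let ?B = "{t \<in> T. (case t of (i, k, c) \<Rightarrow> k - 2) = l}"
    show "card ?A \<le> card ?B"
    proof (cases "l + 2 < K")
      case False
      then have empty: "?A = {}"
        using j(1) by (force simp: S_def P_def coords_def)
      show ?thesis unfolding empty by simp
    next
      case True
      define I' where "I' = {i. i < n \<and> j i \<le> l}"
    let ?C = "(\<lambda>(i, c). (i, l - j i, c)) ` (SIGMA i:I'. {..<level_card K m (l - j i)})"
      have "?A \<subseteq>
          ?C"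
      proof
        fix s assume s: "s \<in> ?A"
        obtain i k c where [simp]: "s = (i, k, c)" by (cases s)
        have "k = l - j i" "j i \<le> l" "i < n" "c < level_card K m k" using s by (auto simp: S_def coords_def)
        then show "s \<in> ?C"
          by (intro image_eqI[of _ _ "(i, c)"]) (auto simp: I'_def)
      qed
      then have "card ?A \<le>
          card (?C)"
        by (rule card_mono[rotated]) (simp add: I'_def)
      also have "\<dots> \<le> card (SIGMA i:I'. {..<level_card K m (l - j i)})"
        by (rule card_image_le) (auto simp: I'_def)
      also have "\<dots> = (\<Sum>i\<in>I'. level_card K m (l - j i))" by (simp add: I'_def)
      finally have "real (card ?A) \<le> 
        real (\<Sum>i\<in>I'. level_card K m (l - j i))" by (rule of_nat_mono)
      also have "\<dots> = (\<Sum>i\<in>I'. real m * 2^K * (3/2)^l * (2/3)^j i)"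
        unfolding of_nat_sum
      proof (rule sum.cong[OF refl])
        fix i assume "i \<in> I'"
        then have "(3/2)^l = (3/2)^(l - j i) * (3/2::real)^j i" by (simp add: I'_def flip: power_add)
        moreover have "(3/2::real)^j i * (2/3)^j i = 1" by (simp flip: power_mult_distrib)
        ultimately show "real (level_card K m (l - j i)) = real m * 2^K * (3/2)^l * (2/3)^j i"
          using True by (simp add: real_level_card)
      qed
      also have "\<dots> = real m * 2^K * (3/2)^l * (\<Sum>i\<in>I'. (2/3)^j i)" by (simp add: sum_distrib_left)
      also have "\<dots> \<le> real m * 2^K * (3/2)^l * (\<Sum>i<n. (2/3)^j i)"
        by (intro mult_left_mono sum_mono2) (auto simp: I'_def)
      also have "\<dots> \<le> real m * 2^K * (3/2)^l * (9/4)" by (intro mult_left_mono sumj) auto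
      also have "\<dots> = real (level_card K m (l + 2))" using True by (simp add: real_level_card power_add power2_eq_square)
      also have "\<dots> = real (card ((\<lambda>c. (0::nat, l + 2, c)) ` {..<level_card K m (l + 2)}))"
        by (subst card_image) (auto simp: inj_on_def)
      also have "\<dots> \<le> real (card ?B)"
        using True nKm by (intro of_nat_mono card_mono) (auto simp: T_def coords_def)
      finally show ?thesis by simp
    qed
  next
    fix s t assume st: "s \<in> S" "t \<in> T" and eq: "(case s of (i, k, c) \<Rightarrow> k + j i) = (case t of (i, k, c) \<Rightarrow> k - 2)"
    obtain i k c where s: "s = (i, k, c)" by (cases s)
    obtain l d where t: "t = (0, l, d)" using st by (cases t) (auto simp: T_def)
    have i: "i < n" using st by (auto simp: s S_def coords_def)
    have l: "l = k + j i + 2" using st eq by (auto simp: s t T_def)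
    have "(\<bar>a i\<bar> powr q) powr (1/q) \<le> ((2/3)^j i) powr (1/q)"
      using j(2)[OF i] q0 by (intro powr_mono2) auto
    then have "\<bar>a i\<bar> \<le> ((2/3)^j i) powr (1/q)" using q0 by (simp add: powr_powr)
    from mult_left_mono[OF this, of "level_val q K m k"]
    have "\<bar>a i\<bar> * level_val q K m k \<le> level_val q K m (k + j i)"
      by (simp add: level_val_add mult.commute)
    also have "\<dots> \<le> 9/4 * level_val q K m l" unfolding l by (rule level_val_2[OF q])
    finally have "\<bar>a i\<bar> * level_val q K m k \<le> 9/4 * level_val q K m l" .
    then show "\<bar>cut P (x a) s\<bar> \<le> \<bar>9/4 * x first_unit t\<bar>"
      by (simp add: s t level_vec_def first_unit_def abs_mult)
  qed
  moreover have "\<nu> (cut (\<lambda>k. \<not> P k) (x a)) \<le> C * (real (N + 2) / K) powr (1/q)"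
  proof (rule edge[OF a])
    have "{k. k < K \<and> \<not> P k} \<subseteq> {K - (N + 2)..<K}" by (auto simp: P_def)
    from card_mono[OF _ this] show "card {k. k < K \<and> \<not> P k} \<le> N + 2" by simp
  qed
  ultimately show ?thesis using \<nu>_split[of a P] \<nu>_scale[of "9/4" "x first_unit"] by linarith
qed

text \<open>The coordinates that are not negligible (the set \<open>G\<close>) are rounded down and
  still have total at least 4/9, so level \<open>l\<close> of the unit vector fits into the levels
  \<open>l + 2 - j i\<close> of \<open>x a\<close>, taken together over \<open>i\<close> in
  \<open>G\<close>.\<close>

lemma \<nu>_lower:
  assumes a: "lq_norm q {..<n} a = 1" and N: "real n * (2/3)^N \<le> 1/3"
  shows "\<nu> (x first_unit) \<le> 9/4 * \<nu> (x a) + C * (real (N + 2) / K) powr (1/q)"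
proof -
  have suma: "(\<Sum>i<n. \<bar>a i\<bar> powr q) = 1" using lq_norm_powr[OF q0, of "{..<n}" a] a by simp
  have a1: "\<bar>a i\<bar> powr q \<le> 1" if "i < n" for i
    using member_le_sum[of i "{..<n}" "\<lambda>i. \<bar>a i\<bar> powr q"] that suma by auto
  define G where "G = {i. i < n \<and> (2/3)^N \<le> \<bar>a i\<bar> powr q}"
  have "\<forall>i. \<exists>j. i \<in> G \<longrightarrow> j \<le> N \<and> (2/3)^j \<le> \<bar>a i\<bar> powr q \<and> \<bar>a i\<bar> powr q \<le> 3/2 * (2/3)^j"
    using geometric_round_down a1 unfolding G_def by blast
  then obtain j where j: "\<And>i. i \<in> G \<Longrightarrow> j i \<le> N" "\<And>i. i \<in> G \<Longrightarrow> (2/3)^j i \<le> \<bar>a i\<bar> powr q"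
    "\<And>i. i \<in> G \<Longrightarrow> \<bar>a i\<bar> powr q \<le> 3/2 * (2/3)^j i" by metis
  have "1 = (\<Sum>i<n. \<bar>a i\<bar> powr q)" using suma by simp
  also have "\<dots> \<le> (\<Sum>i<n. (if i \<in> G then 3/2 * (2/3)^j i else 0) + (2/3)^N)"
    using j(3) by (intro sum_mono) (auto simp: G_def add_increasing2)
  also have "\<dots> = 3/2 * (\<Sum>i\<in>G. (2/3)^j i) + real n * (2/3)^N"
  proof -
    have "(\<Sum>i<n. if i \<in> G then 3/2 * (2/3)^j i else 0) = (\<Sum>i\<in>G. 3/2 * (2/3)^j i :: real)"
      by (rule sum.mono_neutral_cong_right) (auto simp: G_def)
    then show ?thesis by (simp add: sum.distrib sum_distrib_left)
  qed
  finally have sumj: "4/9 \<le> (\<Sum>i\<in>G. (2/3)^j i :: real)" using N by simp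
  \<comment> \<open>\<open>N \<le> k\<close> guarantees \<open>j i \<le> k\<close>, so that
    \<open>k + 2 - j i\<close> involves no truncation; \<open>k + 2 < K\<close> keeps it below
    \<open>K\<close>.\<close>
  define P where "P k \<longleftrightarrow> N \<le> k \<and> k + 2 < K" for k
  define S where "S = {s \<in> coords n K m. fst s = 0 \<and> P (fst (snd s))}"
  define T where "T = {t \<in> coords n K m. fst t \<in> G \<and> fst (snd t) + j (fst t) \<ge> 2}"
  have "\<nu> (cut P (x first_unit)) \<le> \<nu> (\<lambda>j. 9/4 * x a j)"
  proof (rule \<nu>_dominate[where S = S and T = T and f = "\<lambda>(i, k, c). k" and g = "\<lambda>(i, k, c). k + j i - 2"])
    show "S \<subseteq> coords n K m" "T \<subseteq> coords n K m" by (auto simp: S_def T_def)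
    show "(cut P (x first_unit) s) = 0" if "s \<in> coords n K m - S" for s
      using that by (cases s) (auto simp: S_def level_vec_def first_unit_def)
    fix l
    let ?A = "{s \<in> S. (case s of (i, k, c) \<Rightarrow> k) = l}"
    let ?B = "{t \<in> T. (case t of (i, k, c) \<Rightarrow> k + j i - 2) = l}"
    let ?C = "(\<lambda>(i, c). (i, l + 2 - j i, c)) ` (SIGMA i:G. {..<level_card K m (l + 2 - j i)})"
    show "card ?A \<le> card ?B"
    proof (cases "P l")
      case False
      then have empty: "?A = {}" by (auto simp: S_def)
      show ?thesis unfolding empty by simp
    next
      case True
      have "?A \<subseteq> (\<lambda>c. (0, l, c)) ` {..<level_card K m l}"
        by (auto simp: S_def coords_def)
      then have "card ?A \<le> card ((\<lambda>c. (0::nat, l, c)) ` {..<level_card K m l})"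
        by (rule card_mono[rotated]) simp
      also have "\<dots> \<le> card {..<level_card K m l}" by (rule card_image_le) simp
      finally have "real (card ?A) \<le> real (level_card K m l)" by simp
      also have "\<dots> = real m * 2^K * (3/2)^(l + 2) * (4/9)" 
        using True by (simp add: real_level_card P_def power_add power2_eq_square)
      also have "\<dots> \<le> real m * 2^K * (3/2)^(l + 2) * (\<Sum>i\<in>G. (2/3)^j i)" by (intro mult_left_mono sumj) auto
      also have "\<dots> = (\<Sum>i\<in>G. real m * 2^K * (3/2)^(l + 2) * (2/3)^j i)" by (simp add: sum_distrib_left)
      also have "\<dots> = (\<Sum>i\<in>G. real (level_card K m (l + 2 - j i)))"
      proof (rule sum.cong[OF refl])
        fix i assume i: "i \<in> G"
        have le: "j i \<le> l + 2" using j(1)[OF i] True by (simp add: P_def)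
        then have pw: "(3/2)^(l + 2) = (3/2)^(l + 2 - j i) * (3/2::real)^j i" 
          by (simp only: le_add_diff_inverse2 flip: power_add)
        have one: "(3/2::real)^j i * (2/3)^j i = 1" by (simp flip: power_mult_distrib)
        have "real m * 2^K * (3/2)^(l + 2) * (2/3)^j i = real m * 2^K * (3/2)^(l + 2 - j i) * ((3/2)^j i * (2/3)^j i)"
          unfolding pw by (simp only: mult_ac)
        also have "\<dots> = real (level_card K m (l + 2 - j i))"
          unfolding one using True by (subst real_level_card) (auto simp: P_def)
        finally show "real m * 2^K * (3/2)^(l + 2) * (2/3)^j i = real (level_card K m (l + 2 - j i))" .
      qed
      also have "\<dots> = real (card (SIGMA i:G. {..<level_card K m (l + 2 - j i)}))"
        by (subst card_SigmaI) (simp_all add: G_def del: add_2_eq_Suc')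
      also have "\<dots> = real (card (?C))"
        by (subst card_image) (auto simp: inj_on_def)
      also have "\<dots> \<le> real (card ?B)"
      proof (intro of_nat_mono card_mono)
        show "finite ?B" by (simp add: T_def)
        show "?C \<subseteq>
          ?B"
        proof clarify
          fix i c assume i: "i \<in> G" "c < level_card K m (l + 2 - j i)"
          then have "j i \<le> l" "l + 2 < K" "i < n" using j(1)[OF i(1)] True by (auto simp: P_def G_def)
          then show "(i, l + 2 - j i, c) \<in> T \<and> l + 2 - j i + j i - 2 = l"
            using i by (auto simp: T_def coords_def)
        qed
      qed
      finally show ?thesis by simp
    qed
  next
    fix s t assume st: "s \<in> S" "t \<in> T" and eq: "(case s of (i, k, c) \<Rightarrow> k) = (case t of (i, k, c) \<Rightarrow> k + j i - 2)"
    obtain i k c where t: "t = (i, k, c)" by (cases t)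
    obtain l d where s: "s = (0, l, d)" using st by (cases s) (auto simp: S_def)
    have i: "i \<in> G" using st by (auto simp: t T_def)
    have l: "l + 2 = k + j i" using st eq by (auto simp: s t T_def)
    have "((2/3)^j i) powr (1/q) \<le> (\<bar>a i\<bar> powr q) powr (1/q)"
      using j(2)[OF i] q0 by (intro powr_mono2) auto
    then have *: "((2/3)^j i) powr (1/q) \<le> \<bar>a i\<bar>" using q0 by (simp add: powr_powr)
    have "level_val q K m l \<le> 9/4 * level_val q K m (k + j i)" using level_val_2[OF q, of K m l] unfolding l .
    also have "\<dots> \<le> 9/4 * (level_val q K m k * \<bar>a i\<bar>)"
      unfolding level_val_add by (intro mult_left_mono *) auto
    finally show "\<bar>cut P (x first_unit) s\<bar> \<le> \<bar>9/4 * x a t\<bar>"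
      by (simp add: s t level_vec_def first_unit_def abs_mult mult_ac)
  qed
  moreover have "\<nu> (cut (\<lambda>k. \<not> P k) (x first_unit)) \<le> C * (real (N + 2) / K) powr (1/q)"
  proof (rule edge[OF lq_norm_first_unit])
    have "{k. k < K \<and> \<not> P k} \<subseteq> {..<N} \<union> {K - 2..<K}" by (auto simp: P_def)
    then have "card {k. k < K \<and> \<not> P k} \<le> card ({..<N} \<union> {K - 2..<K})" by (rule card_mono[rotated]) auto
    also have "\<dots> \<le> card {..<N} + card {K - 2..<K}" by (rule card_Un_le)
    finally show "card {k. k < K \<and> \<not> P k} \<le> N + 2" by simp
  qed
  ultimately show ?thesis using \<nu>_split[of first_unit P] \<nu>_scale[of "9/4" "x a"] by linarith
qed

end


section \<open>Uniform copies of finite-dimensional spaces, finite exponent\<close>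

text \<open>Rounding to the grid of mesh \<open>\<tau> / n\<close> sorts \<open>S\<close> into
  finitely many boxes; one representative of each nonempty box, taken in \<open>S\<close> itself, is
  enough.\<close>

lemma finite_net:
  fixes S :: "(nat \<Rightarrow> real) set"
  assumes "\<And>a i. a \<in> S \<Longrightarrow> i < n \<Longrightarrow> \<bar>a i\<bar> \<le> R" and \<tau>: "\<tau> > 0" and n: "n > 0"
  shows "\<exists>Q. finite Q \<and> Q \<subseteq> S \<and> (\<forall>a\<in>S. \<exists>b\<in>Q. (\<Sum>i<n. \<bar>a i - b i\<bar>) \<le> \<tau>)"
proof -
  define c where "c a = (\<lambda>i\<in>{..<n}. \<lfloor>a i * n / \<tau>\<rfloor>)" for a :: "nat \<Rightarrow> real"
  have "c ` S \<subseteq> {..<n} \<rightarrow>\<^sub>E {\<lfloor>- R * n / \<tau>\<rfloor>..\<lfloor>R * n / \<tau>\<rfloor>}"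
  proof (intro image_subsetI PiE_I)
    fix a i assume a: "a \<in> S" "i \<in> {..<n}"
    then have "- R \<le> a i" "a i \<le> R" using assms(1)[of a i] by auto
    then have "- R * n / \<tau> \<le> a i * n / \<tau>" "a i * n / \<tau> \<le> R * n / \<tau>"
      using \<tau> by (intro divide_right_mono mult_right_mono; simp)+
    then show "c a i \<in> {\<lfloor>- R * n / \<tau>\<rfloor>..\<lfloor>R * n / \<tau>\<rfloor>}"
      using a(2) by (auto simp: c_def intro!: floor_mono)
  qed (auto simp: c_def)
  then have fin: "finite (c ` S)" by (rule finite_subset) (intro finite_PiE; simp)
  define Q where "Q = inv_into S c ` c ` S"
  have "(\<Sum>i<n. \<bar>a i - b i\<bar>) \<le> \<tau>" if "c a = c b" for a b
  proof -
    have "(\<Sum>i<n. \<bar>a i - b i\<bar>) \<le> (\<Sum>i<n. \<tau> / n)"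
    proof (rule sum_mono)
      fix i assume "i \<in> {..<n}"
      then have "\<lfloor>a i * n / \<tau>\<rfloor> = \<lfloor>b i * n / \<tau>\<rfloor>" using fun_cong[OF that, of i] by (simp add: c_def)
      then have "\<bar>a i * n / \<tau> - b i * n / \<tau>\<bar> \<le> 1" by linarith
      then have "\<bar>(a i - b i) * (n / \<tau>)\<bar> \<le> 1" by (simp add: algebra_simps)
      then have "\<bar>a i - b i\<bar> * (n / \<tau>) \<le> 1" using \<tau> unfolding abs_mult by simp
      then show "\<bar>a i - b i\<bar> \<le> \<tau> / n" using \<tau> n by (simp add: field_simps)
    qed
    also have "\<dots> = \<tau>" using n by simp
    finally show ?thesis .
  qed
  moreover have "c (inv_into S c (c a)) = c a" if "a \<in> S" for a using that by (simp add: f_inv_into_f)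
  ultimately have "\<forall>a\<in>S. \<exists>b\<in>Q. (\<Sum>i<n. \<bar>a i - b i\<bar>) \<le> \<tau>" unfolding Q_def by (metis imageI)
  moreover have "Q \<subseteq> S" by (auto simp: Q_def inv_into_into)
  moreover have "finite Q" unfolding Q_def using fin by (rule finite_imageI)
  ultimately show ?thesis by blast
qed

context multiscale
begin

text \<open>For a fixed placement the construction is linear in \<open>a\<close>; this turns a good
  placement into \<open>n\<close> vectors whose linear combinations are controlled.\<close>

lemma \<Phi>_vec: "\<Phi> w (word (x a)) = (\<Sum>i<n. a i *\<^sub>R \<Phi> w (word (x (\<lambda>j. if j = i then 1 else 0))))"
proof -
  have "word (x a) s = (\<Sum>i<n. a i * word (x (\<lambda>j. if j = i then 1 else 0)) s)" if s: "s \<in> I" for s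
  proof -
    obtain l k c b where [simp]: "s = ((l, k, c), b)" by (metis prod.exhaust)
    have "(\<Sum>i<n. a i * word (x (\<lambda>j. if j = i then 1 else 0)) s) = (\<Sum>i<n. if i = l then word (x a) s else 0)"
      by (intro sum.cong) (auto simp: word_def level_vec_def)
    moreover have "(l, k, c) \<in> coords n K m" using s by (simp add: I_def)
    then have "l < n" by (simp add: coords_def)
    ultimately show ?thesis by simp
  qed
  then have "\<Phi> w (word (x a)) = (\<Sum>s\<in>I. \<Sum>i<n. (a i * word (x (\<lambda>j. if j = i then 1 else 0)) s) *\<^sub>R e (w s))"
    unfolding \<Phi>_def by (simp add: scaleR_sum_left)
  also have "\<dots> = (\<Sum>i<n. a i *\<^sub>R \<Phi> w (word (x (\<lambda>j. if j = i then 1 else 0))))"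
    unfolding \<Phi>_def by (subst sum.swap) (simp add: scaleR_sum_right)
  finally show ?thesis .
qed

lemma card_coords: "card (coords n K m) = n * m * (\<Sum>k<K. 3 ^ k * 2 ^ (K - k))"
  by (simp add: coords_def level_card_def sum_distrib_left mult_ac)

end

lemma exists_large_K:
  fixes N c C q :: real
  assumes "q \<ge> 1" "c > 0" "C > 0" "N > 0"
  shows "\<exists>K. (0::nat) < K \<and> C * (N / K) powr (1/q) \<le> c"
proof -
  define t where "t = (c / C) powr q"
  have t: "t > 0" using assms by (simp add: t_def)
  obtain K :: nat where K: "N / t < K" using reals_Archimedean2 by blast
  have "real K > 0" using K t assms by (smt (verit) divide_pos_pos)
  then have K0: "K > 0" by simp
  have "N / K \<le> t" using K t K0 by (simp add: field_simps)
  then have "(N / K) powr (1/q) \<le> t powr (1/q)" using assms by (intro powr_mono2) auto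
  also have "\<dots> = c / C" using assms by (simp add: t_def powr_powr)
  finally have "C * (N / K) powr (1/q) \<le> C * (c / C)" using assms by (intro mult_left_mono) auto
  then have "C * (N / K) powr (1/q) \<le> c" using assms by simp
  with K0 show ?thesis by blast
qed

text \<open>A Krivine-type statement with an absolute constant in place of almost isometry. The
  parameters are chosen in the order \<open>N\<close> (rounding), \<open>K\<close> (edge loss
  against \<open>C\<close>), \<eta> and the nets, and last the multiplicity \<open>m\<close>, which
  has to be large for concentration.\<close>

lemma krivine_finite:
  fixes Z :: "'b::real_normed_vector set"
  assumes q: "q \<ge> 1" and basis: "\<And>L. \<exists>e :: nat \<Rightarrow> 'b. lq_basis e L q C"
    and n: "n > 0" and Z: "finite Z" and \<epsilon>: "\<epsilon> > 0"
  shows "\<exists>u :: nat \<Rightarrow> 'b. \<forall>a. lq_norm q {..<n} a \<le> norm (lincomb n a u) \<and>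
     norm (lincomb n a u) \<le> 8 * lq_norm q {..<n} a \<and>
     (\<forall>z\<in>Z. norm z - \<epsilon> \<le> norm (z + (lincomb n a u)))"
proof -
  have C: "C \<ge> 1" using basis[of 0] by (auto simp: lq_basis_def)
  have q0: "q > 0" using q by simp
  obtain N where N: "real n * (2/3)^N \<le> 1/3"
  proof -
    obtain N where "(2/3::real)^N < 1 / (3 * n)" using real_arch_pow_inv[of "1 / (3 * n)" "2/3"] n by auto
    then have "real n * (2/3)^N \<le> 1/3" using n by (simp add: field_simps)
    then show ?thesis using that by blast
  qed
  obtain K :: nat where K: "(0::nat) < K" "C * (real (N + 2) / K) powr (1/q) \<le> 1/16"
  proof -
    have "\<exists>K. (0::nat) < K \<and> C * (real (N + 2) / K) powr (1/q) \<le> 1/16"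
      using C by (intro exists_large_K[OF q]) linarith+
    then show ?thesis by (elim exE conjE) (rule that)
  qed
  \<comment> \<open>Beyond radius \<open>R\<close> the vector \<open>\<Psi> a\<close> is at least
    twice as long as each \<open>z\<close>, so transversality is automatic there and a net of a
    bounded set suffices.\<close>
  define R where "R = 1 + (\<Sum>z\<in>Z. 2 * norm z)"
  have R1: "R \<ge> 1" by (auto simp: R_def intro: sum_nonneg)
  have RZ: "2 * norm z \<le> R" if "z \<in> Z" for z
    using member_le_sum[of z Z "\<lambda>z. 2 * norm z"] that Z by (simp add: R_def)
  define \<eta> where "\<eta> = min (1/64) (\<epsilon>/4)"
  have \<eta>: "\<eta> > 0" "\<eta> \<le> 1/64" "\<eta> \<le> \<epsilon>/4" using \<epsilon> by (auto simp: \<eta>_def)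
  define \<tau> where "\<tau> = \<eta> / C"
  have \<tau>: "\<tau> > 0" using \<eta> C by (simp add: \<tau>_def)
  define S1 where "S1 = {a :: nat \<Rightarrow> real. lq_norm q {..<n} a = 1}"
  define S2 where "S2 = {a :: nat \<Rightarrow> real. lq_norm q {..<n} a \<le> R}"
  have S2b: "\<bar>a i\<bar> \<le> R" if "a \<in> S2" "i < n" for a i
    using abs_le_lq_norm[OF _ q0, of "{..<n}" i a] that by (auto simp: S2_def)
  have S12: "S1 \<subseteq> S2" using R1 by (auto simp: S1_def S2_def)
  have net: "\<exists>Q. finite Q \<and> Q \<subseteq> S \<and> (\<forall>a\<in>S. \<exists>b\<in>Q. (\<Sum>i<n. \<bar>a i - b i\<bar>) \<le> \<tau>)" if "S \<subseteq> S2" for S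
    by (rule finite_net[where R = R]) (use S2b that \<tau> n in auto)
  obtain Q1 where Q1: "finite Q1" "Q1 \<subseteq> S1" "\<forall>a\<in>S1. \<exists>b\<in>Q1. (\<Sum>i<n. \<bar>a i - b i\<bar>) \<le> \<tau>"
    using net[OF S12] by (elim exE conjE)
  obtain Q2 where Q2: "finite Q2" "Q2 \<subseteq> S2" "\<forall>a\<in>S2. \<exists>b\<in>Q2. (\<Sum>i<n. \<bar>a i - b i\<bar>) \<le> \<tau>"
    using net[OF order_refl] by (elim exE conjE)
  define Q where "Q = Q1 \<union> Q2"
  have Q: "finite Q" "Q \<subseteq> S2" using Q1 Q2 S12 by (auto simp: Q_def)
  \<comment> \<open>Makes \<open>2 * C * (R * v0) * (\<theta> * m) powr (1/q)\<close> equal to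
    \<eta>: moving \<open>\<theta> * m\<close> coordinates changes the norms by at most
    \<eta>.\<close>
  define \<theta> where "\<theta> = 2 * real K * 2^K * (\<eta> / (2 * C * R)) powr q"
  have \<theta>: "\<theta> > 0" using K \<eta> C R1 by (simp add: \<theta>_def)
  define \<kappa> where "\<kappa> = n * (\<Sum>k<K. 3 ^ k * 2 ^ (K - k))"
  \<comment> \<open>With \<open>s = \<theta> * m\<close> and \<open>m * \<kappa>\<close>
    coordinates, both conditions of \<open>realize\<close> compare a multiple of
    \<open>m\<^sup>2\<close> with a multiple of \<open>m\<close>; \<open>H\<close> is the threshold
    that \<open>m * \<theta>\<^sup>2\<close> must exceed.\<close>
  define H where "H = max (16 * (2 * C * R + \<eta>) / \<eta> * (2 * \<kappa>)) (64 * \<kappa> * (card (insert 0 Z) * card Q) + 1)"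
  obtain m :: nat where "H / \<theta>\<^sup>2 < m" using reals_Archimedean2 by blast
  then have mH: "H < m * \<theta>\<^sup>2" using \<theta> by (simp add: field_simps)
  have "H > 0" unfolding H_def by (rule less_le_trans[OF _ max.cobounded2]) (simp only: of_nat_0_less_iff add_gr_0, simp)
  with mH have m: "m > 0" using \<theta> by (cases "m = 0") auto
  have H1: "16 * (2 * C * R + \<eta>) / \<eta> * (2 * \<kappa>) \<le> m * \<theta>\<^sup>2" using mH by (simp add: H_def)
  have H2: "64 * \<kappa> * (card (insert 0 Z) * card Q) < m * \<theta>\<^sup>2" using mH by (simp add: H_def)
  define L where "L = card (coords n K m \<times> (UNIV::bool set))"
  obtain e :: "nat \<Rightarrow> 'b" where e: "lq_basis e L q C"
    using basis by blast
  interpret multiscale e L q C n K m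
    using e n K m by (simp add: L_def multiscale_def random_lq_def random_lq_axioms_def multiscale_axioms_def)
  have cJ: "card (coords n K m) = m * \<kappa>" by (simp add: card_coords \<kappa>_def)
  define v0 where "v0 = (1 / (2 * real K * real m * 2^K)) powr (1/q)"
  have xv: "\<bar>x a s\<bar> \<le> R * v0" if "a \<in> S2" "s \<in> coords n K m" for a s
  proof -
    obtain i k c where s: "s = (i, k, c)" by (cases s)
    have i: "i < n" using that by (simp add: s coords_def)
    have "level_val q K m k \<le> v0" unfolding level_val_def v0_def
      using q by (intro powr_mono2 divide_right_mono) (auto simp: power_le_one)
    then show ?thesis using S2b[OF that(1) i] R1
      by (simp add: s level_vec_def abs_mult mult_mono)
  qed
  have "\<exists>w\<in>\<Omega>. \<forall>z\<in>insert 0 Z. \<forall>y\<in>x ` Q. \<bar>norm (z + \<Phi> w (word y)) - mean z (word y)\<bar> \<le> 2 * \<eta>"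
  proof (rule realize[where s = "\<theta> * m" and R = R and v = "R * v0"])
    show "finite (insert 0 Z)" "finite (x ` Q)" using Z Q by auto
    show "\<eta> > 0" "R \<ge> 0" "\<theta> * m > 0" "R * v0 \<ge> 0" using \<eta> R1 \<theta> m by (auto simp: v0_def)
    show "\<bar>y s\<bar> \<le> R * v0" if y: "y \<in> x ` Q" "s \<in> coords n K m" for y s
    proof -
      obtain a where "a \<in> S2" "y = x a" using y(1) Q(2) by blast
      then show ?thesis using xv[OF _ y(2)] by simp
    qed
    show "lq_norm q I (word y) \<le> R" if y: "y \<in> x ` Q" for y
    proof -
      obtain a where "a \<in> S2" "y = x a" using y Q(2) by blast
      then show ?thesis by (simp add: lq_norm_word_vec S2_def)
    qed
    have "v0 * (\<theta> * m) powr (1/q) = ((\<eta> / (2 * C * R)) powr q) powr (1/q)"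
      unfolding v0_def powr_mult[symmetric] using K m by (intro arg_cong[where f = "\<lambda>t. t powr (1/q)"]) (simp add: \<theta>_def)
    also have "\<dots> = \<eta> / (2 * C * R)" using q \<eta> C R1 by (simp add: powr_powr)
    finally have v: "v0 * (\<theta> * m) powr (1/q) = \<eta> / (2 * C * R)" .
    have "2 * C * (R * v0) * (\<theta> * m) powr (1/q) = 2 * C * R * (v0 * (\<theta> * m) powr (1/q))" by simp
    also have "\<dots> = \<eta>" unfolding v using C R1 by simp
    finally show "2 * C * (R * v0) * (\<theta> * m) powr (1/q) \<le> \<eta>" by simp
    have sq: "(\<theta> * m)\<^sup>2 = m * (m * \<theta>\<^sup>2)" by (simp add: power2_eq_square)
    show "16 * (2 * C * R + \<eta>) / \<eta> * (2 * card (coords n K m)) \<le> (\<theta> * m)\<^sup>2"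
      unfolding sq using mult_left_mono[OF H1, of m] by (simp add: cJ mult_ac)
    have "card (x ` Q) \<le> card Q" by (rule card_image_le) (rule Q)
    then have "64 * m * \<kappa> * (card (insert 0 Z) * card (x ` Q)) \<le> 64 * m * \<kappa> * (card (insert 0 Z) * card Q)"
      by (intro mult_left_mono) auto
    then have "real (64 * m * \<kappa> * (card (insert 0 Z) * card (x ` Q))) \<le> real (m * (64 * \<kappa> * (card (insert 0 Z) * card Q)))"
      by (simp only: of_nat_le_iff mult_ac)
    also have "\<dots> < m * (m * \<theta>\<^sup>2)" using mult_strict_left_mono[OF H2, of "real m"] m by simp
    finally show "real (32 * (2 * card (coords n K m)) * (card (insert 0 Z) * card (x ` Q))) < (\<theta> * m)\<^sup>2"
      unfolding sq cJ by (simp add: mult_ac)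
  qed
  then obtain w where w: "w \<in> \<Omega>" 
    and conc: "\<And>z a. z \<in> insert 0 Z \<Longrightarrow> a \<in> Q \<Longrightarrow> \<bar>norm (z + \<Phi> w (word (x a))) - mean z (word (x a))\<bar> \<le> 2 * \<eta>"
    by blast
  define U where "U i = \<Phi> w (word (x (\<lambda>j. if j = i then 1 else 0)))" for i
  define \<Psi> where "\<Psi> a = (lincomb n a U)" for a
  have \<Psi>: "\<Phi> w (word (x a)) = \<Psi> a" for a unfolding \<Psi>_def U_def by (rule \<Phi>_vec)
  have \<Psi>_scale: "\<Psi> (\<lambda>i. t * a i) = t *\<^sub>R \<Psi> a" for t a by (simp add: \<Psi>_def scaleR_sum_right)
  have U: "norm (U i) \<le> C" if "i < n" for i
  proof -
    have "(\<Sum>j<n. \<bar>if j = i then 1 else 0\<bar> powr q) = (\<Sum>j<n. if j = i then 1 else 0)"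
      using q by (intro sum.cong) auto
    then have "lq_norm q {..<n} (\<lambda>j. if j = i then 1 else 0) = 1" using that by (simp add: lq_norm_def)
    then show ?thesis
      using \<Phi>_bounds(2)[OF w, of "word (x (\<lambda>j. if j = i then 1 else 0))"] by (simp add: U_def lq_norm_word_vec)
  qed
  have \<Psi>_diff: "norm (\<Psi> a - \<Psi> b) \<le> \<eta>" if "(\<Sum>i<n. \<bar>a i - b i\<bar>) \<le> \<tau>" for a b
  proof -
    have "norm (\<Psi> a - \<Psi> b) = norm (\<Sum>i<n. (a i - b i) *\<^sub>R U i)"
      by (simp add: \<Psi>_def sum_subtractf scaleR_diff_left)
    also have "\<dots> \<le> (\<Sum>i<n. \<bar>a i - b i\<bar> * C)"
      by (rule sum_norm_le) (auto intro!: mult_left_mono U)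
    also have "\<dots> \<le> \<tau> * C" unfolding sum_distrib_right[symmetric] using that C by (intro mult_right_mono) auto
    finally show ?thesis using C by (simp add: \<tau>_def)
  qed
  define B where "B = \<nu> (x first_unit)"
  have "lq_norm q I (word (x first_unit)) \<le> \<nu> (x first_unit)" unfolding lq_norm_word by (rule \<nu>_bounds(1))
  then have B: "B \<ge> 1" by (simp add: lq_norm_word_vec lq_norm_first_unit B_def)
  \<comment> \<open>The errors are 1/16 from the edge and \<open>3 * \<eta> \<le> 3/64\<close> from
    net and concentration. As \<open>B \<ge> 1\<close>, the norm lies between
    \<open>(4/9 * 15/16 - 3/64) * B\<close> and \<open>(9/4 + 1/16 + 3/64) * B\<close>, hence
    between \<open>7/20 * B\<close> and \<open>14/5 * B\<close>.\<close>
  have sphere: "7/20 * B \<le> norm (\<Psi> a)" "norm (\<Psi> a) \<le> 7/20 * B * 8" if a: "lq_norm q {..<n} a = 1" for a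
  proof -
    obtain b where b: "b \<in> Q1" "(\<Sum>i<n. \<bar>a i - b i\<bar>) \<le> \<tau>" using Q1(3) a by (auto simp: S1_def)
    have b1: "lq_norm q {..<n} b = 1" using b Q1 by (auto simp: S1_def)
    have "\<bar>norm (\<Psi> b) - \<nu> (x b)\<bar> \<le> 2 * \<eta>" using conc[of 0 b] b by (simp add: \<Psi> \<nu>_def Q_def)
    moreover have "\<bar>norm (\<Psi> a) - norm (\<Psi> b)\<bar> \<le> \<eta>"
      using \<Psi>_diff[OF b(2)] norm_triangle_ineq3[of "\<Psi> a" "\<Psi> b"] by simp
    moreover have "\<nu> (x b) \<le> 9/4 * B + 1/16" using \<nu>_upper[OF b1 N] K(2) by (simp add: B_def)
    moreover have "B \<le> 9/4 * \<nu> (x b) + 1/16" using \<nu>_lower[OF b1 N] K(2) by (simp add: B_def)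
    ultimately show "7/20 * B \<le> norm (\<Psi> a)" "norm (\<Psi> a) \<le> 7/20 * B * 8"
      using \<eta>(2) B by linarith+
  qed
  have homog: "7/20 * B * lq_norm q {..<n} a \<le> norm (\<Psi> a) \<and> norm (\<Psi> a) \<le> 7/20 * B * 8 * lq_norm q {..<n} a" for a
  proof (cases "lq_norm q {..<n} a = 0")
    case True
    then have "\<Psi> a = 0" using lq_norm_eq_0_iff[of "{..<n}" q a] q by (simp add: \<Psi>_def)
    then show ?thesis using True by simp
  next
    case False
    define t where "t = lq_norm q {..<n} a"
    have t: "t > 0" using False lq_norm_nonneg[of q "{..<n}" a] unfolding t_def by linarith
    have "lq_norm q {..<n} (\<lambda>i. 1/t * a i) = 1" using t lq_norm_cmult[OF q0, of "{..<n}" "1/t" a] by (simp add: t_def)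
    from sphere[OF this] have "7/20 * B \<le> 1/t * norm (\<Psi> a)" "1/t * norm (\<Psi> a) \<le> 7/20 * B * 8"
      unfolding \<Psi>_scale using t by auto
    then show ?thesis unfolding t_def[symmetric] using t by (simp add: field_simps)
  qed
  \<comment> \<open>On the net, concentration and \<open>norm_le_mean\<close> lose
    \<open>2 * \<eta>\<close>; leaving the net loses another \<eta>. Together this is at most
    \<epsilon>.\<close>
  have GZ: "norm z - \<epsilon> \<le> norm (z + \<Psi> a)" if z: "z \<in> Z" for z a
  proof (cases "lq_norm q {..<n} a \<le> R")
    case True
    then obtain b where b: "b \<in> Q2" "(\<Sum>i<n. \<bar>a i - b i\<bar>) \<le> \<tau>" using Q2(3) by (auto simp: S2_def)
    have "\<bar>norm (z + \<Psi> b) - mean z (word (x b))\<bar> \<le> 2 * \<eta>" using conc[of z b] b z by (simp add: \<Psi> Q_def)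
    moreover have "norm z \<le> mean z (word (x b))" by (rule norm_le_mean)
    moreover have "\<bar>norm (z + \<Psi> a) - norm (z + \<Psi> b)\<bar> \<le> \<eta>"
      using \<Psi>_diff[OF b(2)] norm_triangle_ineq3[of "z + \<Psi> a" "z + \<Psi> b"] by simp
    ultimately show ?thesis using \<eta>(3) \<epsilon> by linarith
  next
    case False
    have "lq_norm q {..<n} a \<le> norm (\<Psi> a)" using \<Phi>_bounds(1)[OF w, of "word (x a)"] by (simp add: \<Psi> lq_norm_word_vec)
    then have "2 * norm z \<le> norm (\<Psi> a)" using False RZ[OF z] by linarith
    moreover have "norm (\<Psi> a) \<le> norm (z + \<Psi> a) + norm z"
      using norm_triangle_ineq4[of "z + \<Psi> a" z] by simp
    ultimately show ?thesis using \<epsilon> by linarith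
  qed
  define u where "u i = (20 / (7 * B)) *\<^sub>R U i" for i
  have u: "(lincomb n a u) = (20 / (7 * B)) *\<^sub>R \<Psi> a" for a
    by (simp add: u_def \<Psi>_def scaleR_sum_right mult.commute)
  show ?thesis
  proof (intro exI[of _ u] allI conjI ballI)
    fix a
    define c where "c = 20 / (7 * B)"
    have c: "c > 0" "c * (7/20 * B * t) = t" for t using B by (auto simp: c_def)
    have nu: "norm (lincomb n a u) = c * norm (\<Psi> a)" unfolding u[of a] c_def using B by simp
    have "c * (7/20 * B * lq_norm q {..<n} a) \<le> c * norm (\<Psi> a)"
      using homog[of a] c(1) by (intro mult_left_mono) auto
    then show "lq_norm q {..<n} a \<le> norm (lincomb n a u)" unfolding nu c(2) .
    have "c * norm (\<Psi> a) \<le> c * (7/20 * B * (8 * lq_norm q {..<n} a))"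
      using homog[of a] c(1) by (intro mult_left_mono) auto
    then show "norm (lincomb n a u) \<le> 8 * lq_norm q {..<n} a" unfolding nu c(2) .
    fix z assume z: "z \<in> Z"
    show "norm z - \<epsilon> \<le> norm (z + (lincomb n a u))"
      using GZ[OF z, of "\<lambda>i. 20 / (7 * B) * a i"] unfolding u[of a] \<Psi>_scale[of "20 / (7 * B)" a] .
  qed
qed


section \<open>Uniform copies, infinite exponent\<close>

definition max_norm :: "nat \<Rightarrow> (nat \<Rightarrow> real) \<Rightarrow> real" where
  "max_norm n a = (MAX i\<in>{..<n}. \<bar>a i\<bar>)"

lemma abs_le_max_norm: "i < n \<Longrightarrow> \<bar>a i\<bar> \<le> max_norm n a"
  by (auto simp: max_norm_def intro: Max_ge)

lemma max_norm_le: "n > 0 \<Longrightarrow> (\<And>i. i < n \<Longrightarrow> \<bar>a i\<bar> \<le> c) \<Longrightarrow> max_norm n a \<le> c"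
  by (subst max_norm_def, subst Max_le_iff) auto

lemma max_norm_nonneg: "n > 0 \<Longrightarrow> max_norm n a \<ge> 0"
  using abs_le_max_norm[of 0 n a] by linarith

lemma max_norm_attained: "n > 0 \<Longrightarrow> \<exists>i<n. max_norm n a = \<bar>a i\<bar>"
proof -
  assume "n > 0"
  then have "max_norm n a \<in> (\<lambda>i. \<bar>a i\<bar>) ` {..<n}" unfolding max_norm_def by (intro Max_in) auto
  then show ?thesis by auto
qed

lemma max_norm_cmult:
  assumes "n > 0"
  shows "max_norm n (\<lambda>i. c * a i) = \<bar>c\<bar> * max_norm n a"
proof (rule antisym)
  show "max_norm n (\<lambda>i. c * a i) \<le> \<bar>c\<bar> * max_norm n a"
    using assms by (intro max_norm_le) (auto simp: abs_mult intro!: mult_left_mono abs_le_max_norm)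
  obtain i where "i < n" "max_norm n a = \<bar>a i\<bar>" using max_norm_attained[OF assms] by blast
  then show "\<bar>c\<bar> * max_norm n a \<le> max_norm n (\<lambda>i. c * a i)"
    using abs_le_max_norm[of i n "\<lambda>i. c * a i"] by (simp add: abs_mult)
qed

definition sup_copy :: "real \<Rightarrow> nat \<Rightarrow> (nat \<Rightarrow> 'b::real_normed_vector) \<Rightarrow> bool" where
  "sup_copy D n u \<longleftrightarrow> (\<forall>a. max_norm n a \<le> norm (lincomb n a u) \<and> norm (lincomb n a u) \<le> D * max_norm n a)"

abbreviation block :: "nat \<Rightarrow> (nat \<Rightarrow> 'b) \<Rightarrow> nat \<Rightarrow> (nat \<Rightarrow> real) \<Rightarrow> 'b::real_vector" where
  "block n u r a \<equiv> \<Sum>j<n. a j *\<^sub>R u (r * n + j)"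

lemma sum_blocks:
  fixes u :: "nat \<Rightarrow> 'b::real_normed_vector"
  assumes "n > 0"
  shows "(\<Sum>i<M * n. (c (i div n) * A (i div n) (i mod n)) *\<^sub>R u i) =
    (\<Sum>r<M. c r *\<^sub>R (block n u r (A r)))"
proof -
  let ?f = "\<lambda>i. (c (i div n) * A (i div n) (i mod n)) *\<^sub>R u i"
  have "(\<Sum>i<M * n. ?f i) = (\<Sum>r<M. sum ?f {r * n..<r * n + n})"
    by (rule sum.nat_group[symmetric])
  also have "\<dots> = (\<Sum>r<M. c r *\<^sub>R (block n u r (A r)))"
  proof (rule sum.cong[OF refl])
    fix r
    have "sum ?f {r * n..<r * n + n} = (\<Sum>j<n. ?f (j + r * n))"
      using sum.shift_bounds_nat_ivl[of ?f 0 "r * n" n] by (simp add: lessThan_atLeast0 add.commute)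
    also have "\<dots> = (\<Sum>j<n. (c r * A r j) *\<^sub>R u (r * n + j))"
      using assms by (intro sum.cong) (auto simp: add.commute)
    finally show "sum ?f {r * n..<r * n + n} = c r *\<^sub>R (block n u r (A r))"
      by (simp add: scaleR_sum_right)
  qed
  finally show ?thesis .
qed

lemma block_less: "r < M \<Longrightarrow> j < n \<Longrightarrow> r * n + j < M * (n::nat)"
proof -
  assume "r < M" "j < n"
  then have "r * n + j < Suc r * n" by simp
  also have "\<dots> \<le> M * n" using \<open>r < M\<close> by (intro mult_right_mono) auto
  finally show ?thesis .
qed

text \<open>Vectors from different blocks have disjoint supports, so in the max norm their sum is no
  larger than the largest of them. The third claim is this flatness, used both for James' step and
  for transversality.\<close>

lemma sup_copy_blocks:
  fixes u :: "nat \<Rightarrow> 'b::real_normed_vector"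
  assumes u: "sup_copy D (M * n) u" and n: "n > 0" and "M > 0" and D: "D \<ge> 0"
  shows "r < M \<Longrightarrow> max_norm n a \<le> norm (block n u r a)"
    and "r < M \<Longrightarrow> norm (block n u r a) \<le> D * max_norm n a"
    and "(\<And>r. r < M \<Longrightarrow> max_norm n (A r) \<le> C) \<Longrightarrow> (\<And>r. r < M \<Longrightarrow> \<bar>c r\<bar> \<le> m) \<Longrightarrow> 
      norm (\<Sum>r<M. c r *\<^sub>R (block n u r (A r))) \<le> D * (m * C)"
proof -
  have Mn: "M * n > 0" using assms by simp
  show gen: "norm (\<Sum>r<M. c r *\<^sub>R (block n u r (A r))) \<le> D * (m * C)"
    if "\<And>r. r < M \<Longrightarrow> max_norm n (A r) \<le> C" "\<And>r. r < M \<Longrightarrow> \<bar>c r\<bar> \<le> m" for A C c m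
  proof -
    have "norm (\<Sum>r<M. c r *\<^sub>R (block n u r (A r))) \<le> 
       D * max_norm (M * n) (\<lambda>i. c (i div n) * A (i div n) (i mod n))"
      unfolding sum_blocks[OF n, symmetric] using u by (simp add: sup_copy_def)
    also have "\<dots> \<le> D * (m * C)"
    proof (intro mult_left_mono max_norm_le Mn D)
      fix i assume i: "i < M * n"
      then have r: "i div n < M" by (simp add: less_mult_imp_div_less)
      have "\<bar>A (i div n) (i mod n)\<bar> \<le> C"
        using abs_le_max_norm[of "i mod n" n "A (i div n)"] that(1)[OF r] n by simp
      then show "\<bar>c (i div n) * A (i div n) (i mod n)\<bar> \<le> m * C"
        unfolding abs_mult using that(2)[OF r] by (intro mult_mono) auto
    qed
    finally show ?thesis .
  qed
  assume r: "r < M"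
  define c where "c s = (if s = r then 1 else 0 :: real)" for s
  have eq: "(\<Sum>s<M. c s *\<^sub>R (block n u s a)) = (block n u r a)"
  proof -
    have "(\<Sum>s<M. c s *\<^sub>R (block n u s a)) = 
       (\<Sum>s<M. if s = r then \<Sum>j<n. a j *\<^sub>R u (s * n + j) else 0)"
      by (intro sum.cong) (auto simp: c_def)
    then show ?thesis using r by (simp add: sum.delta)
  qed
  show "norm (block n u r a) \<le> D * max_norm n a"
    using gen[of "\<lambda>_. a" "max_norm n a" c 1] unfolding eq by (simp add: c_def)
  have "max_norm n a \<le> max_norm (M * n) (\<lambda>i. c (i div n) * a (i mod n))"
  proof (rule max_norm_le[OF n])
    fix j assume j: "j < n"
    then have "\<bar>c ((r * n + j) div n) * a ((r * n + j) mod n)\<bar> = \<bar>a j\<bar>" by (simp add: c_def)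
    then show "\<bar>a j\<bar> \<le> max_norm (M * n) (\<lambda>i. c (i div n) * a (i mod n))"
      using abs_le_max_norm[OF block_less[OF r j], of "\<lambda>i. c (i div n) * a (i mod n)"] by simp
  qed
  also have "\<dots> \<le> norm (\<Sum>i<M * n. (c (i div n) * a (i mod n)) *\<^sub>R u i)"
    using u by (simp add: sup_copy_def)
  also have "\<dots> = norm (block n u r a)"
    using sum_blocks[OF n, of c "\<lambda>_. a" u M] unfolding eq by simp
  finally show "max_norm n a \<le> norm (block n u r a)" .
qed

text \<open>Cut \<open>n * n\<close> vectors into \<open>n\<close> blocks. A block with upper
  constant \<open>3/4 * D\<close> is an improved copy. Otherwise each block contains a vector of max
  norm at most 1 and norm above \<open>3/4 * D\<close>, and these \<open>n\<close> vectors have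
  constants \<open>D / 2\<close> and \<open>D\<close>, a distortion of 2.\<close>

lemma james_step:
  fixes u :: "nat \<Rightarrow> 'b::real_normed_vector"
  assumes u: "sup_copy D (n * n) u" and n: "n > 0" and D: "D > 0"
  shows "\<exists>v :: nat \<Rightarrow> 'b. sup_copy (max (3/4 * D) 2) n v"
proof (cases "\<exists>r<n. \<forall>a. norm (block n u r a) \<le> 3/4 * D * max_norm n a")
  case True
  then obtain r where r: "r < n" "\<And>a. norm (block n u r a) \<le> 3/4 * D * max_norm n a" by blast
  have "sup_copy (max (3/4 * D) 2) n (\<lambda>j. u (r * n + j))"
    unfolding sup_copy_def
  proof (intro allI conjI)
    fix a
    show "max_norm n a \<le> norm (\<Sum>i<n. a i *\<^sub>R u (r * n + i))"
      by (rule sup_copy_blocks(1)[OF u n n _ r(1)]) (use D in simp)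
    have "3/4 * D * max_norm n a \<le> max (3/4 * D) 2 * max_norm n a" by (intro mult_right_mono max_norm_nonneg n) auto
    with r(2)[of a] show "norm (\<Sum>i<n. a i *\<^sub>R u (r * n + i)) \<le> max (3/4 * D) 2 * max_norm n a" by linarith
  qed
  then show ?thesis by blast
next
  case False
  then have "\<forall>r. \<exists>a. r < n \<longrightarrow> norm (block n u r a) > 3/4 * D * max_norm n a"
    by (meson not_le)
  then obtain A where A: "\<And>r. r < n \<Longrightarrow> norm (block n u r (A r)) > 3/4 * D * max_norm n (A r)" by metis
  define A' where "A' r j = 1 / max_norm n (A r) * A r j" for r j
  define W where "W r = (block n u r (A' r))" for r
  have A0: "max_norm n (A r) > 0" if "r < n" for r
  proof (rule ccontr)
    assume "\<not> max_norm n (A r) > 0"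
    then have "max_norm n (A r) = 0" using max_norm_nonneg[OF n, of "A r"] by linarith
    then show False
      using sup_copy_blocks(2)[OF u n n _ that, of "A r"] A[OF that] D by simp
  qed
  have A1: "max_norm n (A' r) \<le> 1" if "r < n" for r
    using A0[OF that] unfolding A'_def max_norm_cmult[OF n] by simp
  have W: "norm (W r) > 3/4 * D" if "r < n" for r
  proof -
    have "W r = (1 / max_norm n (A r)) *\<^sub>R (block n u r (A r))"
      by (simp add: W_def A'_def scaleR_sum_right)
    then have "norm (W r) = norm (block n u r (A r)) / max_norm n (A r)"
      using A0[OF that] by simp
    then show ?thesis using A[OF that] A0[OF that] by (simp add: pos_less_divide_eq)
  qed
  have up: "norm (lincomb n c W) \<le> D * m" if "\<And>r. r < n \<Longrightarrow> \<bar>c r\<bar> \<le> m" for c m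
    using sup_copy_blocks(3)[OF u n n _ A1 that] D unfolding W_def by simp
  have low: "D / 2 * max_norm n c \<le> norm (lincomb n c W)" for c
  proof -
    obtain s where s: "s < n" "max_norm n c = \<bar>c s\<bar>" using max_norm_attained[OF n] by blast
    \<comment> \<open>All signs are reversed except that of the largest coefficient: the sum of the
      two combinations is a single term of norm at least \<open>3/2 * D * \<bar>c s\<bar>\<close>,
      and the bound \<open>D * \<bar>c s\<bar>\<close> for \<open>d\<close> leaves
      \<open>D / 2 * \<bar>c s\<bar>\<close> for \<open>c\<close>.\<close>
    define d where "d r = (if r = s then c r else - c r)" for r
    have "(lincomb n c W) + (lincomb n d W) = (\<Sum>r<n. if r = s then (2 * c s) *\<^sub>R W s else 0)"
      unfolding sum.distrib[symmetric] by (intro sum.cong) (auto simp: d_def simp flip: scaleR_add_left)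
    also have "\<dots> = (2 * c s) *\<^sub>R W s" using s by (simp add: sum.delta)
    finally have "2 * \<bar>c s\<bar> * norm (W s) = norm ((lincomb n c W) + (lincomb n d W))"
      by (simp add: abs_mult)
    also have "\<dots> \<le> norm (lincomb n c W) + norm (lincomb n d W)" by (rule norm_triangle_ineq)
    also have "norm (lincomb n d W) \<le> D * max_norm n c"
      by (rule up) (use abs_le_max_norm[of _ n c] in \<open>auto simp: d_def\<close>)
    finally have "2 * \<bar>c s\<bar> * norm (W s) \<le> norm (lincomb n c W) + D * max_norm n c" by simp
    moreover have "2 * \<bar>c s\<bar> * (3/4 * D) \<le> 2 * \<bar>c s\<bar> * norm (W s)"
      using W[OF s(1)] by (intro mult_left_mono) auto
    ultimately show ?thesis by (simp add: s(2) algebra_simps)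
  qed
  have "sup_copy (max (3/4 * D) 2) n (\<lambda>r. (2 / D) *\<^sub>R W r)"
    unfolding sup_copy_def
  proof (intro allI conjI)
    fix c
    have eq: "norm (\<Sum>i<n. c i *\<^sub>R (2 / D) *\<^sub>R W i) = 2 / D * norm (lincomb n c W)"
    proof -
      have "(\<Sum>i<n. c i *\<^sub>R (2 / D) *\<^sub>R W i) = (2 / D) *\<^sub>R (lincomb n c W)"
        by (simp add: scaleR_sum_right mult.commute)
      then show ?thesis using D by simp
    qed
    show "max_norm n c \<le> norm (\<Sum>i<n. c i *\<^sub>R (2 / D) *\<^sub>R W i)"
      unfolding eq using low[of c] D by (simp add: field_simps)
    have "norm (lincomb n c W) \<le> D * max_norm n c" by (rule up) (rule abs_le_max_norm)
    then have "2 / D * norm (lincomb n c W) \<le> 2 * max_norm n c" using D by (simp add: field_simps)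
    also have "\<dots> \<le> max (3/4 * D) 2 * max_norm n c" by (intro mult_right_mono max_norm_nonneg n) auto
    finally show "norm (\<Sum>i<n. c i *\<^sub>R (2 / D) *\<^sub>R W i) \<le> max (3/4 * D) 2 * max_norm n c" unfolding eq .
  qed
  then show ?thesis by blast
qed

text \<open>Each step multiplies the constant by 3/4 until 2 is reached. It needs a copy of squared
  length, and copies of every length are at hand.\<close>

lemma james_sup:
  assumes "\<And>n. n > 0 \<Longrightarrow> \<exists>u :: nat \<Rightarrow> 'b::real_normed_vector. sup_copy D n u" and D: "D > 0" and n: "n > 0"
  shows "\<exists>u :: nat \<Rightarrow> 'b. sup_copy 2 n u"
proof -
  have *: "\<forall>n>0. \<exists>u :: nat \<Rightarrow> 'b. sup_copy (max ((3/4)^k * D) 2) n u" for k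
  proof (induction k)
    case 0
    show ?case
    proof safe
      fix n :: nat assume n: "n > 0"
      then obtain u :: "nat \<Rightarrow> 'b" where u: "sup_copy D n u" using assms(1) by blast
      have "sup_copy (max D 2) n u" unfolding sup_copy_def
      proof (intro allI conjI)
        fix a
        have "D * max_norm n a \<le> max D 2 * max_norm n a" by (intro mult_right_mono max_norm_nonneg n) auto
        with u show "norm (lincomb n a u) \<le> max D 2 * max_norm n a"
          unfolding sup_copy_def by (meson order_trans)
      qed (use u in \<open>auto simp: sup_copy_def\<close>)
      then show "\<exists>u :: nat \<Rightarrow> 'b. sup_copy (max ((3/4)^0 * D) 2) n u" by auto
    qed
  next
    case (Suc k)
    show ?case
    proof safe
      fix n :: nat assume n: "n > 0"
      then obtain u :: "nat \<Rightarrow> 'b" where u: "sup_copy (max ((3/4)^k * D) 2) (n * n) u"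
        using Suc.IH[rule_format, of "n * n"] by auto
      have "max (3/4 * max ((3/4)^k * D) 2) 2 = max ((3/4)^Suc k * D) 2"
        by (auto simp: max_def)
      then show "\<exists>u :: nat \<Rightarrow> 'b. sup_copy (max ((3/4)^Suc k * D) 2) n u"
        using james_step[OF u n] by (metis less_max_iff_disj zero_less_numeral)
    qed
  qed
  obtain k where "(3/4::real)^k < 2 / D" using real_arch_pow_inv[of "2 / D" "3/4"] D by auto
  then have "max ((3/4)^k * D) 2 = 2" using D by (simp add: field_simps)
  with *[of k] n show ?thesis by metis
qed

text \<open>If every block fails, add up the failures belonging to one \<open>z\<close>: each
  \<open>z + W\<close> loses \<epsilon>, while the sum of the block vectors \<open>W\<close> stays
  bounded by flatness. Hence each \<open>z\<close> fails on boundedly many blocks, and a large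
  \<open>M\<close> leaves a good one.\<close>

lemma sup_copy_transversal:
  fixes Z :: "'b::real_normed_vector set"
  assumes "\<And>n. n > 0 \<Longrightarrow> \<exists>u :: nat \<Rightarrow> 'b. sup_copy 2 n u" and n: "n > 0" and Z: "finite Z" and \<epsilon>: "\<epsilon> > 0"
  shows "\<exists>u :: nat \<Rightarrow> 'b. sup_copy 2 n u \<and> (\<forall>a. \<forall>z\<in>Z. norm z - \<epsilon> \<le> norm (z + (lincomb n a u)))"
proof -
  define \<zeta> where "\<zeta> = 1 + (\<Sum>z\<in>Z. norm z)"
  have \<zeta>: "norm z \<le> \<zeta>" if "z \<in> Z" for z
    using member_le_sum[of z Z norm] that Z by (simp add: \<zeta>_def)
  have \<zeta>1: "\<zeta> \<ge> 1" by (auto simp: \<zeta>_def intro: sum_nonneg)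
  obtain M0 :: nat where M0: "card Z * (4 * \<zeta> / \<epsilon>) < M0" using reals_Archimedean2 by blast
  define M where "M = Suc M0"
  have M: "card Z * (4 * \<zeta> / \<epsilon>) < M" "M > 0" using M0 by (auto simp: M_def)
  obtain u :: "nat \<Rightarrow> 'b" where u: "sup_copy 2 (M * n) u" using assms(1)[of "M * n"] n M by auto
  note blocks = sup_copy_blocks[OF u n M(2)]
  define W where "W r a = (block n u r a)" for r a
  have "\<exists>r<M. \<forall>a. \<forall>z\<in>Z. norm z - \<epsilon> \<le> norm (z + W r a)"
  proof (rule ccontr)
    assume "\<not> ?thesis"
    then have "\<forall>r. \<exists>a z. r < M \<longrightarrow> z \<in> Z \<and> norm (z + W r a) < norm z - \<epsilon>" by (meson not_le)
    then obtain a z where az: "\<And>r. r < M \<Longrightarrow> z r \<in> Z \<and> norm (z r + W r (a r)) < norm (z r) - \<epsilon>" by metis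
    define F where "F y = {r. r < M \<and> z r = y}" for y
    have finF: "finite (F y)" for y by (simp add: F_def)
    have Fb: "card (F y) * \<epsilon> \<le> 4 * \<zeta>" if y: "y \<in> Z" for y
    proof -
      \<comment> \<open>A failing block vector has norm at most \<open>2 * norm y\<close>, so its
        coefficients are bounded, as flatness requires.\<close>
      have a: "max_norm n (a r) \<le> 2 * \<zeta>" if "r \<in> F y" for r
      proof -
        have r: "r < M" "z r = y" using that by (auto simp: F_def)
        have "max_norm n (a r) \<le> norm (W r (a r))" unfolding W_def by (rule blocks(1)) (use r in auto)
        also have "\<dots> \<le> norm (y + W r (a r)) + norm y" using norm_triangle_ineq4[of "y + W r (a r)" y] by simp
        also have "\<dots> \<le> 2 * \<zeta>" using az[OF r(1)] r \<zeta>[OF y] \<epsilon> by auto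
        finally show ?thesis .
      qed
      define A where "A r = (if r \<in> F y then a r else (\<lambda>_. 0))" for r
      have "norm (\<Sum>r<M. 1 *\<^sub>R W r (A r)) \<le> 2 * (1 * (2 * \<zeta>))"
        unfolding W_def
      proof (rule blocks(3))
        show "max_norm n (A r) \<le> 2 * \<zeta>" for r
          using a[of r] max_norm_le[of n "\<lambda>_. 0" "2 * \<zeta>"] \<zeta>1 n by (auto simp: A_def)
      qed auto
      moreover have "(\<Sum>r<M. 1 *\<^sub>R W r (A r)) = (\<Sum>r\<in>F y. W r (a r))"
        by (rule sum.mono_neutral_cong_right) (auto simp: F_def A_def W_def)
      ultimately have w: "norm (\<Sum>r\<in>F y. W r (a r)) \<le> 4 * \<zeta>" by simp
      have "card (F y) * norm y = norm ((\<Sum>r\<in>F y. y + W r (a r)) - (\<Sum>r\<in>F y. W r (a r)))"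
        by (simp add: sum.distrib flip: scaleR_conv_of_real) (metis norm_scaleR abs_of_nat sum_constant_scaleR)
      also have "\<dots> \<le> norm (\<Sum>r\<in>F y. y + W r (a r)) + norm (\<Sum>r\<in>F y. W r (a r))" by (rule norm_triangle_ineq4)
      also have "norm (\<Sum>r\<in>F y. y + W r (a r)) \<le> (\<Sum>r\<in>F y. norm y - \<epsilon>)"
        by (rule sum_norm_le) (use az in \<open>force simp: F_def\<close>)
      finally show ?thesis using w by (simp add: algebra_simps)
    qed
    have "{..<M} = (\<Union>y\<in>Z. F y)" using az by (auto simp: F_def)
    then have "M \<le> (\<Sum>y\<in>Z. card (F y))" using card_UN_le[OF Z, of F] by (metis card_lessThan)
    then have "M * \<epsilon> \<le> real (\<Sum>y\<in>Z. card (F y)) * \<epsilon>" using \<epsilon> by (intro mult_right_mono of_nat_mono) auto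
    also have "\<dots> = (\<Sum>y\<in>Z. card (F y) * \<epsilon>)" by (simp add: sum_distrib_right)
    also have "\<dots> \<le> (\<Sum>y\<in>Z. 4 * \<zeta>)" by (intro sum_mono Fb)
    finally have "M * \<epsilon> \<le> card Z * (4 * \<zeta>)" by simp
    with M(1) \<epsilon> show False by (simp add: field_simps)
  qed
  then obtain r where r: "r < M" "\<forall>a. \<forall>z\<in>Z. norm z - \<epsilon> \<le> norm (z + W r a)" by blast
  have "sup_copy 2 n (\<lambda>j. u (r * n + j))"
    unfolding sup_copy_def using blocks(1,2)[OF _ r(1)] by auto
  with r(2) show ?thesis unfolding W_def by blast
qed


section \<open>Independent copies\<close>

lemma lpn_norm_finite: "lpn_norm (ereal q) n = lq_norm q {..<n}"
  by (simp add: lpn_norm_def lq_norm_def fun_eq_iff)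

lemma lpn_norm_infinite: "lpn_norm \<infinity> n = max_norm n"
  by (simp add: lpn_norm_def max_norm_def fun_eq_iff)

lemma ereal_ge_1_cases:
  assumes "1 \<le> (p :: ereal)"
  obtains "p = \<infinity>" | q where "p = ereal q" "q \<ge> 1"
  using assms by (cases p) (auto simp: one_ereal_def)

lemma lpn_norm_nonneg: "1 \<le> p \<Longrightarrow> n \<ge> 1 \<Longrightarrow> lpn_norm p n a \<ge> 0"
  by (erule ereal_ge_1_cases) (auto simp: lpn_norm_finite lpn_norm_infinite max_norm_nonneg)

lemma abs_le_lpn_norm: "1 \<le> p \<Longrightarrow> i < n \<Longrightarrow> \<bar>a i\<bar> \<le> lpn_norm p n a"
  by (erule ereal_ge_1_cases) (auto simp: lpn_norm_finite lpn_norm_infinite abs_le_max_norm abs_le_lq_norm)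

lemma lpn_norm_cong: "(\<And>i. i < n \<Longrightarrow> a i = b i) \<Longrightarrow> lpn_norm p n a = lpn_norm p n b"
  by (simp add: lpn_norm_def)

text \<open>Boundedness of \<open>T\<close> makes the quotients bounded above, so that their
  supremum is a true bound; vectors with \<open>NE x = 0\<close>, whose quotient is 0 by convention,
  are covered by \<open>K\<close> instead.\<close>

lemma onorm_between_bound:
  assumes "bounded_linear_between E NE F NF T" "x \<in> E" "\<And>x. x \<in> E \<Longrightarrow> NE x \<ge> 0"
  shows "NF (T x) \<le> onorm_between E NE NF T * NE x"
proof -
  obtain K where K: "\<And>x. x \<in> E \<Longrightarrow> NF (T x) \<le> K * NE x"
    using assms(1) unfolding bounded_linear_between_def by blast
  show ?thesis
  proof (cases "NE x = 0")
    case True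
    then show ?thesis using K[OF assms(2)] by simp
  next
    case False
    have "bdd_above ((\<lambda>x. NF (T x) / NE x) ` E)"
    proof (rule bdd_aboveI2)
      fix y assume y: "y \<in> E"
      show "NF (T y) / NE y \<le> \<bar>K\<bar>"
      proof (cases "NE y = 0")
        case False
        then have "NE y > 0" using assms(3)[OF y] by simp
        then have "NF (T y) / NE y \<le> K" using K[OF y] by (simp add: pos_divide_le_eq)
        then show ?thesis by simp
      qed simp
    qed
    then have "NF (T x) / NE x \<le> onorm_between E NE NF T"
      unfolding onorm_between_def by (rule cSUP_upper[OF assms(2)])
    then show ?thesis using False assms(3)[OF assms(2)] by (simp add: pos_divide_le_eq)
  qed
qed

text \<open>Take the images of the unit vectors under the inverse of a near-optimal isomorphism
  \<open>T\<close>, scaled by the norm of \<open>T\<close> so that the lower constant becomes 1; the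
  product of the two norms is then an upper constant.\<close>

lemma contains_lpn_uniformlyD:
  assumes "contains_lpn_uniformly p TYPE('b::banach)" and p: "1 \<le> p"
  shows "\<exists>\<Lambda>\<ge>1. \<forall>n\<ge>1. \<exists>e :: nat \<Rightarrow> 'b. \<forall>a. lpn_norm p n a \<le> norm (lincomb n a e) \<and>
    norm (lincomb n a e) \<le> \<Lambda> * lpn_norm p n a"
proof -
  obtain C E where C: "C \<ge> 1" and E: "\<And>n. n \<ge> 1 \<Longrightarrow> subspace (E n)"
     "\<And>n. n \<ge> 1 \<Longrightarrow> linear_isomorphisms (E n) norm (lpn_space n) (lpn_norm p n) \<noteq> {}"
     "\<And>n. n \<ge> 1 \<Longrightarrow> banach_mazur_dist (E n :: 'b set) norm (lpn_space n) (lpn_norm p n) \<le> C"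
    using assms(1) unfolding contains_lpn_uniformly_def by metis
  have "\<exists>e :: nat \<Rightarrow> 'b. \<forall>a. lpn_norm p n a \<le> norm (lincomb n a e) \<and>
    norm (lincomb n a e) \<le> (C + 1) * lpn_norm p n a" if n: "n \<ge> 1" for n
  proof -
    let ?F = "lpn_space n" and ?N = "lpn_norm p n"
    obtain T where T: "T \<in> linear_isomorphisms (E n) norm ?F ?N"
      and lt: "onorm_between (E n) norm ?N T * onorm_between ?F ?N norm (inv_into (E n) T) < C + 1"
    proof -
      \<comment> \<open>The infimum defining the distance need not be attained, hence
        \<open>C + 1\<close>.\<close>
      have "\<exists>T\<in>linear_isomorphisms (E n) norm ?F ?N. 
        onorm_between (E n) norm ?N T * onorm_between ?F ?N norm (inv_into (E n) T) < C + 1"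
      proof (rule ccontr)
        assume "\<not> ?thesis"
        then have "C + 1 \<le> banach_mazur_dist (E n) norm ?F ?N"
          unfolding banach_mazur_dist_def using E(2)[OF n] by (intro cINF_greatest) (auto simp: not_less)
        with E(3)[OF n] show False by simp
      qed
      then show ?thesis using that by blast
    qed
    define S where "S = inv_into (E n) T"
    define A where "A = onorm_between (E n) norm ?N T"
    define B where "B = onorm_between ?F ?N norm S"
    have bij: "bij_betw T (E n) ?F" and bT: "bounded_linear_between (E n) norm ?F ?N T"
      and bS: "bounded_linear_between ?F ?N (E n) norm S"
      using T by (auto simp: linear_isomorphisms_def S_def)
    have S_in: "S a \<in> E n" and TS: "T (S a) = a" if "a \<in> ?F" for a
      using bij that unfolding S_def by (auto simp: bij_betw_def inv_into_into f_inv_into_f)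
    have A: "?N a \<le> A * norm (S a)" if "a \<in> ?F" for a
      using onorm_between_bound[OF bT S_in[OF that]] by (simp add: A_def TS[OF that])
    have B: "norm (S a) \<le> B * ?N a" if "a \<in> ?F" for a
      using onorm_between_bound[OF bS that] lpn_norm_nonneg[OF p n] by (simp add: B_def)
    have S_add: "S (a + b) = S a + S b" if "a \<in> ?F" "b \<in> ?F" for a b
      using bS that by (auto simp: bounded_linear_between_def)
    have S_scale: "S (c *\<^sub>R a) = c *\<^sub>R S a" if "a \<in> ?F" for a c
      using bS that by (auto simp: bounded_linear_between_def)
    define \<delta> where "\<delta> l = (\<lambda>i. if i = l then 1 else 0 :: real)" for l :: nat
    \<comment> \<open>Coefficient sequences are arbitrary from \<open>n\<close> on, so they are
      truncated to land in \<open>lpn_space n\<close>; smaller \<open>m\<close> serve the induction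
      in \<open>tr_eq\<close>.\<close>
    define tr where "tr m a = (\<lambda>i. if i < m then a i else 0 :: real)" for m :: nat and a
    have \<delta>F: "\<delta> l \<in> ?F" if "l < n" for l using that by (auto simp: \<delta>_def lpn_space_def)
    have trF: "tr m a \<in> ?F" if "m \<le> n" for m a using that by (auto simp: tr_def lpn_space_def)
    have tr_eq: "S (tr m a) = (\<Sum>l<m. a l *\<^sub>R S (\<delta> l))" if "m \<le> n" for m a
      using that
    proof (induction m)
      case 0
      have "S (0 *\<^sub>R tr 0 a) = 0 *\<^sub>R S (tr 0 a)" by (rule S_scale) (simp add: trF)
      moreover have "0 *\<^sub>R tr 0 a = tr 0 a" by (simp add: fun_eq_iff tr_def scaleR_fun_def)
      ultimately have "S (tr 0 a) = 0" by (metis scaleR_zero_left)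
      then show ?case by (simp only: lessThan_0 sum.empty)
    next
      case (Suc m)
      have "tr (Suc m) a = tr m a + a m *\<^sub>R \<delta> m"
        by (auto simp: fun_eq_iff tr_def \<delta>_def scaleR_fun_def less_Suc_eq)
      moreover have "a m *\<^sub>R \<delta> m \<in> ?F" using Suc.prems by (auto simp: \<delta>_def lpn_space_def scaleR_fun_def)
      ultimately have "S (tr (Suc m) a) = S (tr m a) + a m *\<^sub>R S (\<delta> m)"
        using S_add[OF trF[of m a]] S_scale[OF \<delta>F[of m]] Suc.prems by simp
      then show ?case using Suc by simp
    qed
    have trN: "?N (tr n a) = ?N a" for a by (rule lpn_norm_cong) (simp add: tr_def)
    have "1 \<le> ?N (\<delta> 0)" using abs_le_lpn_norm[OF p, of 0 n "\<delta> 0"] n by (simp add: \<delta>_def)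
    also have "\<dots> \<le> A * norm (S (\<delta> 0))" using n by (intro A \<delta>F) simp
    finally have A0: "A > 0" by (smt (verit) mult_nonpos_nonneg norm_ge_zero)
    show ?thesis
    proof (intro exI[of _ "\<lambda>l. A *\<^sub>R S (\<delta> l)"] allI conjI)
      fix a
      have "(\<Sum>l<n. a l *\<^sub>R A *\<^sub>R S (\<delta> l)) = A *\<^sub>R S (tr n a)"
        by (simp add: tr_eq scaleR_sum_right mult.commute)
      then have eq: "norm (\<Sum>l<n. a l *\<^sub>R A *\<^sub>R S (\<delta> l)) = A * norm (S (tr n a))" using A0 by simp
      show "?N a \<le> norm (\<Sum>l<n. a l *\<^sub>R A *\<^sub>R S (\<delta> l))" unfolding eq using A[OF trF[of n a]] by (simp add: trN)
      have "A * norm (S (tr n a)) \<le> A * (B * ?N a)"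
        using B[OF trF[of n a]] A0 by (intro mult_left_mono) (auto simp: trN)
      also have "\<dots> = A * B * ?N a" by simp
      also have "\<dots> \<le> (C + 1) * ?N a"
        using lt lpn_norm_nonneg[OF p n] by (intro mult_right_mono) (auto simp: A_def B_def S_def)
      finally show "norm (\<Sum>l<n. a l *\<^sub>R A *\<^sub>R S (\<delta> l)) \<le> (C + 1) * ?N a" unfolding eq .
    qed
  qed
  then show ?thesis using C by (intro exI[of _ "C + 1"]) auto
qed

text \<open>The distortion in the hypothesis on \<open>Y\<close> disappears here: James' argument
  gives 2 for infinite \<open>p\<close>, the averaging argument 8 for finite
  \<open>p\<close>.\<close>

lemma uniform_copies:
  fixes Z :: "'b::banach set"
  assumes Y: "contains_lpn_uniformly p TYPE('b)" and p: "1 \<le> p" and n: "n \<ge> 1"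
    and Z: "finite Z" and \<epsilon>: "\<epsilon> > 0"
  shows "\<exists>u :: nat \<Rightarrow> 'b. \<forall>a. lpn_norm p n a \<le> norm (lincomb n a u) \<and>
     norm (lincomb n a u) \<le> 8 * lpn_norm p n a \<and>
     (\<forall>z\<in>Z. norm z - \<epsilon> \<le> norm (z + (lincomb n a u)))"
proof -
  obtain \<Lambda> where \<Lambda>: "\<Lambda> \<ge> 1" and copies: "\<And>n. n \<ge> 1 \<Longrightarrow> \<exists>e :: nat \<Rightarrow> 'b. \<forall>a. 
    lpn_norm p n a \<le> norm (lincomb n a e) \<and> norm (lincomb n a e) \<le> \<Lambda> * lpn_norm p n a"
    using contains_lpn_uniformlyD[OF Y p] by blast
  from p show ?thesis
  proof (cases rule: ereal_ge_1_cases)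
    case 1
    have sup: "\<exists>u :: nat \<Rightarrow> 'b. sup_copy \<Lambda> n u" if "n > 0" for n
      using copies[of n] that unfolding sup_copy_def 1 lpn_norm_infinite by simp
    have "\<exists>u :: nat \<Rightarrow> 'b. sup_copy 2 n u" if "n > 0" for n
      by (rule james_sup[OF sup]) (use \<Lambda> that in auto)
    then obtain u :: "nat \<Rightarrow> 'b" where u: "sup_copy 2 n u" 
      "\<And>a z. z \<in> Z \<Longrightarrow> norm z - \<epsilon> \<le> norm (z + (lincomb n a u))"
      using sup_copy_transversal[of n Z \<epsilon>] n Z \<epsilon> by auto
    show ?thesis unfolding 1 lpn_norm_infinite
    proof (intro exI[of _ u] allI conjI ballI u(2))
      fix a
      have "norm (lincomb n a u) \<le> 2 * max_norm n a" using u(1) by (simp add: sup_copy_def)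
      also have "\<dots> \<le> 8 * max_norm n a" using max_norm_nonneg[of n a] n by simp
      finally show "norm (lincomb n a u) \<le> 8 * max_norm n a" .
    qed (use u(1) in \<open>simp add: sup_copy_def\<close>)
  next
    case (2 q)
    have basis: "\<exists>e :: nat \<Rightarrow> 'b. lq_basis e L q \<Lambda>" for L
    proof (cases "L = 0")
      case True
      then show ?thesis using 2 \<Lambda> by (intro exI[of _ "\<lambda>_. 0"]) (simp add: lq_basis_def lq_norm_def)
    next
      case False
      then show ?thesis using copies[of L] 2 \<Lambda> by (auto simp: lq_basis_def lpn_norm_finite)
    qed
    show ?thesis unfolding 2(1) lpn_norm_finite
      by (rule krivine_finite[OF 2(2) basis _ Z \<epsilon>]) (use n in simp)
  qed
qed

text \<open>Finite-dimensionality in the form used below: it supplies finite nets of the unit sphere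
  and is preserved by adding a transversal copy.\<close>

definition compact_ball :: "'b::real_normed_vector set \<Rightarrow> bool" where
  "compact_ball S \<longleftrightarrow> (\<exists>K. compact K \<and> {z\<in>S. norm z \<le> 1} \<subseteq> K)"

text \<open>By homogeneity it suffices to treat unit vectors of \<open>S\<close>. A net of mesh
  \<open>\<epsilon>/3\<close> reduces them to finitely many; two thirds of \<epsilon> pay for
  replacing \<open>y\<close> by a point of the net on both sides.\<close>

lemma transversal_copy:
  fixes S :: "'b::banach set"
  assumes Y: "contains_lpn_uniformly p TYPE('b)" and p: "1 \<le> p" and n: "n \<ge> 1"
    and S: "subspace S" "compact_ball S" and \<epsilon>: "\<epsilon> > 0"
  shows "\<exists>u :: nat \<Rightarrow> 'b. \<forall>a. lpn_norm p n a \<le> norm (lincomb n a u) \<and>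
     norm (lincomb n a u) \<le> 8 * lpn_norm p n a \<and>
     (\<forall>z\<in>S. (1 - \<epsilon>) * norm z \<le> norm (z + (lincomb n a u)))"
proof -
  obtain K where K: "compact K" "{z\<in>S. norm z \<le> 1} \<subseteq> K" using S by (auto simp: compact_ball_def)
  obtain Z where Z: "finite Z" "K \<subseteq> (\<Union>x\<in>Z. ball x (\<epsilon>/3))"
    using K(1) \<epsilon> unfolding compact_eq_totally_bounded by (metis divide_pos_pos zero_less_numeral)
  obtain u :: "nat \<Rightarrow> 'b" where u: "\<And>a. lpn_norm p n a \<le> norm (lincomb n a u)"
     "\<And>a. norm (lincomb n a u) \<le> 8 * lpn_norm p n a"
     "\<And>a z. z \<in> Z \<Longrightarrow> norm z - \<epsilon>/3 \<le> norm (z + (lincomb n a u))"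
    using uniform_copies[OF Y p n Z(1), of "\<epsilon>/3"] \<epsilon> by auto
  have unit: "1 - \<epsilon> \<le> norm (y + (lincomb n a u))" if y: "y \<in> S" "norm y = 1" for y a
  proof -
    have "y \<in> K" using y K(2) by auto
    then obtain z where "z \<in> Z" "y \<in> ball z (\<epsilon>/3)" using Z(2) by blast
    then have z: "z \<in> Z" "dist z y < \<epsilon>/3" by auto
    define w where "w = (lincomb n a u)"
    have "norm z - \<epsilon>/3 \<le> norm (z + w)" unfolding w_def by (rule u(3)[OF z(1)])
    moreover have "norm (z + w) \<le> norm (y + w) + dist z y"
      using norm_triangle_ineq[of "y + w" "z - y"] by (simp add: dist_norm algebra_simps)
    moreover have "norm y \<le> norm z + dist z y"
      using norm_triangle_ineq[of z "y - z"] by (simp add: dist_norm norm_minus_commute)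
    ultimately show ?thesis using z y unfolding w_def by linarith
  qed
  show ?thesis
  proof (intro exI[of _ u] allI conjI ballI u(1,2))
    fix a z assume z: "z \<in> S"
    show "(1 - \<epsilon>) * norm z \<le> norm (z + (lincomb n a u))"
    proof (cases "z = 0")
      case False
      define t where "t = norm z"
      have t: "t > 0" using False by (simp add: t_def)
      have "1 - \<epsilon> \<le> norm ((1/t) *\<^sub>R z + (\<Sum>i<n. (1/t * a i) *\<^sub>R u i))"
        by (rule unit) (use z S(1) t in \<open>auto simp: subspace_scale t_def\<close>)
      also have "(1/t) *\<^sub>R z + (\<Sum>i<n. (1/t * a i) *\<^sub>R u i) = (1/t) *\<^sub>R (z + (lincomb n a u))"
        by (simp add: scaleR_add_right scaleR_sum_right)
      also have "norm \<dots> = norm (z + (lincomb n a u)) / t" using t by simp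
      finally show ?thesis using t by (simp add: t_def pos_le_divide_eq)
    qed simp
  qed
qed

lemma compact_box_image:
  fixes u :: "nat \<Rightarrow> 'b::real_normed_vector"
  shows "compact {\<Sum>i<n. a i *\<^sub>R u i | a. \<forall>i<n. \<bar>a i\<bar> \<le> R}"
proof (induction n)
  case (Suc n)
  let ?C = "\<lambda>n. {\<Sum>i<n. a i *\<^sub>R u i | a. \<forall>i<n. \<bar>a i\<bar> \<le> R}"
  have "compact ((\<lambda>t. t *\<^sub>R u n) ` {- R..R})"
    by (intro compact_continuous_image continuous_intros) auto
  from compact_sums[OF Suc this]
  have "compact {x + y | x y. x \<in> ?C n \<and> y \<in> (\<lambda>t. t *\<^sub>R u n) ` {- R..R}}" .
  also have "{x + y | x y. x \<in> ?C n \<and> y \<in> (\<lambda>t. t *\<^sub>R u n) ` {- R..R}} = ?C (Suc n)" (is "?A = _")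
  proof (intro equalityI subsetI)
    fix v assume "v \<in> ?A"
    then obtain a t where at: "v = (lincomb n a u) + t *\<^sub>R u n" "\<forall>i<n. \<bar>a i\<bar> \<le> R" "t \<in> {- R..R}" by auto
    have "v = (\<Sum>i<Suc n. (a(n := t)) i *\<^sub>R u i)" by (simp add: at)
    moreover have "\<forall>i<Suc n. \<bar>(a(n := t)) i\<bar> \<le> R" using at by (auto simp: less_Suc_eq)
    ultimately show "v \<in> ?C (Suc n)" by (intro CollectI exI[of _ "a(n := t)"] conjI)
  next
    fix v assume "v \<in> ?C (Suc n)"
    then obtain a where a: "v = (lincomb n a u) + a n *\<^sub>R u n" "\<forall>i<Suc n. \<bar>a i\<bar> \<le> R" by auto
    have "a n \<in> {- R..R}" using a(2)[rule_format, of n] by (auto simp: abs_le_iff)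
    then have t: "a n *\<^sub>R u n \<in> (\<lambda>t. t *\<^sub>R u n) ` {- R..R}" by (rule imageI)
    have c: "(lincomb n a u) \<in> ?C n"
      using a(2) by (intro CollectI exI[of _ a]) simp
    show "v \<in> ?A" unfolding a(1)
      by (rule CollectI, rule exI, rule exI, rule conjI[OF refl conjI[OF c t]])
  qed
  finally show ?case .
qed auto

text \<open>Transversality controls both components of a vector of norm at most 1: with
  \<open>\<epsilon> \<le> 1/2\<close> the part in \<open>S\<close> has norm at most 2, so the
  coefficients are at most 3. The ball therefore lies in the sum of two compact sets.\<close>

lemma transversal_sum:
  fixes S :: "'b::banach set"
  assumes S: "subspace S" "compact_ball S" and p: "1 \<le> p" and n: "n \<ge> 1" and \<epsilon>: "\<epsilon> \<le> 1/2"
    and u: "\<And>a. lpn_norm p n a \<le> norm (lincomb n a u)"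
     "\<And>a z. z \<in> S \<Longrightarrow> (1 - \<epsilon>) * norm z \<le> norm (z + (lincomb n a u))"
  defines "S' \<equiv> {z + (lincomb n a u) | z a. z \<in> S}"
  shows "subspace S'" "compact_ball S'"
proof -
  show "subspace S'"
  proof (rule subspaceI)
    show "0 \<in> S'" unfolding S'_def using subspace_0[OF S(1)]
      by (intro CollectI exI[of _ 0] exI[of _ "\<lambda>_. 0"]) auto
    fix x y assume "x \<in> S'" "y \<in> S'"
    then obtain z a z' a' where "x = z + (lincomb n a u)" "y = z' + (lincomb n a' u)" "z \<in> S" "z' \<in> S"
      by (auto simp: S'_def)
    then have "x + y = (z + z') + (\<Sum>i<n. (a i + a' i) *\<^sub>R u i)" "z + z' \<in> S"
      using subspace_add[OF S(1)] by (auto simp: scaleR_add_left sum.distrib)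
    then show "x + y \<in> S'" unfolding S'_def
      by (intro CollectI exI[of _ "z + z'"] exI[of _ "\<lambda>i. a i + a' i"]) auto
  next
    fix c x assume "x \<in> S'"
    then obtain z a where "x = z + (lincomb n a u)" "z \<in> S" by (auto simp: S'_def)
    then have "c *\<^sub>R x = c *\<^sub>R z + (\<Sum>i<n. (c * a i) *\<^sub>R u i)" "c *\<^sub>R z \<in> S"
      using subspace_scale[OF S(1)] by (auto simp: scaleR_add_right scaleR_sum_right)
    then show "c *\<^sub>R x \<in> S'" unfolding S'_def
      by (intro CollectI exI[of _ "c *\<^sub>R z"] exI[of _ "\<lambda>i. c * a i"]) auto
  qed
  obtain K where K: "compact K" "{z\<in>S. norm z \<le> 1} \<subseteq> K" using S by (auto simp: compact_ball_def)
  let ?C = "{\<Sum>i<n. a i *\<^sub>R u i | a. \<forall>i<n. \<bar>a i\<bar> \<le> 3}"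
  let ?K = "{x + y | x y. x \<in> (\<lambda>z. 2 *\<^sub>R z) ` K \<and> y \<in> ?C}"
  have "compact ?K" by (intro compact_sums compact_scaling K compact_box_image)
  moreover have "{z\<in>S'. norm z \<le> 1} \<subseteq> ?K"
  proof safe
    fix x assume "x \<in> S'" and x1: "norm x \<le> 1"
    then obtain z a where x: "x = z + (lincomb n a u)" and z: "z \<in> S" by (auto simp: S'_def)
    have "1/2 * norm z \<le> (1 - \<epsilon>) * norm z" using \<epsilon> by (intro mult_right_mono) auto
    also have "\<dots> \<le> 1" using u(2)[OF z, of a] x1 by (simp add: x)
    finally have z2: "norm z \<le> 2" by simp
    have "norm (lincomb n a u) \<le> norm x + norm z" using norm_triangle_ineq4[of x z] by (simp add: x)
    then have "lpn_norm p n a \<le> 3" using u(1)[of a] z2 x1 by linarith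
    then have "\<forall>i<n. \<bar>a i\<bar> \<le> 3" using abs_le_lpn_norm[OF p, of _ n a] by (meson order_trans)
    then have "(lincomb n a u) \<in> ?C" by blast
    moreover have "(1/2) *\<^sub>R z \<in> K" using z2 z K(2) subspace_scale[OF S(1)] by auto
    then have "z \<in> (\<lambda>z. 2 *\<^sub>R z) ` K" by (intro image_eqI[of _ _ "(1/2) *\<^sub>R z"]) auto
    ultimately show "\<exists>x' y. x = x' + y \<and> x' \<in> (\<lambda>z. 2 *\<^sub>R z) ` K \<and> y \<in> ?C" using x by blast
  qed
  ultimately show "compact_ball S'" by (auto simp: compact_ball_def)
qed

text \<open>Each copy is transversal to the span of its predecessors. Dropping the blocks from
  \<open>k\<close> on costs the product of the factors \<open>1 - \<epsilon> j\<close>, which stays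
  above 3/4 because the \<open>\<epsilon> j\<close> add up to 1/4.\<close>

lemma independent_copies:
  fixes N :: "nat \<Rightarrow> nat"
  assumes Y: "contains_lpn_uniformly p TYPE('b::banach)" and p: "1 \<le> p" and N: "\<And>j. N j \<ge> 1"
  shows "\<exists>u :: nat \<Rightarrow> nat \<Rightarrow> 'b. 
    (\<forall>j a. lpn_norm p (N j) a \<le> norm (lincomb (N j) a (u j)) \<and> 
      norm (lincomb (N j) a (u j)) \<le> 8 * lpn_norm p (N j) a) \<and>
    (\<forall>k m A. k \<le> m \<longrightarrow> 3/4 * norm (\<Sum>j<k. \<Sum>i<N j. A j i *\<^sub>R u j i) \<le> norm (\<Sum>j<m. \<Sum>i<N j. A j i *\<^sub>R u j i))"
proof -
  define \<epsilon> where "\<epsilon> j = (1/2::real)^(j + 3)" for j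
  have \<epsilon>: "\<epsilon> j > 0" "\<epsilon> j \<le> 1/2" for j
  proof -
    have "(1/2::real)^(j + 3) \<le> (1/2)^1" by (rule power_decreasing) auto
    then show "\<epsilon> j > 0" "\<epsilon> j \<le> 1/2" by (auto simp: \<epsilon>_def)
  qed
  define good where "good j S u \<longleftrightarrow> (\<forall>a. lpn_norm p (N j) a \<le> norm (lincomb (N j) a u) \<and>
     norm (lincomb (N j) a u) \<le> 8 * lpn_norm p (N j) a \<and>
     (\<forall>z\<in>S. (1 - \<epsilon> j) * norm z \<le> norm (z + (lincomb (N j) a u))))" for j S and u :: "nat \<Rightarrow> 'b"
  define ext where "ext j S u = {z + (lincomb (N j) a u) | z a. z \<in> S}" for j S and u :: "nat \<Rightarrow> 'b"
  define P where "P j s \<longleftrightarrow> subspace (fst s) \<and> compact_ball (fst s) \<and> good j (fst s) (snd s)" for j s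
  have ex: "\<exists>u. good j S u" if "subspace S" "compact_ball S" for j S
    unfolding good_def by (rule transversal_copy[OF Y p N that \<epsilon>(1)])
  \<comment> \<open>Dependent choice on pairs of a subspace and a copy transversal to it; the next
    subspace is the sum of the two.\<close>
  have "\<exists>f. \<forall>j. P j (f j) \<and> fst (f (Suc j)) = ext j (fst (f j)) (snd (f j))"
  proof (rule dependent_nat_choice)
    have S0: "subspace {0::'b}" "compact_ball {0::'b}"
      by (auto simp: subspace_def compact_ball_def intro!: exI[of _ "{0}"])
    then obtain u where "good 0 {0} u" using ex by blast
    then show "\<exists>s. P 0 s" using S0 by (intro exI[of _ "({0}, u)"]) (simp add: P_def)
    fix s j assume s: "P j s"
    have s1: "subspace (fst s)" "compact_ball (fst s)"
      and s2: "\<And>a. lpn_norm p (N j) a \<le> norm (lincomb (N j) a (snd s))"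
        "\<And>a z. z \<in> fst s \<Longrightarrow> (1 - \<epsilon> j) * norm z \<le> norm (z + (lincomb (N j) a (snd s)))"
      using s unfolding P_def good_def by blast+
    have S': "subspace (ext j (fst s) (snd s))" "compact_ball (ext j (fst s) (snd s))"
      unfolding ext_def using transversal_sum[OF s1 p N \<epsilon>(2) s2] by auto
    then obtain u where "good (Suc j) (ext j (fst s) (snd s)) u" using ex by blast
    then show "\<exists>s'. P (Suc j) s' \<and> fst s' = ext j (fst s) (snd s)"
      using S' by (intro exI[of _ "(ext j (fst s) (snd s), u)"]) (simp add: P_def)
  qed
  then obtain f where f: "\<And>j. P j (f j)" "\<And>j. fst (f (Suc j)) = ext j (fst (f j)) (snd (f j))" by blast
  define u where "u j = snd (f j)" for j
  define T where "T A m = (\<Sum>j<m. \<Sum>i<N j. A j i *\<^sub>R u j i)" for A :: "nat \<Rightarrow> nat \<Rightarrow> real" and m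
  have T_in: "T A m \<in> fst (f m)" for A m
  proof (induction m)
    case 0
    show ?case using f(1)[of 0] by (auto simp: T_def P_def subspace_0)
  next
    case (Suc m)
    have "T A (Suc m) = T A m + (lincomb (N m) (A m) (u m))" by (simp add: T_def)
    then show ?case unfolding f(2) ext_def using Suc by (auto simp: u_def)
  qed
  \<comment> \<open>The constant decreases by exactly \<open>\<epsilon> m\<close> at each step and
    is at most 1 throughout, so that
    \<open>(1 - \<epsilon> m) * c \<ge> c - \<epsilon> m\<close>.\<close>
  have gap: "(3/4 + (1/2)^(m + 2)) * norm (T A k) \<le> norm (T A m)" if "k \<le> m" for A k m
    using that
  proof (induction m rule: dec_induct)
    case base
    have "(1/2::real)^(k + 2) \<le> (1/2)^2" by (rule power_decreasing) auto
    then have "(3/4 + (1/2)^(k + 2)) * norm (T A k) \<le> 1 * norm (T A k)"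
      by (intro mult_right_mono) (auto simp: power2_eq_square)
    then show ?case by simp
  next
    case (step m)
    define c where "c = (3/4 + (1/2::real)^(m + 2))"
    have "(1/2::real)^(m + 2) \<le> (1/2)^2" by (rule power_decreasing) auto
    then have c: "c \<le> 1" by (auto simp: c_def power2_eq_square)
    have "3/4 + (1/2)^(Suc m + 2) = c - \<epsilon> m" by (simp add: c_def \<epsilon>_def power_add eval_nat_numeral)
    also have "\<dots> \<le> (1 - \<epsilon> m) * c" using mult_left_mono[OF c, of "\<epsilon> m"] \<epsilon>(1)[of m] by (simp add: algebra_simps)
    finally have "(3/4 + (1/2)^(Suc m + 2)) * norm (T A k) \<le> (1 - \<epsilon> m) * c * norm (T A k)"
      by (intro mult_right_mono) auto
    also have "\<dots> \<le> (1 - \<epsilon> m) * norm (T A m)"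
      using mult_left_mono[OF step.IH, of "1 - \<epsilon> m"] \<epsilon>(2)[of m] by (simp add: c_def mult.assoc)
    also have "\<dots> \<le> norm (T A m + (lincomb (N m) (A m) (u m)))"
      using f(1)[of m] T_in[of A m] by (auto simp: P_def good_def u_def)
    also have "\<dots> = norm (T A (Suc m))" by (simp add: T_def)
    finally show ?case .
  qed
  have "3/4 * norm (T A k) \<le> norm (T A m)" if "k \<le> m" for A k m
  proof -
    have "3/4 * norm (T A k) \<le> (3/4 + (1/2)^(m + 2)) * norm (T A k)" by (intro mult_right_mono) auto
    with gap[OF that, of A] show ?thesis by linarith
  qed
  then show ?thesis
    using f(1) unfolding T_def by (intro exI[of _ u]) (auto simp: P_def good_def u_def)
qed


section \<open>Discretization of the function spaces\<close>

abbreviation Mu :: "real measure" where "Mu \<equiv> lebesgue_on {0..1}"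

text \<open>A measurable partition of \<open>[0,1]\<close> is represented by the labels of its
  cells; refinement becomes pairing of labels.\<close>

abbreviation labellings :: "(real \<Rightarrow> nat) set" where "labellings \<equiv> measurable Mu (count_space UNIV)"

section \<open>Representatives of classes and integrability\<close>

lemma finite_Mu: "finite_measure Mu"
  by (metis cbox_interval finite_measure_lebesgue_on lmeasurable_cbox)

lemma rep_L0_measurable [measurable, simp]: "rep_L0 x \<in> borel_measurable Mu"
  using Quotient3_rep_reflp[OF Quotient3_L0] by blast

lemma abs_rep_L0 [simp]: "abs_L0 (rep_L0 x) = x"
  by (rule Quotient3_abs_rep[OF Quotient3_L0])

lemma rep_abs_L0:
  assumes "f \<in> borel_measurable Mu"
  shows "AE t in Mu. rep_L0 (abs_L0 f) t = f t"
  using rep_abs_rsp[OF Quotient3_L0, of f f] assms by (auto elim!: eventually_mono)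

lemma Lp_norm_abs: "f \<in> borel_measurable Mu \<Longrightarrow> Lp_norm p (abs_L0 f) = Lp_seminorm p f"
  by (rule Lp_norm.abs_eq) auto

lemma Lp_abs: "f \<in> borel_measurable Mu \<Longrightarrow> abs_L0 f \<in> Lp p \<longleftrightarrow> Lp_fun p f"
  using in_Lp.abs_eq[of f p] by (auto simp: Lp_def)

lemma diff_abs:
  "f \<in> borel_measurable Mu \<Longrightarrow> g \<in> borel_measurable Mu \<Longrightarrow> abs_L0 f - abs_L0 g = abs_L0 (\<lambda>t. f t - g t)"
  by (rule minus_L0.abs_eq) auto

lemma rep_diff: "AE t in Mu. rep_L0 (x - y) t = rep_L0 x t - rep_L0 y t"
  using rep_abs_L0[of "\<lambda>t. rep_L0 x t - rep_L0 y t"] diff_abs[of "rep_L0 x" "rep_L0 y"] by simp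

lemma Lp_diff: "1 \<le> p \<Longrightarrow> x \<in> Lp p \<Longrightarrow> y \<in> Lp p \<Longrightarrow> x - y \<in> Lp p"
  using Lp_add(1)[of p x "- y"] Lp_uminus by simp

lemma Lp_finiteD: "x \<in> Lp (ereal q) \<Longrightarrow> integrable Mu (\<lambda>t. \<bar>rep_L0 x t\<bar> powr q)"
  by (simp add: Lp_def in_Lp.rep_eq Lp_fun_def)

lemma Lp_norm_finite: "Lp_norm (ereal q) x = (LINT t|Mu. \<bar>rep_L0 x t\<bar> powr q) powr (1/q)"
  by (simp add: Lp_norm.rep_eq Lp_seminorm_def)

lemma Lp_infiniteD:
  assumes "x \<in> Lp \<infinity>"
  shows "AE t in Mu. \<bar>rep_L0 x t\<bar> \<le> Lp_norm \<infinity> x"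
proof -
  let ?e = "esssup Mu (\<lambda>t. ereal \<bar>rep_L0 x t\<bar>)"
  have "?e < \<infinity>" using assms by (simp add: Lp_def in_Lp.rep_eq Lp_fun_def)
  then have "?e = ereal (Lp_norm \<infinity> x)"
    using esssup_abs_nonneg[of "rep_L0 x"] by (cases ?e) (auto simp: Lp_norm.rep_eq Lp_seminorm_def)
  then show ?thesis using esssup_AE[of "\<lambda>t. ereal \<bar>rep_L0 x t\<bar>" Mu] by simp
qed

lemma Lp_infinite_bound:
  assumes f: "f \<in> borel_measurable Mu" and le: "AE t in Mu. \<bar>f t\<bar> \<le> B"
  shows "abs_L0 f \<in> Lp \<infinity>" "Lp_norm \<infinity> (abs_L0 f) \<le> B"
proof -
  have "esssup Mu (\<lambda>t. ereal \<bar>f t\<bar>) \<le> ereal B"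
    using assms by (intro esssup_I) auto
  then show "abs_L0 f \<in> Lp \<infinity>" "Lp_norm \<infinity> (abs_L0 f) \<le> B"
    using f esssup_abs_nonneg[of f]
    by (cases "esssup Mu (\<lambda>t. ereal \<bar>f t\<bar>)"; auto simp: Lp_abs Lp_norm_abs Lp_fun_def Lp_seminorm_def)+
qed

lemma powr_ge_self: "(1::real) \<le> q \<Longrightarrow> \<bar>s\<bar> \<le> 1 + \<bar>s\<bar> powr q"
  using powr_mono[of 1 q "\<bar>s\<bar>"] by (cases "\<bar>s\<bar> \<le> 1") (auto simp: add_increasing2)

lemma integrable_of_powr:
  fixes f :: "real \<Rightarrow> real"
  assumes "1 \<le> q" "f \<in> borel_measurable Mu" "integrable Mu (\<lambda>t. \<bar>f t\<bar> powr q)"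
  shows "integrable Mu f"
proof (rule Bochner_Integration.integrable_bound)
  show "integrable Mu (\<lambda>t. 1 + \<bar>f t\<bar> powr q)"
    using assms finite_measure.integrable_const[OF finite_Mu] by auto
  have "norm (f t) \<le> norm (1 + \<bar>f t\<bar> powr q)" for t
    using powr_ge_self[OF assms(1), of "f t"] by simp
  then show "AE t in Mu. norm (f t) \<le> norm (1 + \<bar>f t\<bar> powr q)" by simp
qed (use assms in auto)

lemma Lp_integrable:
  assumes "1 \<le> p" "x \<in> Lp p"
  shows "integrable Mu (rep_L0 x)"
  using assms(1)
proof (cases rule: ereal_ge_1_cases)
  case 1
  have "integrable Mu (\<lambda>t. Lp_norm \<infinity> x)" by (rule finite_measure.integrable_const[OF finite_Mu])
  then show ?thesis
  proof (rule Bochner_Integration.integrable_bound)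
    have "AE t in Mu. \<bar>rep_L0 x t\<bar> \<le> Lp_norm \<infinity> x" using Lp_infiniteD assms 1 by blast
    then show "AE t in Mu. norm (rep_L0 x t) \<le> norm (Lp_norm \<infinity> x)"
      by eventually_elim simp
  qed simp
next
  case (2 q)
  show ?thesis
    by (rule integrable_of_powr[OF 2(2) rep_L0_measurable Lp_finiteD]) (use assms(2) 2(1) in simp)
qed

text \<open>Hoelder's inequality on \<open>A\<close>, obtained by integrating a pointwise Young
  inequality. The power of the measure in front is the one for which the coordinates of a step
  function reproduce its norm.\<close>

lemma jensen_on_set:
  fixes f :: "real \<Rightarrow> real"
  assumes q: "1 \<le> q" and f: "f \<in> borel_measurable Mu" "integrable Mu (\<lambda>t. \<bar>f t\<bar> powr q)" and A: "A \<in> sets Mu"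
  shows "\<bar>measure Mu A powr (1/q - 1) * (LINT t|Mu. f t * indicator A t)\<bar> powr q \<le>
    (LINT t|Mu. \<bar>f t\<bar> powr q * indicator A t)"
proof -
  define m where "m = measure Mu A"
  define a where "a = (LINT t|Mu. \<bar>f t\<bar> * indicator A t)"
  define c where "c = (LINT t|Mu. \<bar>f t\<bar> powr q * indicator A t)"
  have intf: "integrable Mu (\<lambda>t. \<bar>f t\<bar>)" using integrable_of_powr[OF q f] by auto
  have intA: "integrable Mu (\<lambda>t. g t * indicator A t)" if "integrable Mu g" for g :: "real \<Rightarrow> real"
    using that A by (rule integrable_real_mult_indicator[rotated])
  have c0: "c \<ge> 0" unfolding c_def by (intro integral_nonneg_AE) auto
  have a0: "a \<ge> 0" unfolding a_def by (intro integral_nonneg_AE) auto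
  have "\<bar>LINT t|Mu. f t * indicator A t\<bar> \<le> (LINT t|Mu. \<bar>f t * indicator A t\<bar>)"
    by (rule integral_abs_bound)
  also have "\<dots> = a" by (simp add: a_def abs_mult)
  finally have fa: "\<bar>LINT t|Mu. f t * indicator A t\<bar> \<le> a" .
  have "A \<subseteq> {0..1}" using sets.sets_into_space[OF A] by (simp add: space_restrict_space)
  then have m_ind: "(LINT t|Mu. indicator A t) = m" "integrable Mu (indicator A :: real \<Rightarrow> real)"
    using A finite_measure.emeasure_finite[OF finite_Mu, of A]
    by (auto simp: m_def space_restrict_space less_top Int_absorb2)
  show ?thesis
  proof (cases "a = 0 \<or> m = 0")
    case True
    \<comment> \<open>If \<open>a = 0\<close> the integral vanishes; on a null set the weight does,
      since \<open>0 powr x = 0\<close>.\<close>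
    have z: "m powr (1/q - 1) * (LINT t|Mu. f t * indicator A t) = 0"
      using True fa by auto
    show ?thesis unfolding m_def[symmetric] c_def[symmetric] z using c0 q by simp
  next
    case False
    \<comment> \<open>The mean of \<open>\<bar>f\<bar>\<close> over \<open>A\<close>: after division
      by it the tangent bound \<open>s \<le> s powr q / q + (1 - 1/q)\<close> at
      \<open>s = 1\<close> is sharp for constant \<open>\<bar>f\<bar>\<close>.\<close>
    define \<alpha> where "\<alpha> = a / m"
    have m0: "m > 0" using False by (simp add: m_def zero_less_measure_iff)
    have \<alpha>0: "\<alpha> > 0" using m0 a0 False by (simp add: \<alpha>_def)
    have pt: "\<bar>f t\<bar> / \<alpha> \<le> \<bar>f t\<bar> powr q * (1 / (q * \<alpha> powr q)) + (1 - 1/q)" for t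
    proof (cases "f t = 0")
      case True
      then show ?thesis using q by simp
    next
      case False
      define s where "s = \<bar>f t\<bar> / \<alpha>"
      have s: "s > 0" using False \<alpha>0 by (simp add: s_def)
      have "(s powr q) powr (1/q) * 1 powr (1 - 1/q) \<le> 1/q * s powr q + (1 - 1/q) * 1"
        by (rule Youngs_inequality_0) (use q s in auto)
      then have "s \<le> 1/q * s powr q + (1 - 1/q)" using q s by (simp add: powr_powr)
      then show ?thesis using \<alpha>0 by (simp add: s_def powr_divide)
    qed
    let ?a = "(LINT t|Mu. \<bar>f t\<bar> / \<alpha> * indicator A t)" and ?b = "(LINT t|Mu. (\<bar>f t\<bar> powr q * (1 / (q * \<alpha> powr q)) + (1 - 1/q)) * indicator A t)"
    have "?a \<le>
      ?b"
      using f intf finite_measure.integrable_const[OF finite_Mu]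
      by (intro integral_mono intA mult_right_mono pt) auto
    moreover have "?a = a / \<alpha>"
    proof -
      have "?a = (LINT t|Mu. (1/\<alpha>) * (\<bar>f t\<bar> * indicator A t))"
        by (intro Bochner_Integration.integral_cong) auto
      then show ?thesis by (simp add: a_def)
    qed
    moreover have "?b
      = c * (1 / (q * \<alpha> powr q)) + (1 - 1/q) * m"
    proof -
      have "?b =
        (LINT t|Mu. (1 / (q * \<alpha> powr q)) * (\<bar>f t\<bar> powr q * indicator A t) + (1 - 1/q) * indicator A t)"
        by (intro Bochner_Integration.integral_cong) (auto simp: algebra_simps)
      also have "\<dots> = (LINT t|Mu. (1 / (q * \<alpha> powr q)) * (\<bar>f t\<bar> powr q * indicator A t)) + (LINT t|Mu. (1 - 1/q) * indicator A t)"
        using intA[OF f(2)] m_ind(2) by (intro Bochner_Integration.integral_add) auto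
      also have "\<dots> = (1 / (q * \<alpha> powr q)) * c + (1 - 1/q) * m"
        unfolding integral_mult_right_zero m_ind(1) c_def ..
      finally show ?thesis by simp
    qed
    moreover have "a / \<alpha> = m" using False m0 by (simp add: \<alpha>_def)
    ultimately have "m \<le> c * (1 / (q * \<alpha> powr q)) + (1 - 1/q) * m" by simp
    then have "m / q \<le> c / (q * \<alpha> powr q)" by (simp add: algebra_simps)
    then have key: "m * \<alpha> powr q \<le> c" using q \<alpha>0 by (simp add: field_simps)
    have "\<bar>m powr (1/q - 1) * (LINT t|Mu. f t * indicator A t)\<bar> powr q \<le> (m powr (1/q - 1) * a) powr q"
      using fa q by (intro powr_mono2) (auto simp: abs_mult intro!: mult_left_mono)
    also have "\<dots> = (m powr (1/q - 1) * m * \<alpha>) powr q" using m0 by (simp add: \<alpha>_def)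
    also have "m powr (1/q - 1) * m = m powr (1/q)" using m0 by (simp add: powr_diff)
    also have "(m powr (1/q) * \<alpha>) powr q = m * \<alpha> powr q" using q m0 by (simp add: powr_mult powr_powr)
    finally show ?thesis using key unfolding m_def c_def by linarith
  qed
qed

definition cell :: "(real \<Rightarrow> nat) \<Rightarrow> nat \<Rightarrow> real set" where
  "cell lab i = {t \<in> {0..1}. lab t = i}"

text \<open>Weighted averages over the cells of the partition; by the conventions \<open>1 / 0 = 0\<close> and
  \<open>0 powr a = 0\<close> the null cells get coordinate \<open>0\<close>.\<close>

definition cell_weight :: "ereal \<Rightarrow> real \<Rightarrow> real" where
  "cell_weight p m = (if p = \<infinity> then 1 / m else m powr (1 / real_of_ereal p - 1))"

definition discretize :: "ereal \<Rightarrow> (real \<Rightarrow> nat) \<Rightarrow> L0 \<Rightarrow> nat \<Rightarrow> real" where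
  "discretize p lab x i = cell_weight p (measure Mu (cell lab i)) * (LINT t|Mu. rep_L0 x t * indicator (cell lab i) t)"

lemma cell_sets [measurable]: "lab \<in> labellings \<Longrightarrow> cell lab i \<in> sets Mu"
  using measurable_sets[of lab Mu "count_space UNIV" "{i}"]
  by (simp add: cell_def vimage_def Int_def space_restrict_space conj_commute)

lemma integral_cell:
  assumes "lab \<in> labellings"
  shows "(LINT t|Mu. c * indicator (cell lab i) t) = c * measure Mu (cell lab i)"
proof -
  have "cell lab i \<inter> {0..1} = cell lab i" by (auto simp: cell_def)
  then show ?thesis
    using cell_sets[OF assms, of i] finite_measure.emeasure_finite[OF finite_Mu, of "cell lab i"] by simp
qed

lemma sum_cells:
  assumes "\<And>t. lab t < N" "t \<in> {0..1}"
  shows "(\<Sum>i<N. g i * indicator (cell lab i) t) = (g (lab t) :: real)"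
proof -
  have "(\<Sum>i<N. g i * indicator (cell lab i) t) = (\<Sum>i<N. if i = lab t then g i else 0)"
    using assms by (intro sum.cong) (auto simp: cell_def indicator_def)
  then show ?thesis using assms by (simp add: sum.delta)
qed

lemma discretize_diff:
  assumes "1 \<le> p" "x \<in> Lp p" "y \<in> Lp p" and lab: "lab \<in> labellings"
  shows "discretize p lab (x - y) i = discretize p lab x i - discretize p lab y i"
proof -
  note int = Lp_integrable[OF assms(1)]
  have intA: "integrable Mu (\<lambda>t. rep_L0 x t * indicator (cell lab i) t)" if "x \<in> Lp p" for x
    using int[OF that] cell_sets[OF lab] by (intro integrable_real_mult_indicator)
  have "(LINT t|Mu. rep_L0 (x - y) t * indicator (cell lab i) t) =
    (LINT t|Mu. rep_L0 x t * indicator (cell lab i) t - rep_L0 y t * indicator (cell lab i) t)"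
    using cell_sets[OF lab, of i] rep_diff[of x y]
    by (intro integral_cong_AE) (auto simp: left_diff_distrib elim!: eventually_mono)
  also have "\<dots> = (LINT t|Mu. rep_L0 x t * indicator (cell lab i) t) - (LINT t|Mu. rep_L0 y t * indicator (cell lab i) t)"
    by (intro Bochner_Integration.integral_diff intA assms)
  finally show ?thesis by (simp add: discretize_def right_diff_distrib)
qed

lemma discretize_contraction:
  assumes p: "1 \<le> p" and x: "x \<in> Lp p" and lab: "lab \<in> labellings" "\<And>t. lab t < N"
  shows "lpn_norm p N (discretize p lab x) \<le> Lp_norm p x"
  using p
proof (cases rule: ereal_ge_1_cases)
  case 1
  have N: "N > 0" using lab(2)[of 0] by simp
  have "\<bar>discretize p lab x i\<bar> \<le> Lp_norm \<infinity> x" for i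
  proof -
    define m where "m = measure Mu (cell lab i)"
    have "\<bar>LINT t|Mu. rep_L0 x t * indicator (cell lab i) t\<bar> \<le> (LINT t|Mu. \<bar>rep_L0 x t * indicator (cell lab i) t\<bar>)"
      by (rule integral_abs_bound)
    also have "\<dots> \<le> (LINT t|Mu. Lp_norm \<infinity> x * indicator (cell lab i) t)"
    proof (rule integral_mono_AE)
      show "integrable Mu (\<lambda>t. \<bar>rep_L0 x t * indicator (cell lab i) t\<bar>)"
        using Lp_integrable[OF p x] cell_sets[OF lab(1)] by (intro integrable_abs integrable_real_mult_indicator)
      show "integrable Mu (\<lambda>t. Lp_norm \<infinity> x * indicator (cell lab i) t)"
        using cell_sets[OF lab(1)] finite_measure.integrable_const[OF finite_Mu] by (intro integrable_real_mult_indicator)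
      show "AE t in Mu. \<bar>rep_L0 x t * indicator (cell lab i) t\<bar> \<le> Lp_norm \<infinity> x * indicator (cell lab i) t"
      proof -
        have "AE t in Mu. \<bar>rep_L0 x t\<bar> \<le> Lp_norm \<infinity> x" using Lp_infiniteD x 1 by blast
        then show ?thesis by eventually_elim (auto simp: indicator_def)
      qed
    qed
    also have "\<dots> = Lp_norm \<infinity> x * m"
      unfolding m_def by (rule integral_cell[OF lab(1)])
    finally have "\<bar>LINT t|Mu. rep_L0 x t * indicator (cell lab i) t\<bar> \<le> Lp_norm \<infinity> x * m" .
    then have "1 / m * \<bar>LINT t|Mu. rep_L0 x t * indicator (cell lab i) t\<bar> \<le> 1 / m * (Lp_norm \<infinity> x * m)"
      by (intro mult_left_mono) (auto simp: m_def)
    also have "\<dots> \<le> Lp_norm \<infinity> x" using Lp_norm_nonneg[of \<infinity> x] by (cases "m = 0") auto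
    finally show ?thesis by (simp add: discretize_def cell_weight_def 1 abs_mult m_def)
  qed
  then show ?thesis using N by (simp add: 1 lpn_norm_infinite max_norm_le)
next
  case (2 q)
  let ?f = "rep_L0 x"
  have f: "?f \<in> borel_measurable Mu" "integrable Mu (\<lambda>t. \<bar>?f t\<bar> powr q)"
    using Lp_finiteD[OF x[unfolded 2(1)]] by simp_all
  have "(\<Sum>i<N. \<bar>discretize p lab x i\<bar> powr q) \<le> (\<Sum>i<N. (LINT t|Mu. \<bar>?f t\<bar> powr q * indicator (cell lab i) t))"
    unfolding discretize_def cell_weight_def using 2
    by (intro sum_mono) (simp add: jensen_on_set[OF 2(2) f cell_sets[OF lab(1)]])
  also have "\<dots> = (LINT t|Mu. (\<Sum>i<N. \<bar>?f t\<bar> powr q * indicator (cell lab i) t))"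
    using f cell_sets[OF lab(1)] by (intro Bochner_Integration.integral_sum[symmetric] integrable_real_mult_indicator) auto
  also have "\<dots> = (LINT t|Mu. \<bar>?f t\<bar> powr q)"
    by (rule Bochner_Integration.integral_cong[OF refl], rule sum_cells[OF lab(2)]) (simp add: space_restrict_space)
  finally have "(\<Sum>i<N. \<bar>discretize p lab x i\<bar> powr q) powr (1/q) \<le> (LINT t|Mu. \<bar>?f t\<bar> powr q) powr (1/q)"
    using 2 by (intro powr_mono2) (auto intro: sum_nonneg)
  then show ?thesis by (simp add: 2(1) lpn_norm_finite lq_norm_def Lp_norm_finite)
qed

definition step :: "(real \<Rightarrow> nat) \<Rightarrow> (nat \<Rightarrow> real) \<Rightarrow> L0" where
  "step lab \<sigma> = abs_L0 (\<lambda>t. \<sigma> (lab t))"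

lemma step_measurable [measurable]:
  "lab \<in> labellings \<Longrightarrow> (\<lambda>t. \<sigma> (lab t) :: real) \<in> borel_measurable Mu"
  by (rule measurable_compose[where N = "count_space UNIV"]) auto

lemma step_diff:
  "lab \<in> labellings \<Longrightarrow> step lab \<sigma> - step lab \<tau> = step lab (\<lambda>i. \<sigma> i - \<tau> i)"
  unfolding step_def by (rule diff_abs) auto

lemma bounded_in_Lp:
  assumes p: "1 \<le> p" and f: "f \<in> borel_measurable Mu" and le: "\<And>t. \<bar>f t\<bar> \<le> B"
  shows "abs_L0 f \<in> Lp p"
  using p
proof (cases rule: ereal_ge_1_cases)
  case 1
  then show ?thesis using Lp_infinite_bound(1)[OF f, of B] le by auto
next
  case (2 q)
  have "integrable Mu (\<lambda>t. \<bar>f t\<bar> powr q)"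
  proof (rule Bochner_Integration.integrable_bound)
    show "integrable Mu (\<lambda>t. B powr q)" by (rule finite_measure.integrable_const[OF finite_Mu])
    show "AE t in Mu. norm (\<bar>f t\<bar> powr q) \<le> norm (B powr q)"
      using le 2 by (auto intro!: powr_mono2)
  qed (use f in auto)
  then show ?thesis using f 2 by (simp add: Lp_abs Lp_fun_def)
qed

lemma step_in_Lp:
  assumes "1 \<le> p" "lab \<in> labellings" "\<And>t. lab t < N"
  shows "step lab \<sigma> \<in> Lp p"
  unfolding step_def
proof (rule bounded_in_Lp[OF assms(1)])
  show "\<bar>\<sigma> (lab t)\<bar> \<le> (\<Sum>i<N. \<bar>\<sigma> i\<bar>)" for t
    using assms(3) by (intro member_le_sum) auto
qed (use assms in auto)

text \<open>On a cell of positive measure averaging returns the value; the remaining cells get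
  coordinate 0 but form a null set. Together with the contraction property, step functions keep
  their norm.\<close>

lemma discretize_step:
  assumes p: "1 \<le> p" and lab: "lab \<in> labellings" "\<And>t. lab t < N"
  shows "Lp_norm p (step lab \<sigma>) \<le> lpn_norm p N (discretize p lab (step lab \<sigma>))"
proof -
  define m where "m i = measure Mu (cell lab i)" for i
  have ind: "(LINT t|Mu. c * indicator (cell lab i) t) = c * m i" for c i
    unfolding m_def by (rule integral_cell[OF lab(1)])
  have int: "(LINT t|Mu. rep_L0 (step lab \<sigma>) t * indicator (cell lab i) t) = \<sigma> i * m i" for i
  proof -
    have "(LINT t|Mu. rep_L0 (step lab \<sigma>) t * indicator (cell lab i) t) = (LINT t|Mu. \<sigma> i * indicator (cell lab i) t)"
    proof (rule integral_cong_AE)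
      show "(\<lambda>t. rep_L0 (step lab \<sigma>) t * indicator (cell lab i) t) \<in> borel_measurable Mu"
        "(\<lambda>t. \<sigma> i * indicator (cell lab i) t) \<in> borel_measurable Mu"
        using cell_sets[OF lab(1), of i] by auto
      have "AE t in Mu. rep_L0 (step lab \<sigma>) t = \<sigma> (lab t)"
        unfolding step_def by (rule rep_abs_L0[OF step_measurable[OF lab(1)]])
      then show "AE t in Mu. rep_L0 (step lab \<sigma>) t * indicator (cell lab i) t = \<sigma> i * indicator (cell lab i) t"
        by eventually_elim (auto simp: indicator_def cell_def)
    qed
    then show ?thesis unfolding ind .
  qed
  from p show ?thesis
  proof (cases rule: ereal_ge_1_cases)
    case 1
    have "AE t in Mu. m (lab t) \<noteq> 0"
    proof -
      have "AE t in Mu. t \<notin> cell lab i" if "m i = 0" for i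
        using that cell_sets[OF lab(1), of i] finite_measure.emeasure_eq_measure[OF finite_Mu, of "cell lab i"]
        by (intro AE_not_in) (auto simp: m_def null_sets_def)
      then have "AE t in Mu. \<forall>i. m i = 0 \<longrightarrow> t \<notin> cell lab i" by (simp add: AE_all_countable)
      moreover have "AE t in Mu. t \<in> space Mu" by (rule AE_space)
      ultimately show ?thesis by eventually_elim (auto simp: cell_def)
    qed
    then have "AE t in Mu. \<bar>\<sigma> (lab t)\<bar> \<le> max_norm N (discretize p lab (step lab \<sigma>))"
    proof eventually_elim
      case (elim t)
      then have "discretize p lab (step lab \<sigma>) (lab t) = \<sigma> (lab t)"
        unfolding discretize_def int cell_weight_def m_def[symmetric] by (simp add: 1)
      then show ?case using abs_le_max_norm[OF lab(2)[of t]] by metis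
    qed
    then show ?thesis unfolding 1 lpn_norm_infinite step_def
      by (intro Lp_infinite_bound(2)) (use lab in auto)
  next
    case (2 q)
    have "Lp_norm p (step lab \<sigma>) = (LINT t|Mu. \<bar>\<sigma> (lab t)\<bar> powr q) powr (1/q)"
      using lab by (simp add: step_def Lp_norm_abs Lp_seminorm_def 2(1))
    also have "(LINT t|Mu. \<bar>\<sigma> (lab t)\<bar> powr q) = (LINT t|Mu. (\<Sum>i<N. \<bar>\<sigma> i\<bar> powr q * indicator (cell lab i) t))"
    proof (rule Bochner_Integration.integral_cong[OF refl])
      fix t assume "t \<in> space Mu"
      then have "t \<in> {0..1}" by (simp add: space_restrict_space)
      from sum_cells[OF lab(2) this, of "\<lambda>i. \<bar>\<sigma> i\<bar> powr q"]
      show "\<bar>\<sigma> (lab t)\<bar> powr q = (\<Sum>i<N. \<bar>\<sigma> i\<bar> powr q * indicator (cell lab i) t)" by (rule sym)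
    qed
    also have "\<dots> = (\<Sum>i<N. (LINT t|Mu. \<bar>\<sigma> i\<bar> powr q * indicator (cell lab i) t))"
      using cell_sets[OF lab(1)] finite_measure.integrable_const[OF finite_Mu]
      by (intro Bochner_Integration.integral_sum integrable_real_mult_indicator) auto
    also have "\<dots> = (\<Sum>i<N. \<bar>discretize p lab (step lab \<sigma>) i\<bar> powr q)"
    proof (rule sum.cong[OF refl])
      fix i
      have "\<bar>m i powr (1/q - 1) * (\<sigma> i * m i)\<bar> powr q = \<bar>\<sigma> i\<bar> powr q * m i"
      proof (cases "m i = 0")
        case False
        then have mi: "m i > 0" by (simp add: m_def zero_less_measure_iff)
        have "m i powr (1/q - 1) * m i = m i powr (1/q)" using mi by (simp add: powr_diff)
        then have "\<bar>m i powr (1/q - 1) * (\<sigma> i * m i)\<bar> = m i powr (1/q) * \<bar>\<sigma> i\<bar>"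
          by (simp add: abs_mult mult_ac)
        then show ?thesis using 2 mi by (simp add: powr_mult powr_powr)
      qed (use 2 in simp)
      then show "(LINT t|Mu. \<bar>\<sigma> i\<bar> powr q * indicator (cell lab i) t) = \<bar>discretize p lab (step lab \<sigma>) i\<bar> powr q"
        unfolding discretize_def int ind cell_weight_def m_def[symmetric] by (simp add: 2(1))
    qed
    finally show ?thesis by (simp add: 2(1) lpn_norm_finite lq_norm_def)
  qed
qed

text \<open>One parameter widens the range \<open>[-k, k]\<close> and refines the mesh
  \<open>(1/2)^k\<close> together; the shift by \<open>k\<close> makes the index a natural
  number.\<close>

definition quantize :: "nat \<Rightarrow> real \<Rightarrow> nat" where
  "quantize k s = nat \<lfloor>(max (- real k) (min (real k) s) + real k) * 2^k\<rfloor>"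

definition dequantize :: "nat \<Rightarrow> nat \<Rightarrow> real" where
  "dequantize k i = real i / 2^k - real k"

lemma quantize_less: "quantize k s < 2 * k * 2^k + 1"
proof -
  define v where "v = max (- real k) (min (real k) s) + real k"
  have "v \<le> 2 * real k" by (auto simp: v_def)
  then have "v * 2^k \<le> 2 * real k * 2^k" by (intro mult_right_mono) auto
  then have "\<lfloor>v * 2^k\<rfloor> \<le> \<lfloor>real (2 * k * 2^k)\<rfloor>" by (intro floor_mono) simp
  then have "nat \<lfloor>v * 2^k\<rfloor> \<le> 2 * k * 2^k" by (simp only: floor_of_nat nat_le_iff)
  then show ?thesis by (simp add: quantize_def v_def)
qed

text \<open>The unconditional bound provides the dominating function, the second one convergence as
  \<open>k\<close> grows.\<close>

lemma quantize_error:
  shows "\<bar>s - dequantize k (quantize k s)\<bar> \<le> \<bar>s\<bar> + 1"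
    and "\<bar>s\<bar> \<le> real k \<Longrightarrow> \<bar>s - dequantize k (quantize k s)\<bar> \<le> (1/2)^k"
proof -
  define v where "v = max (- real k) (min (real k) s)"
  have v: "v + real k \<ge> 0" by (auto simp: v_def)
  have "real (quantize k s) = of_int \<lfloor>(v + real k) * 2^k\<rfloor>"
    using v by (simp add: quantize_def v_def[symmetric])
  then have "\<bar>(v + real k) * 2^k - real (quantize k s)\<bar> \<le> 1" by linarith
  then have "\<bar>(v + real k) * 2^k - real (quantize k s)\<bar> / 2^k \<le> 1 / 2^k" by (intro divide_right_mono) auto
  also have "\<bar>(v + real k) * 2^k - real (quantize k s)\<bar> / 2^k = \<bar>((v + real k) * 2^k - real (quantize k s)) / 2^k\<bar>"
    by simp
  also have "((v + real k) * 2^k - real (quantize k s)) / 2^k = v - dequantize k (quantize k s)"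
    by (simp add: dequantize_def diff_divide_distrib)
  finally have e: "\<bar>v - dequantize k (quantize k s)\<bar> \<le> (1/2)^k" by (simp add: power_one_over)
  have "(1/2::real)^k \<le> 1" by (simp add: power_le_one)
  moreover have "\<bar>s - v\<bar> \<le> \<bar>s\<bar>" by (auto simp: v_def)
  ultimately show "\<bar>s - dequantize k (quantize k s)\<bar> \<le> \<bar>s\<bar> + 1" using e by linarith
  assume "\<bar>s\<bar> \<le> real k"
  then have "v = s" by (auto simp: v_def)
  with e show "\<bar>s - dequantize k (quantize k s)\<bar> \<le> (1/2)^k" by simp
qed

lemma quantize_measurable:
  assumes [measurable]: "f \<in> borel_measurable Mu"
  shows "(\<lambda>t. quantize k (f t)) \<in> labellings"
  unfolding quantize_def by measurable

lemma step_approximation: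
  assumes p: "1 \<le> p" and x: "x \<in> Lp p" and \<delta>: "\<delta> > 0"
  shows "\<exists>lab N \<sigma>. lab \<in> labellings \<and> (\<forall>t. lab t < N) \<and> Lp_norm p (x - step lab \<sigma>) \<le> \<delta>"
proof -
  let ?f = "rep_L0 x"
  define d where "d k t = ?f t - dequantize k (quantize k (?f t))" for k t
  note meas = quantize_measurable[OF rep_L0_measurable[of x]]
  have dm: "d k \<in> borel_measurable Mu" for k
    unfolding d_def using step_measurable[OF meas[of k], of "dequantize k"] by simp
  have eq: "x - step (\<lambda>t. quantize k (?f t)) (dequantize k) = abs_L0 (d k)" for k
    using diff_abs[of ?f "\<lambda>t. dequantize k (quantize k (?f t))"] step_measurable[OF meas[of k], of "dequantize k"]
    by (simp add: step_def d_def[abs_def])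
  have "\<exists>k. Lp_norm p (abs_L0 (d k)) \<le> \<delta>"
    using p
  proof (cases rule: ereal_ge_1_cases)
    case 1
    obtain k1 :: nat where k1: "Lp_norm \<infinity> x \<le> real k1" using real_arch_simple by blast
    obtain k2 where k2: "(1/2::real)^k2 < \<delta>" using real_arch_pow_inv[OF \<delta>, of "1/2"] by auto
    define k where "k = max k1 k2"
    have "(1/2::real)^k \<le> (1/2)^k2" by (rule power_decreasing) (auto simp: k_def)
    then have k: "Lp_norm \<infinity> x \<le> real k" "(1/2)^k \<le> \<delta>" using k1 k2 by (linarith | simp add: k_def)+
    have "AE t in Mu. \<bar>d k t\<bar> \<le> \<delta>"
    proof -
      have "AE t in Mu. \<bar>rep_L0 x t\<bar> \<le> Lp_norm \<infinity> x" using Lp_infiniteD x 1 by blast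
      then show ?thesis
      proof eventually_elim
        case (elim t)
        then show ?case using quantize_error(2)[of "?f t" k] k unfolding d_def by linarith
      qed
    qed
    then show ?thesis unfolding 1 using Lp_infinite_bound(2)[OF dm] by blast
  next
    case (2 q)
    have fq: "integrable Mu (\<lambda>t. \<bar>?f t\<bar> powr q)" using Lp_finiteD[OF x[unfolded 2(1)]] .
    have "(\<lambda>k. LINT t|Mu. \<bar>d k t\<bar> powr q) \<longlonglongrightarrow> (LINT t|Mu. 0)"
    proof (rule integral_dominated_convergence)
      show "integrable Mu (\<lambda>t. 2 powr q * (1 + \<bar>?f t\<bar> powr q))"
        using fq finite_measure.integrable_const[OF finite_Mu]
        by (intro integrable_mult_right Bochner_Integration.integrable_add) auto
      show "(\<lambda>t. \<bar>d k t\<bar> powr q) \<in> borel_measurable Mu" for k using dm[of k] by measurable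
      show "AE t in Mu. norm (\<bar>d k t\<bar> powr q) \<le> 2 powr q * (1 + \<bar>?f t\<bar> powr q)" for k
      proof (rule AE_I2)
        fix t
        have "\<bar>d k t\<bar> powr q \<le> (2 * max 1 \<bar>?f t\<bar>) powr q"
          using quantize_error(1)[of "?f t" k] 2 by (intro powr_mono2) (auto simp: d_def)
        also have "\<dots> = 2 powr q * max 1 \<bar>?f t\<bar> powr q" by (simp add: powr_mult)
        also have "\<dots> \<le> 2 powr q * (1 + \<bar>?f t\<bar> powr q)"
          by (intro mult_left_mono) (auto simp: max_def)
        finally show "norm (\<bar>d k t\<bar> powr q) \<le> 2 powr q * (1 + \<bar>?f t\<bar> powr q)" by simp
      qed
      show "AE t in Mu. (\<lambda>k. \<bar>d k t\<bar> powr q) \<longlonglongrightarrow> 0"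
      proof (rule AE_I2)
        fix t
        obtain k0 :: nat where k0: "\<bar>?f t\<bar> \<le> real k0" using real_arch_simple by blast
        have "\<bar>d k t\<bar> powr q \<le> (1/2)^k" if "k \<ge> k0" for k
        proof -
          have "\<bar>d k t\<bar> \<le> (1/2)^k" unfolding d_def using k0 that by (intro quantize_error(2)) auto
          moreover have "(1/2::real)^k \<le> 1" by (simp add: power_le_one)
          ultimately have "\<bar>d k t\<bar> powr q \<le> \<bar>d k t\<bar> powr 1" using 2 by (intro powr_mono') auto
          then show ?thesis using \<open>\<bar>d k t\<bar> \<le> (1/2)^k\<close> by simp
        qed
        then show "(\<lambda>k. \<bar>d k t\<bar> powr q) \<longlonglongrightarrow> 0"
          by (intro tendsto_sandwich[OF _ _ tendsto_const LIMSEQ_power_zero[of "1/2::real"]])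
            (auto simp: eventually_at_top_linorder)
      qed
    qed auto
    then have "eventually (\<lambda>k. (LINT t|Mu. \<bar>d k t\<bar> powr q) < \<delta> powr q) sequentially"
      by (rule order_tendstoD(2)) (use \<delta> in simp)
    then obtain k where "(LINT t|Mu. \<bar>d k t\<bar> powr q) < \<delta> powr q"
      by (auto simp: eventually_at_top_linorder)
    then have "(LINT t|Mu. \<bar>d k t\<bar> powr q) powr (1/q) \<le> (\<delta> powr q) powr (1/q)"
      using 2 by (intro powr_mono2) auto
    also have "\<dots> = \<delta>" using \<delta> 2 by (simp add: powr_powr)
    finally show ?thesis using dm by (auto simp: 2(1) Lp_norm_abs Lp_seminorm_def)
  qed
  then obtain k where "Lp_norm p (x - step (\<lambda>t. quantize k (?f t)) (dequantize k)) \<le> \<delta>" by (auto simp: eq)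
  with meas[of k] quantize_less[of k] show ?thesis by blast
qed

text \<open>Common refinement: the pair of labels is coded as \<open>lab2 t * N1 + lab1 t\<close>,
  and each partition is recovered by \<open>div\<close> or \<open>mod\<close>.\<close>

lemma common_step_approximation:
  assumes p: "1 \<le> p" and F: "finite F" "F \<subseteq> Lp p" and \<delta>: "\<delta> > 0"
  shows "\<exists>lab N. lab \<in> labellings \<and> (\<forall>t. lab t < N) \<and> (\<forall>x\<in>F. \<exists>\<sigma>. Lp_norm p (x - step lab \<sigma>) \<le> \<delta>)"
  using F
proof (induction F rule: finite_induct)
  case empty
  show ?case by (intro exI[of _ "\<lambda>_. 0"] exI[of _ 1]) auto
next
  case (insert x F)
  obtain lab1 N1 \<sigma>1 where 1: "lab1 \<in> labellings" "\<And>t. lab1 t < N1" "Lp_norm p (x - step lab1 \<sigma>1) \<le> \<delta>"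
    using step_approximation[OF p _ \<delta>, of x] insert.prems by auto
  have "\<exists>lab N. lab \<in> labellings \<and> (\<forall>t. lab t < N) \<and> (\<forall>x\<in>F. \<exists>\<sigma>. Lp_norm p (x - step lab \<sigma>) \<le> \<delta>)"
    using insert by simp
  then obtain lab2 N2 where 2: "lab2 \<in> labellings" "\<And>t. lab2 t < N2"
    "\<And>y. y \<in> F \<Longrightarrow> \<exists>\<sigma>. Lp_norm p (y - step lab2 \<sigma>) \<le> \<delta>"
    by blast
  define lab where "lab t = lab2 t * N1 + lab1 t" for t
  have m: "lab \<in> labellings" unfolding lab_def using 1(1) 2(1) by measurable
  have less: "lab t < N2 * N1" for t unfolding lab_def by (rule block_less[OF 2(2) 1(2)])
  have N1: "N1 > 0" using 1(2)[of 0] by simp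
  have "step lab (\<lambda>i. \<sigma>1 (i mod N1)) = step lab1 \<sigma>1" using 1(2) by (simp add: step_def lab_def)
  moreover have "step lab (\<lambda>i. \<sigma> (i div N1)) = step lab2 \<sigma>" for \<sigma> using 1(2) N1 by (simp add: step_def lab_def)
  ultimately have "\<exists>\<sigma>. Lp_norm p (y - step lab \<sigma>) \<le> \<delta>" if "y \<in> insert x F" for y
    using that 1(3) 2(3) by (metis insertE)
  with m less show ?case by blast
qed


section \<open>Gluing\<close>

text \<open>Balls are centred at a point \<open>x0\<close> of \<open>M\<close>, since 0 need not
  belong to \<open>M\<close>; the radius \<open>R + Lp_norm p x0\<close> captures every point of
  \<open>M\<close> of norm at most \<open>R\<close>.\<close>

lemma proper_net:
  assumes p: "1 \<le> p" and M: "M \<subseteq> Lp p" "proper_metric_space M (Lp_dist p)" and \<delta>: "\<delta> > 0"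
  shows "\<exists>F. finite F \<and> F \<subseteq> M \<and> (\<forall>x\<in>M. Lp_norm p x \<le> R \<longrightarrow> (\<exists>y\<in>F. Lp_norm p (x - y) \<le> \<delta>))"
proof (cases "M = {}")
  case True
  then show ?thesis by (intro exI[of _ "{}"]) auto
next
  case False
  then obtain x0 where x0: "x0 \<in> M" by blast
  interpret Metric_space M "Lp_dist p" using M(2) unfolding proper_metric_space_def by (rule conjunct1)
  define S where "S = mcball x0 (R + Lp_norm p x0)"
  have "compactin mtopology S" using M(2) x0 unfolding proper_metric_space_def S_def by blast
  then have "mtotally_bounded S" by (rule compactin_imp_mtotally_bounded)
  then have "\<exists>F. finite F \<and> F \<subseteq> S \<and> S \<subseteq> (\<Union>x\<in>F. mball x \<delta>)"
    unfolding mtotally_bounded_def using \<delta> by (elim allE impE)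
  then obtain F where F: "finite F" "F \<subseteq> S" "S \<subseteq> (\<Union>x\<in>F. mball x \<delta>)"
    by (elim exE conjE)
  have "F \<subseteq> M" using F(2) by (auto simp: S_def)
  moreover have "\<exists>y\<in>F. Lp_norm p (x - y) \<le> \<delta>" if x: "x \<in> M" "Lp_norm p x \<le> R" for x
  proof -
    have "Lp_norm p (x0 - x) \<le> Lp_norm p x0 + Lp_norm p (- x)"
      using Lp_add(2)[OF p, of x0 "- x"] x0 x M(1) Lp_uminus by auto
    then have "x \<in> S" using x x0 by (auto simp: S_def Lp_dist_def Lp_norm_uminus)
    then obtain y where "y \<in> F" "x \<in> mball y \<delta>" using F(3) by blast
    then show ?thesis using commute[of x y] by (auto simp: Lp_dist_def intro!: bexI[of _ y])
  qed
  ultimately show ?thesis using F(1) by blast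
qed

text \<open>What the gluing requires of one discretization \<open>V\<close>. The vector
  \<open>z\<close> stands for a step function close to \<open>x - y\<close> and not shortened by
  \<open>V\<close>. The 72 is adapted to maps of norm 8: the error costs
  \<open>(1 + 8) / 72 = 1/8\<close> of the distance.\<close>

definition separates :: "ereal \<Rightarrow> L0 set \<Rightarrow> real \<Rightarrow> real \<Rightarrow> nat \<Rightarrow> (L0 \<Rightarrow> nat \<Rightarrow> real) \<Rightarrow> bool" where
  "separates p M R s N V \<longleftrightarrow> N \<ge> 1 \<and> (\<forall>x\<in>Lp p. \<forall>y\<in>Lp p. \<forall>i. V (x - y) i = V x i - V y i) \<and>
    (\<forall>x\<in>Lp p. lpn_norm p N (V x) \<le> Lp_norm p x) \<and>
    (\<forall>x\<in>M. \<forall>y\<in>M. Lp_norm p x \<le> R \<longrightarrow> Lp_norm p y \<le> R \<longrightarrow> s \<le> Lp_norm p (x - y) \<longrightarrow>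
      (\<exists>z\<in>Lp p. Lp_norm p z \<le> lpn_norm p N (V z) \<and> Lp_norm p (x - y - z) \<le> Lp_norm p (x - y) / 72))"

lemma discretization_on_bounded:
  assumes p: "1 \<le> p" and M: "M \<subseteq> Lp p" "proper_metric_space M (Lp_dist p)" and s: "s > 0"
  shows "\<exists>N V. separates p M R s N V"
proof -
  \<comment> \<open>Each of \<open>x\<close> and \<open>y\<close> is within
    \<open>2 * \<delta>\<close> of a step function, \<delta> for the net and \<delta> for the
    approximation, and \<open>4 * \<delta> = s / 72\<close>.\<close>
  define \<delta> where "\<delta> = s / 288"
  have \<delta>: "\<delta> > 0" using s by (simp add: \<delta>_def)
  obtain F where F: "finite F" "F \<subseteq> M" "\<forall>x\<in>M. Lp_norm p x \<le> R \<longrightarrow> (\<exists>y\<in>F. Lp_norm p (x - y) \<le> \<delta>)"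
    using proper_net[OF p M \<delta>, of R] by (elim exE conjE)
  have FL: "F \<subseteq> Lp p" using F M by blast
  obtain lab N where lab: "lab \<in> labellings" "\<And>t. lab t < N"
    and app: "\<forall>x\<in>F. \<exists>\<sigma>. Lp_norm p (x - step lab \<sigma>) \<le> \<delta>"
    using common_step_approximation[OF p F(1) FL \<delta>] by (elim exE conjE) auto
  have N: "N \<ge> 1" using lab(2)[of 0] by simp
  have near: "\<exists>\<sigma>. Lp_norm p (x - step lab \<sigma>) \<le> 2 * \<delta>" if x: "x \<in> M" "Lp_norm p x \<le> R" for x
  proof -
    obtain y where y: "y \<in> F" "Lp_norm p (x - y) \<le> \<delta>" using F(3)[rule_format, OF x] by blast
    obtain \<sigma> where \<sigma>: "Lp_norm p (y - step lab \<sigma>) \<le> \<delta>" using app[rule_format, OF y(1)] by blast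
    have "Lp_norm p ((x - y) + (y - step lab \<sigma>)) \<le> Lp_norm p (x - y) + Lp_norm p (y - step lab \<sigma>)"
      using x(1) y(1) M(1) FL step_in_Lp[OF p lab] by (intro Lp_add(2)[OF p] Lp_diff[OF p]) auto
    then show ?thesis using y(2) \<sigma> by (intro exI[of _ \<sigma>]) simp
  qed
  show ?thesis
    unfolding separates_def
  proof (intro exI[of _ N] exI[of _ "discretize p lab"] conjI ballI allI impI N)
    show "discretize p lab (x - y) i = discretize p lab x i - discretize p lab y i"
      if "x \<in> Lp p" "y \<in> Lp p" for x y i by (rule discretize_diff[OF p that lab(1)])
    show "lpn_norm p N (discretize p lab x) \<le> Lp_norm p x" if "x \<in> Lp p" for x
      by (rule discretize_contraction[OF p that lab])
    fix x y assume xy: "x \<in> M" "y \<in> M" "Lp_norm p x \<le> R" "Lp_norm p y \<le> R" "s \<le> Lp_norm p (x - y)"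
    obtain \<sigma> where \<sigma>: "Lp_norm p (x - step lab \<sigma>) \<le> 2 * \<delta>" using near[OF xy(1,3)] by blast
    obtain \<tau> where \<tau>: "Lp_norm p (y - step lab \<tau>) \<le> 2 * \<delta>" using near[OF xy(2,4)] by blast
    define z where "z = step lab (\<lambda>i. \<sigma> i - \<tau> i)"
    have eq: "x - y - z = (x - step lab \<sigma>) + - (y - step lab \<tau>)"
      unfolding z_def step_diff[OF lab(1), symmetric] by simp
    have "x - step lab \<sigma> \<in> Lp p" "- (y - step lab \<tau>) \<in> Lp p"
      using xy(1,2) M(1) step_in_Lp[OF p lab] by (blast intro: Lp_diff[OF p] Lp_uminus)+
    then have "Lp_norm p (x - y - z) \<le> Lp_norm p (x - step lab \<sigma>) + Lp_norm p (- (y - step lab \<tau>))"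
      unfolding eq by (rule Lp_add(2)[OF p])
    also have "\<dots> \<le> 4 * \<delta>" unfolding Lp_norm_uminus using \<sigma> \<tau> by simp
    also have "\<dots> \<le> Lp_norm p (x - y) / 72" using xy(5) by (simp add: \<delta>_def)
    finally show "\<exists>z\<in>Lp p. Lp_norm p z \<le> lpn_norm p N (discretize p lab z) \<and> Lp_norm p (x - y - z) \<le> Lp_norm p (x - y) / 72"
      using step_in_Lp[OF p lab] discretize_step[OF p lab] unfolding z_def by blast
  qed
qed

section \<open>Partition of unity on the logarithmic scale and enumeration of the pairs\<close>

definition tent :: "int \<Rightarrow> real \<Rightarrow> real" where
  "tent n s = max 0 (1 - \<bar>s - of_int n\<bar>)"

lemma tent_nonneg [simp]: "tent n s \<ge> 0"
  by (simp add: tent_def)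

lemma tent_support: "n \<notin> {\<lfloor>s\<rfloor>, \<lfloor>s\<rfloor> + 1} \<Longrightarrow> tent n s = 0"
proof -
  assume "n \<notin> {\<lfloor>s\<rfloor>, \<lfloor>s\<rfloor> + 1}"
  then have "n \<le> \<lfloor>s\<rfloor> - 1 \<or> n \<ge> \<lfloor>s\<rfloor> + 2" by auto
  then have "real_of_int n \<le> of_int \<lfloor>s\<rfloor> - 1 \<or> real_of_int n \<ge> of_int \<lfloor>s\<rfloor> + 2" by linarith
  then have "\<bar>s - of_int n\<bar> \<ge> 1" by linarith
  then show "tent n s = 0" by (simp add: tent_def)
qed

lemma sum_tent_le:
  assumes "finite A"
  shows "(\<Sum>n\<in>A. tent n s) \<le> 1"
proof -
  have "(\<Sum>n\<in>A. tent n s) \<le> (\<Sum>n\<in>A \<union> {\<lfloor>s\<rfloor>, \<lfloor>s\<rfloor> + 1}. tent n s)"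
    using assms by (intro sum_mono2) auto
  also have "\<dots> = (\<Sum>n\<in>{\<lfloor>s\<rfloor>, \<lfloor>s\<rfloor> + 1}. tent n s)"
    using assms tent_support by (intro sum.mono_neutral_right) auto
  also have "\<dots> = 1"
  proof -
    have "\<bar>s - of_int \<lfloor>s\<rfloor>\<bar> = s - of_int \<lfloor>s\<rfloor>" "\<bar>s - of_int (\<lfloor>s\<rfloor> + 1)\<bar> = of_int \<lfloor>s\<rfloor> + 1 - s" by linarith+
    moreover have "s - of_int \<lfloor>s\<rfloor> \<le> 1" "of_int \<lfloor>s\<rfloor> + 1 - s \<le> 1" by linarith+
    ultimately show ?thesis by (simp add: tent_def)
  qed
  finally show ?thesis .
qed

lemma tent_lipschitz: "\<bar>tent n s - tent n s'\<bar> \<le> \<bar>s - s'\<bar>"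
  unfolding tent_def by linarith

text \<open>At most four tents are nonzero at \<open>s\<close> or \<open>s'\<close>, and each is
  1-Lipschitz; the bound is independent of the number of tents summed.\<close>

lemma sum_tent_diff_le:
  assumes "finite A"
  shows "(\<Sum>n\<in>A. \<bar>tent n s - tent n s'\<bar>) \<le> 4 * \<bar>s - s'\<bar>"
proof -
  let ?B = "{\<lfloor>s\<rfloor>, \<lfloor>s\<rfloor> + 1, \<lfloor>s'\<rfloor>, \<lfloor>s'\<rfloor> + 1}"
  have "(\<Sum>n\<in>A. \<bar>tent n s - tent n s'\<bar>) \<le> (\<Sum>n\<in>A \<union> ?B. \<bar>tent n s - tent n s'\<bar>)"
    using assms by (intro sum_mono2) auto
  also have "\<dots> = (\<Sum>n\<in>?B. \<bar>tent n s - tent n s'\<bar>)"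
    using assms tent_support by (intro sum.mono_neutral_right) auto
  also have "\<dots> \<le> of_nat (card ?B) * \<bar>s - s'\<bar>" by (rule sum_bounded_above) (rule tent_lipschitz)
  also have "\<dots> \<le> of_nat 4 * \<bar>s - s'\<bar>"
  proof (rule mult_right_mono)
    have "card ?B \<le> 4" by (simp add: card_insert_if)
    then show "(of_nat (card ?B) :: real) \<le> of_nat 4" by (rule of_nat_mono)
  qed simp
  finally show ?thesis by simp
qed

lemma tent_round: "tent (round s) s \<ge> 1/2"
  using of_int_round_abs_le[of s] by (auto simp: tent_def abs_minus_commute le_max_iff_disj)

text \<open>The pairs of an annulus and a depth are enumerated by the naturals, because the
  independent copies come in a single sequence.\<close>

definition annulus :: "nat \<Rightarrow> int" where "annulus j = int_decode (fst (prod_decode j))"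
definition depth :: "nat \<Rightarrow> nat" where "depth j = snd (prod_decode j)"

lemma annulus_depth_inj: "inj (\<lambda>j. (annulus j, depth j))"
proof (rule injI)
  fix i j assume "(annulus i, depth i) = (annulus j, depth j)"
  then have "prod_decode i = prod_decode j"
    using inj_int_decode[of UNIV] by (simp add: annulus_def depth_def prod_eq_iff inj_eq)
  then show "i = j" by (metis prod_decode_inverse)
qed

lemma annulus_depth_surj: "\<exists>j. annulus j = n \<and> depth j = k"
  by (rule exI[of _ "prod_encode (int_encode n, k)"]) (simp add: annulus_def depth_def)

text \<open>By injectivity an initial segment of indices sits inside a finite rectangle of annuli
  and depths, where the sum factors and the geometric weights add up to less than 1.\<close>

lemma sum_weights_le:
  assumes a: "\<And>n. a n \<ge> 0" and B: "\<And>A. finite A \<Longrightarrow> (\<Sum>n\<in>A. a n) \<le> B"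
  shows "(\<Sum>j<m. a (annulus j) * (1/2)^(depth j + 1)) \<le> (B :: real)"
proof -
  define K where "K = Suc (Max (insert 0 (depth ` {..<m})))"
  let ?h = "\<lambda>j. (annulus j, depth j)"
  have K: "depth j < K" if "j < m" for j using that by (auto simp: K_def less_Suc_eq_le)
  have "(\<Sum>j<m. a (annulus j) * (1/2)^(depth j + 1)) = (\<Sum>(n, k)\<in>?h ` {..<m}. a n * (1/2)^(k + 1))"
    by (subst sum.reindex) (auto intro: inj_on_subset[OF annulus_depth_inj])
  also have "\<dots> \<le> (\<Sum>(n, k)\<in>annulus ` {..<m} \<times> {..<K}. a n * (1/2)^(k + 1))"
    using a K by (intro sum_mono2) auto
  also have "\<dots> = (\<Sum>n\<in>annulus ` {..<m}. a n) * (\<Sum>k<K. (1/2)^(k + 1))"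
    by (simp add: sum.cartesian_product[symmetric] sum_product)
  also have "\<dots> \<le> (\<Sum>n\<in>annulus ` {..<m}. a n) * 1"
  proof (rule mult_left_mono)
    have "(\<Sum>k<K. (1/2::real)^(k + 1)) = 1 - (1/2)^K" by (induction K) (auto simp: field_simps)
    then show "(\<Sum>k<K. (1/2::real)^(k + 1)) \<le> 1" by simp
  qed (use a in \<open>auto intro: sum_nonneg\<close>)
  also have "\<dots> \<le> B" using B[of "annulus ` {..<m}"] by simp
  finally show ?thesis .
qed

theorem theorem2:
  fixes p :: ereal and M :: "L0 set" and r :: real and \<mu> :: "real \<Rightarrow> real"
  assumes "1 \<le> p"
    and "contains_lpn_uniformly p TYPE('b::banach)"
    and "M \<subseteq> Lp p"
    and "proper_metric_space M (Lp_dist p)"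
    and "r < 1 / 16"
    and "continuous_on {0<..} \<mu>"
    and "mono_on {0<..} \<mu>"
    and "\<mu> ` {0<..} = {..<0}"
  shows "\<exists>f :: L0 \<Rightarrow> 'b. \<forall>x\<in>M. \<forall>y\<in>M.
    (if x = y then 0 else 2 powr \<mu> (Lp_norm p (x - y)) * r * Lp_norm p (x - y)) \<le> norm (f x - f y) \<and>
    norm (f x - f y) \<le> 9 * Lp_norm p (x - y)"
proof -
  note p = assms(1) and Y = assms(2) and M = assms(3,4)
  \<comment> \<open>Surjectivity gives a scale \<open>s k\<close> with
    \<open>\<mu> (s k) = - (k + 1)\<close>; by monotonicity a distance \<open>t\<close> with
    \<open>- \<mu> t < k + 1\<close> is at least \<open>s k\<close>, so depth \<open>k\<close> has
    to resolve distances from \<open>s k\<close> on.\<close>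
  have "\<forall>k. \<exists>s>0. \<mu> s = - (real k + 1)"
  proof
    fix k :: nat
    have "- (real k + 1) \<in> \<mu> ` {0<..}" unfolding assms(8) by simp
    then show "\<exists>s>0. \<mu> s = - (real k + 1)" by (auto simp: eq_commute)
  qed
  then obtain s where s: "\<And>k. s k > 0" "\<And>k. \<mu> (s k) = - (real k + 1)" by metis
  \<comment> \<open>\<open>tent n (lg x)\<close> vanishes unless
    \<open>n - 1 < lg x < n + 1\<close>, so a nonzero vector that it does not cut off has norm below
    \<open>R n\<close>.\<close>
  define R where "R n = exp (512 * (real_of_int n + 1))" for n
  have "\<forall>j. \<exists>N V. separates p M (R (annulus j)) (s (depth j)) N V"
    by (intro allI discretization_on_bounded[OF p M s(1)])
  then obtain N V where NV: "\<And>j. separates p M (R (annulus j)) (s (depth j)) (N j) (V j)" by metis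
  have N: "N j \<ge> 1" for j using NV[of j] unfolding separates_def by blast
  have V_diff: "V j (x - y) i = V j x i - V j y i" if "x \<in> Lp p" "y \<in> Lp p" for j x y i
    using NV[of j] that unfolding separates_def by blast
  have V_le: "lpn_norm p (N j) (V j x) \<le> Lp_norm p x" if "x \<in> Lp p" for j x
    using NV[of j] that unfolding separates_def by blast
  obtain u :: "nat \<Rightarrow> nat \<Rightarrow> 'b" where
    u0: "\<forall>j a. lpn_norm p (N j) a \<le> norm (lincomb (N j) a (u j)) \<and>
      norm (lincomb (N j) a (u j)) \<le> 8 * lpn_norm p (N j) a"
    and indep: "\<forall>k m A. k \<le> m \<longrightarrow> 3/4 * norm (\<Sum>j<k. \<Sum>i<N j. A j i *\<^sub>R u j i) \<le> norm (\<Sum>j<m. \<Sum>i<N j. A j i *\<^sub>R u j i)"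
    using independent_copies[OF Y p, of N, OF N] by (elim exE conjE)
  have u: "lpn_norm p (N j) a \<le> norm (lincomb (N j) a (u j))"
       "norm (lincomb (N j) a (u j)) \<le> 8 * lpn_norm p (N j) a" for j a
    using u0 by auto
  define U where "U j x = (\<Sum>i<N j. V j x i *\<^sub>R u j i)" for j x
  have U_diff: "U j (x - y) = U j x - U j y" if "x \<in> Lp p" "y \<in> Lp p" for j x y
    by (simp add: U_def V_diff[OF that] scaleR_diff_left sum_subtractf)
  have U_le: "norm (U j x) \<le> 8 * Lp_norm p x" if "x \<in> Lp p" for j x
    using u(2)[where j = j and a = "V j x"] V_le[OF that, of j] by (simp add: U_def)
  \<comment> \<open>\<open>norm (U j z)\<close> is at least \<open>1 - 1/72\<close> of the distance,
    and \<open>U j\<close> changes by at most \<open>8/72\<close> of it between \<open>z\<close> and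
    \<open>x - y\<close>; this leaves 7/8.\<close>
  have U_ge: "7/8 * Lp_norm p (x - y) \<le> norm (U j (x - y))"
    if h: "x \<in> M" "y \<in> M" "Lp_norm p x \<le> R (annulus j)" "Lp_norm p y \<le> R (annulus j)" "s (depth j) \<le> Lp_norm p (x - y)" for j x y
  proof -
    obtain z where z: "z \<in> Lp p" "Lp_norm p z \<le> lpn_norm p (N j) (V j z)" "Lp_norm p (x - y - z) \<le> Lp_norm p (x - y) / 72"
      using NV[of j] h unfolding separates_def by blast
    have xy: "x - y \<in> Lp p" using h M(1) by (intro Lp_diff[OF p]) auto
    have "Lp_norm p z \<le> norm (U j z)" using z(2) u(1)[where j = j and a = "V j z"] by (simp add: U_def)
    moreover have "norm (U j (x - y - z)) \<le> 8 * Lp_norm p (x - y - z)" by (rule U_le[OF Lp_diff[OF p xy z(1)]])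
    moreover have "norm (U j z) \<le> norm (U j (x - y)) + norm (U j (x - y - z))"
      using norm_triangle_ineq4[of "U j (x - y)" "U j (x - y - z)"] U_diff[OF xy z(1), of j] by simp
    moreover have "Lp_norm p (x - y) \<le> Lp_norm p z + Lp_norm p (x - y - z)"
      using Lp_add(2)[OF p z(1) Lp_diff[OF p xy z(1)]] by simp
    ultimately show ?thesis using z(3) by linarith
  qed
  \<comment> \<open>The slope 1/512 bounds the contribution of the cutoffs by
    \<open>8 * 4 / 512 = 1/16\<close> in the upper estimate and by \<open>8 / 512 = 1/64\<close> in
    the lower one. At 0 the value \<open>ln 0 = 0\<close> is harmless because \<open>U j\<close>
    maps 0 to 0.\<close>
  define lg where "lg x = ln (Lp_norm p x) / 512" for x
  define c where "c j x = tent (annulus j) (lg x) * (1/2)^(depth j + 1)" for j x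
  have c0: "c j x \<ge> 0" for j x by (simp add: c_def)
  have c_sum: "(\<Sum>j<m. c j x) \<le> 1" for m x
    unfolding c_def by (rule sum_weights_le[OF tent_nonneg sum_tent_le])
  have c_diff: "\<bar>c j x - c j y\<bar> = \<bar>tent (annulus j) (lg x) - tent (annulus j) (lg y)\<bar> * (1/2)^(depth j + 1)" for j x y
    unfolding c_def left_diff_distrib[symmetric] by (simp add: abs_mult)
  have c_diff_sum: "(\<Sum>j<m. \<bar>c j x - c j y\<bar>) \<le> 4 * \<bar>lg x - lg y\<bar>" for m x y
    unfolding c_diff by (rule sum_weights_le[OF abs_ge_zero sum_tent_diff_le])
  have summ: "summable (\<lambda>j. c j x *\<^sub>R U j x)" if x: "x \<in> Lp p" for x
  proof (rule summable_norm_cancel, rule summableI_nonneg_bounded)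
    fix m
    have "(\<Sum>j<m. norm (c j x *\<^sub>R U j x)) \<le> (\<Sum>j<m. c j x * (8 * Lp_norm p x))"
      using U_le[OF x] c0 by (intro sum_mono) (auto intro!: mult_left_mono)
    also have "\<dots> \<le> 1 * (8 * Lp_norm p x)"
      unfolding sum_distrib_right[symmetric] using c_sum Lp_norm_nonneg by (intro mult_right_mono) auto
    finally show "(\<Sum>j<m. norm (c j x *\<^sub>R U j x)) \<le> 8 * Lp_norm p x" by simp
  qed simp
  define f where "f x = (\<Sum>j. c j x *\<^sub>R U j x)" for x
  let ?Q = "\<lambda>x y. (if x = y then 0 else 2 powr \<mu> (Lp_norm p (x - y)) * r * Lp_norm p (x - y)) \<le> norm (f x - f y) \<and>
    norm (f x - f y) \<le> 9 * Lp_norm p (x - y)"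
  \<comment> \<open>Ordering the norms lets the variation of the cutoffs be multiplied by the
    smaller norm, as the estimate \<open>log\<close> requires; the general case follows by
    symmetry.\<close>
  have main: "?Q x y"
    if xy: "x \<in> M" "y \<in> M" and le: "Lp_norm p x \<le> Lp_norm p y" for x y
  proof -
    define t where "t = Lp_norm p (x - y)"
    have x: "x \<in> Lp p" and y: "y \<in> Lp p" using xy M(1) by auto
    have xmy: "x - y \<in> Lp p" by (rule Lp_diff[OF p x y])
    have t0: "t \<ge> 0" by (simp add: t_def Lp_norm_nonneg)
    have ny: "Lp_norm p y \<le> Lp_norm p x + t"
      using Lp_add(2)[OF p x Lp_uminus[OF xmy]] by (simp add: Lp_norm_uminus t_def del: minus_diff_eq)
    have log: "\<bar>lg x - lg y\<bar> * Lp_norm p x \<le> t / 512"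
    proof (cases "Lp_norm p x = 0")
      case False
      then have x0: "Lp_norm p x > 0" using Lp_norm_nonneg[of p x] by linarith
      then have y0: "Lp_norm p y > 0" using le by linarith
      have "ln (Lp_norm p y) - ln (Lp_norm p x) = ln (Lp_norm p y / Lp_norm p x)" using x0 y0 by (simp add: ln_div)
      also have "\<dots> \<le> Lp_norm p y / Lp_norm p x - 1" using x0 y0 by (intro ln_le_minus_one) simp
      also have "\<dots> \<le> t / Lp_norm p x" using divide_right_mono[OF ny, of "Lp_norm p x"] x0 by (simp add: add_divide_distrib)
      finally have "lg y - lg x \<le> t / Lp_norm p x / 512" by (simp add: lg_def flip: diff_divide_distrib)
      moreover have "lg x \<le> lg y" using x0 le by (simp add: lg_def divide_right_mono)
      ultimately have "\<bar>lg x - lg y\<bar> \<le> t / Lp_norm p x / 512" by simp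
      then have "\<bar>lg x - lg y\<bar> * Lp_norm p x \<le> t / Lp_norm p x / 512 * Lp_norm p x"
        using x0 by (intro mult_right_mono) auto
      then show ?thesis using x0 by simp
    qed (use t0 in simp)
    define g where "g j = c j x *\<^sub>R U j x - c j y *\<^sub>R U j y" for j
    \<comment> \<open>The increment is split into a cut-off image of \<open>x - y\<close> and a pure
      variation of the cutoff, carried by the smaller vector.\<close>
    have g_eq: "g j = c j y *\<^sub>R U j (x - y) + (c j x - c j y) *\<^sub>R U j x" for j
      by (simp add: g_def U_diff[OF x y] algebra_simps)
    have lim: "(\<lambda>m. \<Sum>j<m. g j) \<longlonglongrightarrow> f x - f y"
    proof -
      have "g sums (f x - f y)" unfolding g_def f_def
        by (intro sums_diff summable_sums summ x y)
      then show ?thesis by (simp add: sums_def)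
    qed
    have small: "\<bar>c j x - c j y\<bar> * norm (U j x) \<le> 8 * (\<bar>c j x - c j y\<bar> * Lp_norm p x)" for j
      using mult_left_mono[OF U_le[OF x, of j], of "\<bar>c j x - c j y\<bar>"] by simp
    have "norm (\<Sum>j<m. g j) \<le> 9 * t" for m
    proof -
      have "norm (\<Sum>j<m. g j) \<le> (\<Sum>j<m. c j y * (8 * t) + 8 * (\<bar>c j x - c j y\<bar> * Lp_norm p x))"
      proof (rule sum_norm_le)
        fix j
        have "norm (g j) \<le> norm (c j y *\<^sub>R U j (x - y)) + norm ((c j x - c j y) *\<^sub>R U j x)"
          unfolding g_eq by (rule norm_triangle_ineq)
        also have "norm (c j y *\<^sub>R U j (x - y)) \<le> c j y * (8 * t)"
          using U_le[OF xmy, of j] c0[of j y] by (simp add: t_def mult_left_mono)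
        also have "norm ((c j x - c j y) *\<^sub>R U j x) \<le> 8 * (\<bar>c j x - c j y\<bar> * Lp_norm p x)" using small[of j] by simp
        finally show "norm (g j) \<le> c j y * (8 * t) + 8 * (\<bar>c j x - c j y\<bar> * Lp_norm p x)" by simp
      qed
      also have "\<dots> = (\<Sum>j<m. c j y) * (8 * t) + 8 * ((\<Sum>j<m. \<bar>c j x - c j y\<bar>) * Lp_norm p x)"
        by (simp add: sum.distrib sum_distrib_right sum_distrib_left)
      also have "\<dots> \<le> 1 * (8 * t) + 8 * (4 * \<bar>lg x - lg y\<bar> * Lp_norm p x)"
        using c_sum[where m = m and x = y] c_diff_sum[where m = m and x = x and y = y] t0 Lp_norm_nonneg
        by (intro add_mono mult_left_mono mult_right_mono) auto
      also have "\<dots> \<le> 9 * t" using log t0 by simp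
      finally show ?thesis .
    qed
    then have upper: "norm (f x - f y) \<le> 9 * t"
      by (intro Lim_bounded[OF tendsto_norm[OF lim]]) auto
    define A where "A j i = c j x * V j x i - c j y * V j y i" for j i
    have gA: "g j = (lincomb (N j) (A j) (u j))" for j
      by (simp add: g_def A_def U_def scaleR_diff_left sum_subtractf scaleR_sum_right)
    \<comment> \<open>Independence bounds each partial sum by 4/3 of all longer ones, hence of the
      limit.\<close>
    have part: "3/4 * norm (\<Sum>j<k. g j) \<le> norm (f x - f y)" for k
      by (rule Lim_bounded2[OF tendsto_norm[OF lim], of k]) (use indep in \<open>auto simp: gA\<close>)
    \<comment> \<open>A single term is the difference of two consecutive partial sums, hence the
      factor \<open>2 * 4/3 = 8/3\<close>.\<close>
    have g_le: "3/8 * norm (g j) \<le> norm (f x - f y)" for j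
    proof -
      have "norm (g j) \<le> norm (\<Sum>i<Suc j. g i) + norm (\<Sum>i<j. g i)"
        using norm_triangle_ineq4[of "\<Sum>i<Suc j. g i" "\<Sum>i<j. g i"] by simp
      then show ?thesis using part[of j] part[of "Suc j"] by linarith
    qed
    have "2 powr \<mu> t * r * t \<le> norm (f x - f y)" if "x \<noteq> y"
    proof -
      have t: "t > 0" using t0 Lp_norm_eq_0[OF p xmy] that by (auto simp: t_def less_le)
      have y0: "Lp_norm p y > 0"
      proof (rule ccontr)
        assume "\<not> Lp_norm p y > 0"
        then have "Lp_norm p x = 0" "Lp_norm p y = 0" using Lp_norm_nonneg[of p x] Lp_norm_nonneg[of p y] le by linarith+
        then show False using that Lp_norm_eq_0[OF p x] Lp_norm_eq_0[OF p y] by simp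
      qed
      have "\<mu> t \<in> \<mu> ` {0<..}" using t by (intro imageI) simp
      then have \<mu>0: "\<mu> t < 0" unfolding assms(8) by simp
      \<comment> \<open>Rounding down makes \<open>2 powr (- k)\<close> at least
        \<open>2 powr \<mu> t\<close>, while \<open>- \<mu> t < k + 1\<close> still ensures
        \<open>s k \<le> t\<close>.\<close>
      define k where "k = nat \<lfloor>- \<mu> t\<rfloor>"
      have k: "real k \<le> - \<mu> t" "- \<mu> t < real k + 1" using \<mu>0 by (auto simp: k_def)
      \<comment> \<open>At the nearest integer the tent has value at least 1/2.\<close>
      define n where "n = round (lg y)"
      obtain j where j: "annulus j = n" "depth j = k" using annulus_depth_surj by blast
      have "s k \<le> t"
      proof (rule ccontr)
        assume "\<not> s k \<le> t"
        then have "\<mu> t \<le> \<mu> (s k)" using t s(1)[of k] by (intro mono_onD[OF assms(7)]) auto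
        then show False using k(2) s(2)[of k] by simp
      qed
      moreover have "Lp_norm p y \<le> R n"
      proof -
        have "lg y \<le> real_of_int n + 1" using of_int_round_abs_le[of "lg y"] unfolding n_def by linarith
        then have "ln (Lp_norm p y) \<le> 512 * (real_of_int n + 1)" by (simp add: lg_def)
        then have "exp (ln (Lp_norm p y)) \<le> R n" unfolding R_def by (subst exp_le_cancel_iff)
        then show ?thesis using y0 by simp
      qed
      ultimately have U: "7/8 * t \<le> norm (U j (x - y))"
        using U_ge[OF xy, of j] le by (simp add: j t_def)
      define w where "w = (1/2::real)^(k + 1)"
      have w: "w > 0" by (simp add: w_def)
      have "1/2 * w \<le> c j y" unfolding c_def j w_def n_def
        by (intro mult_right_mono tent_round) auto
      then have "1/2 * w * (7/8 * t) \<le> c j y * norm (U j (x - y))"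
        using U w t by (intro mult_mono) auto
      moreover have "\<bar>c j x - c j y\<bar> * Lp_norm p x \<le> w * (t / 512)"
      proof -
        have "\<bar>c j x - c j y\<bar> \<le> \<bar>lg x - lg y\<bar> * w"
          unfolding c_diff j w_def by (intro mult_right_mono tent_lipschitz) auto
        then have "\<bar>c j x - c j y\<bar> * Lp_norm p x \<le> \<bar>lg x - lg y\<bar> * w * Lp_norm p x"
          by (intro mult_right_mono Lp_norm_nonneg)
        also have "\<dots> = w * (\<bar>lg x - lg y\<bar> * Lp_norm p x)" by simp
        also have "\<dots> \<le> w * (t / 512)" using log w by (intro mult_left_mono) auto
        finally show ?thesis .
      qed
      moreover have "c j y * norm (U j (x - y)) \<le> norm (g j) + \<bar>c j x - c j y\<bar> * norm (U j x)"
      proof -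
        have "c j y *\<^sub>R U j (x - y) = g j - (c j x - c j y) *\<^sub>R U j x" by (simp add: g_eq)
        then have "norm (c j y *\<^sub>R U j (x - y)) \<le> norm (g j) + norm ((c j x - c j y) *\<^sub>R U j x)"
          by (metis norm_triangle_ineq4)
        then show ?thesis using c0[of j y] by simp
      qed
      \<comment> \<open>The main part gives \<open>1/2 * 7/8 = 28/64\<close>, and the variation of
        the cutoff takes away \<open>8/512 = 1/64\<close>.\<close>
      ultimately have "27/64 * (w * t) \<le> norm (g j)" using small[of j] by (simp add: mult_ac)
      then have lower: "81/512 * (w * t) \<le> norm (f x - f y)" using g_le[of j] by linarith
      have "2 powr \<mu> t \<le> 2 powr (- real k)" using k(1) by (intro powr_mono) auto
      also have "\<dots> = 2 * w" by (simp add: w_def powr_minus powr_realpow power_one_over inverse_eq_divide)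
      finally have \<psi>: "2 powr \<mu> t \<le> 2 * w" .
      \<comment> \<open>The bound \<open>r < 1/16\<close> asks for
        \<open>2 * w / 16 = 64/512 * w\<close>, below the \<open>3/8 * 27/64 = 81/512\<close> times
        \<open>w\<close> that is available.\<close>
      have "2 powr \<mu> t * r * t \<le> 2 powr \<mu> t * (1/16) * t"
        using assms(5) t by (intro mult_right_mono mult_left_mono) auto
      also have "\<dots> \<le> 2 * w * (1/16) * t" using \<psi> t by (intro mult_right_mono) auto
      also have "\<dots> \<le> 81/512 * (w * t)" using w t by simp
      finally show ?thesis using lower by linarith
    qed
    then show ?thesis using upper by (simp add: t_def)
  qed
  have "?Q x y" if xy: "x \<in> M" "y \<in> M" for x y
  proof (cases "Lp_norm p x \<le> Lp_norm p y")
    case True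
    then show ?thesis by (rule main[OF xy])
  next
    case False
    have eq: "Lp_norm p (y - x) = Lp_norm p (x - y)" using Lp_norm_uminus[of p "x - y"] by simp
    from False have "Lp_norm p y \<le> Lp_norm p x" by simp
    from main[OF xy(2,1) this] show ?thesis
      unfolding eq norm_minus_commute[of "f y" "f x"] by (simp add: eq_commute[of x y])
  qed
  then show ?thesis by blast
qed

end
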